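(* Let $\mathbb{H}^r=(\mathbb{R}\times\mathbb{T})\rtimes\mathbb{R}$ be the reduced Heisenberg group. Let $v_1,v_2\in L^1(\mathbb{R})$ be such that $v_1$ is essentially bounded and $\hat{v}_2\in L^1(\mathbb{R})$, and set $v(y,z,x)=v_1(x)v_2(y)$. Then there is $S=S_{Z,v}\in VN(\mathbb{H}^r\times\mathbb{H}^r)$ such that \[ S(u)=\int_{\mathbb{H}^r}\partial_{(Z,0)}u(g,g^{-1})\,v(g)\,dg \] for every $u\in\mathcal{D}(\mathbb{H}^r\times\mathbb{H}^r)$.
   Context: $\mathbb{H}^r=(\mathbb{R}\times\mathbb{T})\rtimes\mathbb{R}$ has multiplication $(y,z,x)(y',z',x')=(y+y',zz'e^{ixy'},x+x')$ and inverse $(y,z,x)^{-1}=(-y,\bar{z}e^{ixy},-x)$. It is unimodular with Haar integral that of $\mathbb{R}\times\mathbb{T}\times\mathbb{R}$. $Z$ is the element of its Lie algebra with $\exp(hZ)=(0,e^{ih},0)$ for $h\in\mathbb{R}$. $\hat{v}_2$ is the Fourier transform of $v_2$ on $\mathbb{R}$. For a locally compact group $G$, the Fourier algebra $A(G)$ (Eymard) is the Banach algebra of all functions $u(g)=\langle\lambda(g)\xi|\eta\rangle$ with $\xi,\eta\in L^2(G)$, where $\lambda$ is the left regular representation of $G$ on $L^2(G)$; its norm is $\|u\|_A=\inf\{\|\xi\|_2\|\eta\|_2: u=\langle\lambda(\cdot)\xi|\eta\rangle\}$. Its dual is the group von Neumann algebra $VN(G)=\lambda(G)''\subset\mathcal{B}(L^2(G))$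 via $T(u)=\langle T\xi|\eta\rangle$ for $u=\langle\lambda(\cdot)\xi|\eta\rangle$. For a Lie group $G$, $\mathcal{D}(G)$ is the space of compactly supported smooth functions on $G$; it is contained in $A(G)$. For $X$ in the Lie algebra of $G$ and $u\in\mathcal{D}(G\times G)$, $\partial_{(X,0)}u(g,h)=\frac{d}{dt}u(g\exp(tX),h)|_{t=0}$. *)

theory Defs
  imports "HOL-Analysis.Analysis" "HOL-Algebra.Group"
begin

section \<open>Square integrable functions and bounded operators\<close>

text \<open>
  Elements of the Hilbert space \<open>L\<^sup>2(M)\<close> are handled through representatives: equality in
  \<open>L\<^sup>2(M)\<close> is equality almost everywhere, and values outside \<open>space M\<close> are irrelevant.
\<close>

definition L2 :: "'a measure \<Rightarrow> ('a \<Rightarrow> complex) set" where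
  "L2 M = {f \<in> borel_measurable M. integrable M (\<lambda>x. (cmod (f x))\<^sup>2)}"

definition L2_inner :: "'a measure \<Rightarrow> ('a \<Rightarrow> complex) \<Rightarrow> ('a \<Rightarrow> complex) \<Rightarrow> complex" where
  "L2_inner M f g = (LINT x|M. f x * cnj (g x))"

definition L2_norm :: "'a measure \<Rightarrow> ('a \<Rightarrow> complex) \<Rightarrow> real" where
  "L2_norm M f = sqrt (LINT x|M. (cmod (f x))\<^sup>2)"

text \<open>
  Bounded linear operators on \<open>L\<^sup>2(M)\<close>. Linearity and boundedness together force
  \<open>T f = T g\<close> almost everywhere whenever \<open>f = g\<close> almost everywhere, so such a \<open>T\<close> is a
  well-defined operator on classes.
\<close>

definition L2_operators :: "'a measure \<Rightarrow> (('a \<Rightarrow> complex) \<Rightarrow> ('a \<Rightarrow> complex)) set" where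
  "L2_operators M = {T.
     (\<forall>f\<in>L2 M. T f \<in> L2 M) \<and>
     (\<forall>f\<in>L2 M. \<forall>g\<in>L2 M. AE x in M. T (\<lambda>y. f y + g y) x = T f x + T g x) \<and>
     (\<forall>c. \<forall>f\<in>L2 M. AE x in M. T (\<lambda>y. c * f y) x = c * T f x) \<and>
     (\<exists>C. \<forall>f\<in>L2 M. L2_norm M (T f) \<le> C * L2_norm M f)}"

definition commutant ::
    "'a measure \<Rightarrow> (('a \<Rightarrow> complex) \<Rightarrow> ('a \<Rightarrow> complex)) set \<Rightarrow> (('a \<Rightarrow> complex) \<Rightarrow> ('a \<Rightarrow> complex)) set" where
  "commutant M \<A> = {T \<in> L2_operators M. \<forall>A\<in>\<A>. \<forall>f\<in>L2 M. AE x in M. T (A f) x = A (T f) x}"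


section \<open>Group von Neumann algebra and Fourier algebra\<close>

text \<open>Here \<open>G\<close> is a group and \<open>M\<close> a (left) Haar measure on it, with \<open>space M = carrier G\<close>.\<close>

definition left_regular ::
    "('a, 'm) monoid_scheme \<Rightarrow> 'a \<Rightarrow> ('a \<Rightarrow> complex) \<Rightarrow> ('a \<Rightarrow> complex)" where
  "left_regular G g \<xi> = (\<lambda>s. \<xi> (inv\<^bsub>G\<^esub> g \<otimes>\<^bsub>G\<^esub> s))"

definition group_vN ::
    "('a, 'm) monoid_scheme \<Rightarrow> 'a measure \<Rightarrow> (('a \<Rightarrow> complex) \<Rightarrow> ('a \<Rightarrow> complex)) set" where
  "group_vN G M = commutant M (commutant M (left_regular G ` carrier G))"

definition represents ::
    "('a, 'm) monoid_scheme \<Rightarrow> 'a measure \<Rightarrow> ('a \<Rightarrow> complex) \<Rightarrow> ('a \<Rightarrow> complex) \<Rightarrow> ('a \<Rightarrow> complex) \<Rightarrow> bool" where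
  "represents G M \<xi> \<eta> u \<longleftrightarrow> \<xi> \<in> L2 M \<and> \<eta> \<in> L2 M \<and>
     (\<forall>g\<in>carrier G. u g = L2_inner M (left_regular G g \<xi>) \<eta>)"

text \<open>
  The duality between \<open>VN(G)\<close> and \<open>A(G)\<close>: the value \<open>T(u)\<close> is meaningful if \<open>u\<close> lies in \<open>A(G)\<close>,
  that is, if some \<open>\<xi>\<close>, \<open>\<eta>\<close> represent \<open>u\<close>, and \<open>\<langle>T \<xi> | \<eta>\<rangle>\<close> does not depend on their choice.
\<close>

definition vN_apply ::
    "('a, 'm) monoid_scheme \<Rightarrow> 'a measure \<Rightarrow> (('a \<Rightarrow> complex) \<Rightarrow> ('a \<Rightarrow> complex)) \<Rightarrow> ('a \<Rightarrow> complex) \<Rightarrow> complex" where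
  "vN_apply G M T u = (THE c. \<exists>\<xi> \<eta>. represents G M \<xi> \<eta> u \<and> c = L2_inner M (T \<xi>) \<eta>)"


section \<open>The reduced Heisenberg group\<close>

text \<open>The circle group is the unit circle in the complex plane.\<close>

definition Hr :: "(real \<times> complex \<times> real) monoid" where
  "Hr = \<lparr>carrier = UNIV \<times> sphere 0 1 \<times> UNIV,
         mult = (\<lambda>(y, z, x) (y', z', x'). (y + y', z * z' * cis (x * y'), x + x')),
         one = (0, 1, 0)\<rparr>"

text \<open>Normalised Haar measure of the circle.\<close>

definition circle_measure :: "complex measure" where
  "circle_measure =
     distr (uniform_measure lborel {0..<2 * pi}) (restrict_space borel (sphere 0 1)) cis"

definition haar_Hr :: "(real \<times> complex \<times> real) measure" where
  "haar_Hr = lborel \<Otimes>\<^sub>M circle_measure \<Otimes>\<^sub>M lborel"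

text \<open>The one-parameter subgroup \<open>t \<mapsto> exp(tZ)\<close>.\<close>

definition exp_Z :: "real \<Rightarrow> real \<times> complex \<times> real" where
  "exp_Z t = (0, cis t, 0)"

text \<open>
  The derivative in the direction \<open>(X, 0)\<close> of a function on \<open>G \<times> G\<close>; the Lie algebra element \<open>X\<close>
  is given by its one-parameter subgroup \<open>\<gamma> t = exp(tX)\<close>.
\<close>

definition deriv_fst ::
    "('a, 'm) monoid_scheme \<Rightarrow> (real \<Rightarrow> 'a) \<Rightarrow> ('a \<times> 'b \<Rightarrow> complex) \<Rightarrow> 'a \<times> 'b \<Rightarrow> complex" where
  "deriv_fst G \<gamma> u = (\<lambda>(g, h). vector_derivative (\<lambda>t. u (g \<otimes>\<^bsub>G\<^esub> \<gamma> t, h)) (at 0))"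


section \<open>Test functions\<close>

primrec Ck :: "nat \<Rightarrow> ('a::euclidean_space \<Rightarrow> 'b::real_normed_vector) \<Rightarrow> bool" where
  "Ck 0 f \<longleftrightarrow> continuous_on UNIV f"
| "Ck (Suc k) f \<longleftrightarrow>
     (\<forall>x. f differentiable at x) \<and> (\<forall>b\<in>Basis. Ck k (\<lambda>x. frechet_derivative f (at x) b))"

definition smooth :: "('a::euclidean_space \<Rightarrow> 'b::real_normed_vector) \<Rightarrow> bool" where
  "smooth f \<longleftrightarrow> (\<forall>k. Ck k f)"

text \<open>
  The covering map of the manifold \<open>Hr\<close>; it is a local diffeomorphism, so a function on \<open>Hr\<close>
  (or on \<open>Hr \<times> Hr\<close>) is smooth iff its lift to the covering Euclidean space is.
\<close>

definition cover_Hr :: "real \<times> real \<times> real \<Rightarrow> real \<times> complex \<times> real" where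
  "cover_Hr = (\<lambda>(y, \<theta>, x). (y, cis \<theta>, x))"

definition test_functions_Hr2 ::
    "((real \<times> complex \<times> real) \<times> (real \<times> complex \<times> real) \<Rightarrow> complex) set" where
  "test_functions_Hr2 = {u.
     smooth (\<lambda>(a, b). u (cover_Hr a, cover_Hr b)) \<and>
     (\<exists>K. compact K \<and> K \<subseteq> carrier (Hr \<times>\<times> Hr) \<and> (\<forall>p \<in> carrier (Hr \<times>\<times> Hr) - K. u p = 0))}"


section \<open>Fourier transform on the real line\<close>

definition fourier :: "(real \<Rightarrow> complex) \<Rightarrow> real \<Rightarrow> complex" where
  "fourier f s = (LINT y|lborel. f y * cis (- (s * y)))"


section \<open>Consistency\<close>

lemma group_Hr: "group Hr"
proof (rule groupI)
  fix p assume "p \<in> carrier Hr"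
  then obtain y z x where p: "p = (y, z, x)" and z: "cmod z = 1"
    by (auto simp: Hr_def)
  have "z * cnj z = 1"
    using z by (metis complex_norm_square of_real_1 one_power2)
  then have "(- y, cnj z * cis (x * y), - x) \<otimes>\<^bsub>Hr\<^esub> p = \<one>\<^bsub>Hr\<^esub>"
    by (simp add: p Hr_def cis_mult mult.commute mult.left_commute)
  moreover have "(- y, cnj z * cis (x * y), - x) \<in> carrier Hr"
    using z by (simp add: Hr_def norm_mult)
  ultimately show "\<exists>q\<in>carrier Hr. q \<otimes>\<^bsub>Hr\<^esub> p = \<one>\<^bsub>Hr\<^esub>"
    by blast
qed (auto simp: Hr_def norm_mult cis_mult algebra_simps)

lemma inv_Hr:
  assumes "cmod z = 1"
  shows "inv\<^bsub>Hr\<^esub> (y, z, x) = (- y, cnj z * cis (x * y), - x)"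
proof (rule group.inv_equality [OF group_Hr])
  have "z * cnj z = 1"
    using assms by (metis complex_norm_square of_real_1 one_power2)
  then show "(- y, cnj z * cis (x * y), - x) \<otimes>\<^bsub>Hr\<^esub> (y, z, x) = \<one>\<^bsub>Hr\<^esub>"
    by (simp add: Hr_def cis_mult mult.commute mult.left_commute)
qed (use assms in \<open>auto simp: Hr_def norm_mult\<close>)

lemma space_haar_Hr: "space haar_Hr = carrier Hr"
  by (simp add: haar_Hr_def circle_measure_def Hr_def space_pair_measure space_restrict_space)

end

theory Submission
  imports Defs "HOL-Probability.Probability"
begin

text \<open>
  Along the central circle of both factors, \<open>\<xi>\<close> and \<open>\<eta>\<close> decompose into Fourier components, and
  integrating a coefficient function over \<open>(g, g\<inverse>)\<close> only pairs components with equal index \<open>n\<close> in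
  both factors. There \<open>\<partial>\<^bsub>(Z,0)\<^esub>\<close> contributes a factor of size \<open>\<bar>n\<bar>\<close>, which has to be compensated by
  the remaining integral over \<open>(x, y)\<close>. With the sum of the two arguments held fixed and \<open>v\<^sub>2\<close> written as the
  inverse Fourier transform of its transform, that integral factors through the partial Fourier transforms in \<open>y\<close>
  of the components of \<open>\<xi>\<close> and \<open>\<eta>\<close> at the frequencies \<open>s + n x\<close> and \<open>s - n x\<close>. Cauchy--Schwarz and
  Plancherel in the variable \<open>n x\<close> gain the factor \<open>1 / \<bar>n\<bar>\<close>, the constant being the supremum of
  \<open>v\<^sub>1\<close> times the \<open>L\<^sup>1\<close> norm of the transform of \<open>v\<^sub>2\<close>; Bessel's inequality sums the estimates over \<open>n\<close>.

  Hence truncating the Fourier series of the derivative gives functionals that are uniformly bounded on the Fourier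
  algebra, and \<open>S\<close> is a cluster point of them. On a test function the truncations converge by dominated
  convergence. A test function lies in the Fourier algebra since the operators \<open>1 - X\<close> have explicit inverses
  for left invariant vector fields \<open>X\<close>, whose composition is convolution by a square integrable function.
\<close>

section \<open>The Hilbert space of square integrable functions\<close>

text \<open>The gain comes from non-commutativity. Translation by \<open>(g, inv g)\<close> moves
  the two plane points in opposite directions, and the twist in the group law multiplies the
  \<open>n\<close>-th component by a phase whose frequency in \<open>y\<close> is proportional to
  \<open>n * x\<close>. Integrating over \<open>x\<close> therefore sweeps the frequency axis with
  speed |n|, and this pays for the derivative. The factor \<open>2 * pi\<close> lost in Plancherel's
  inequality is the one that the inversion formula divides by, so neither appears in the final
  constant.

  Convergence of the truncations is established on test functions alone; on the rest of the Fourier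
  algebra the uniform bound yields just a cluster point, and that suffices. The functionals must be
  attached to functions \<open>u\<close> and not to pairs of vectors: both the commutation with the
  commutant and the definite description in \<open>vN_apply\<close> rest on this.

  Vectors and operators are handled through representatives, so operator identities hold almost
  everywhere and are obtained by testing against all vectors. Group inverses are replaced by
  explicit formulas, and test functions by functions rebuilt from their lifts, wherever
  measurability is at stake.\<close>

lemma L2I: "f \<in> borel_measurable M \<Longrightarrow> integrable M (\<lambda>x. (cmod (f x))\<^sup>2) \<Longrightarrow> f \<in> L2 M"
  by (simp add: L2_def)

lemma L2_measurable [measurable_dest]: "f \<in> L2 M \<Longrightarrow> f \<in> borel_measurable M"
  and L2_integrable: "f \<in> L2 M \<Longrightarrow> integrable M (\<lambda>x. (cmod (f x))\<^sup>2)"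
  by (simp_all add: L2_def)

lemma L2_iff_nn:
  assumes "f \<in> borel_measurable M"
  shows "f \<in> L2 M \<longleftrightarrow> (\<integral>\<^sup>+x. ennreal ((cmod (f x))\<^sup>2) \<partial>M) < \<infinity>"
  using assms by (simp add: L2_def integrable_iff_bounded)

lemma borel_measurable_cnj [measurable (raw)]:
  "f \<in> borel_measurable M \<Longrightarrow> (\<lambda>x. cnj (f x)) \<in> borel_measurable M"
  by (rule borel_measurable_continuous_on [where f = cnj]) (auto intro: continuous_intros)

lemma norm_mult_le_squares:
  fixes a b :: complex
  shows "cmod a * cmod b \<le> (cmod a)\<^sup>2 + (cmod b)\<^sup>2"
proof -
  have "2 * (cmod a * cmod b) \<le> (cmod a)\<^sup>2 + (cmod b)\<^sup>2"
    using sum_squares_bound [of "cmod a" "cmod b"] by simp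
  moreover have "0 \<le> cmod a * cmod b" by simp
  ultimately show ?thesis by linarith
qed

lemma L2_mult_integrable:
  assumes "f \<in> L2 M" "g \<in> L2 M"
  shows "integrable M (\<lambda>x. f x * cnj (g x))"
proof (rule Bochner_Integration.integrable_bound)
  show "integrable M (\<lambda>x. (cmod (f x))\<^sup>2 + (cmod (g x))\<^sup>2)"
    using assms by (simp add: L2_integrable)
  show "(\<lambda>x. f x * cnj (g x)) \<in> borel_measurable M"
    using assms[THEN L2_measurable] by simp
qed (use norm_mult_le_squares in \<open>auto simp: norm_mult\<close>)

lemma L2_norm_mult_integrable:
  assumes "f \<in> L2 M" "g \<in> L2 M"
  shows "integrable M (\<lambda>x. cmod (f x) * cmod (g x))"
  using integrable_norm[OF L2_mult_integrable[OF assms]] by (simp add: norm_mult)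

lemma L2_add:
  assumes "f \<in> L2 M" "g \<in> L2 M"
  shows "(\<lambda>x. f x + g x) \<in> L2 M"
proof (rule L2I)
  have "(cmod (f x + g x))\<^sup>2 \<le> 2 * ((cmod (f x))\<^sup>2 + (cmod (g x))\<^sup>2)" for x
  proof -
    have "(cmod (f x + g x))\<^sup>2 \<le> (cmod (f x) + cmod (g x))\<^sup>2"
      by (intro power_mono norm_triangle_ineq) auto
    also have "\<dots> \<le> 2 * ((cmod (f x))\<^sup>2 + (cmod (g x))\<^sup>2)"
      using sum_squares_bound [of "cmod (f x)" "cmod (g x)"] by (simp add: power2_sum)
    finally show ?thesis .
  qed
  then show "integrable M (\<lambda>x. (cmod (f x + g x))\<^sup>2)"
    using assms[THEN L2_integrable] assms[THEN L2_measurable]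
    by (intro Bochner_Integration.integrable_bound
          [of M "\<lambda>x. 2 * ((cmod (f x))\<^sup>2 + (cmod (g x))\<^sup>2)" "\<lambda>x. (cmod (f x + g x))\<^sup>2"]) auto
qed (use assms[THEN L2_measurable] in simp)

lemma L2_scale:
  assumes "f \<in> L2 M"
  shows "(\<lambda>x. c * f x) \<in> L2 M"
  using assms by (auto simp: L2_def norm_mult power_mult_distrib)

lemma L2_diff:
  assumes "f \<in> L2 M" "g \<in> L2 M"
  shows "(\<lambda>x. f x - g x) \<in> L2 M"
  using L2_add[OF assms(1) L2_scale[OF assms(2), of "-1"]] by simp

lemma L2_inner_add_left:
  assumes "f \<in> L2 M" "g \<in> L2 M" "h \<in> L2 M"
  shows "L2_inner M (\<lambda>x. f x + g x) h = L2_inner M f h + L2_inner M g h"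
  using Bochner_Integration.integral_add[OF L2_mult_integrable[OF assms(1,3)] L2_mult_integrable[OF assms(2,3)]]
  by (simp add: L2_inner_def distrib_right)

lemma L2_inner_diff_left:
  assumes "f \<in> L2 M" "g \<in> L2 M" "h \<in> L2 M"
  shows "L2_inner M (\<lambda>x. f x - g x) h = L2_inner M f h - L2_inner M g h"
  using Bochner_Integration.integral_diff[OF L2_mult_integrable[OF assms(1,3)] L2_mult_integrable[OF assms(2,3)]]
  by (simp add: L2_inner_def left_diff_distrib)

lemma L2_inner_scale_left: "L2_inner M (\<lambda>x. c * f x) h = c * L2_inner M f h"
  unfolding L2_inner_def by (simp add: mult.assoc)

lemma L2_inner_cnj: "cnj (L2_inner M f g) = L2_inner M g f"
  unfolding L2_inner_def by (simp flip: Bochner_Integration.integral_cnj add: mult.commute)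

lemma L2_inner_add_right:
  assumes "f \<in> L2 M" "g \<in> L2 M" "h \<in> L2 M"
  shows "L2_inner M h (\<lambda>x. f x + g x) = L2_inner M h f + L2_inner M h g"
  using Bochner_Integration.integral_add[OF L2_mult_integrable[OF assms(3,1)] L2_mult_integrable[OF assms(3,2)]]
  by (simp add: L2_inner_def distrib_left)

lemma L2_inner_diff_right:
  assumes "f \<in> L2 M" "g \<in> L2 M" "h \<in> L2 M"
  shows "L2_inner M h (\<lambda>x. f x - g x) = L2_inner M h f - L2_inner M h g"
  using Bochner_Integration.integral_diff[OF L2_mult_integrable[OF assms(3,1)] L2_mult_integrable[OF assms(3,2)]]
  by (simp add: L2_inner_def right_diff_distrib)

lemma L2_inner_scale_right: "L2_inner M h (\<lambda>x. c * f x) = cnj c * L2_inner M h f"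
proof -
  have "cnj (L2_inner M (\<lambda>x. c * f x) h) = cnj c * cnj (L2_inner M f h)"
    by (simp add: L2_inner_scale_left)
  then show ?thesis by (simp only: L2_inner_cnj)
qed

section \<open>Norms, the Cauchy-Schwarz inequality and equality almost everywhere\<close>

lemma L2_norm_nonneg [simp]: "0 \<le> L2_norm M f"
  by (simp add: L2_norm_def)

lemma L2_norm_power2: "(L2_norm M f)\<^sup>2 = (LINT x|M. (cmod (f x))\<^sup>2)"
  by (simp add: L2_norm_def)

lemma L2_inner_self: "L2_inner M f f = complex_of_real ((L2_norm M f)\<^sup>2)"
  unfolding L2_norm_power2 L2_inner_def by (simp flip: complex_norm_square of_real_power integral_of_real)

lemma L2_norm_nn:
  assumes "f \<in> L2 M"
  shows "(\<integral>\<^sup>+x. ennreal ((cmod (f x))\<^sup>2) \<partial>M) = ennreal ((L2_norm M f)\<^sup>2)"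
  unfolding L2_norm_power2 by (rule nn_integral_eq_integral) (use assms in \<open>auto simp: L2_integrable\<close>)

text \<open>A quadratic polynomial without negative values has nonpositive discriminant. The
  degenerate case \<open>a = 0\<close> has to be included, because the squared norm put in for
  \<open>a\<close> may vanish.\<close>

lemma discriminant_le:
  fixes a b c :: real
  assumes "0 \<le> a" and nonneg: "\<And>t. 0 \<le> a * t\<^sup>2 - 2 * c * t + b"
  shows "c\<^sup>2 \<le> a * b"
proof (cases "a = 0")
  case True
  have "c = 0"
  proof (rule ccontr)
    assume "c \<noteq> 0"
    \<comment> \<open>At this \<open>t\<close> the polynomial takes the value -1.\<close>
    with nonneg[of "(b + 1) / (2 * c)"] True show False by simp
  qed
  then show ?thesis using True by simp
next
  case False
  have "0 \<le> a * (a * (c / a)\<^sup>2 - 2 * c * (c / a) + b)"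
    by (rule mult_nonneg_nonneg[OF assms(1) nonneg])
  also have "\<dots> = a * b - c\<^sup>2"
    using False by (simp add: field_simps power2_eq_square)
  finally show ?thesis by simp
qed

lemma L2_norm_mult_le:
  assumes f: "f \<in> L2 M" and g: "g \<in> L2 M"
  shows "(LINT x|M. cmod (f x) * cmod (g x)) \<le> L2_norm M f * L2_norm M g"
proof -
  let ?I = "LINT x|M. cmod (f x) * cmod (g x)"
  have "0 \<le> (L2_norm M f)\<^sup>2 * t\<^sup>2 - 2 * ?I * t + (L2_norm M g)\<^sup>2" for t :: real
  proof -
    have "0 \<le> (LINT x|M. (t * cmod (f x) - cmod (g x))\<^sup>2)" by simp
    also have "\<dots> = (LINT x|M. t\<^sup>2 * (cmod (f x))\<^sup>2 - (2 * t) * (cmod (f x) * cmod (g x)) + (cmod (g x))\<^sup>2)"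
      by (intro Bochner_Integration.integral_cong) (auto simp: power2_eq_square algebra_simps)
    also have "\<dots> = t\<^sup>2 * (L2_norm M f)\<^sup>2 - (2 * t) * ?I + (L2_norm M g)\<^sup>2"
      using f g by (simp add: L2_norm_power2 L2_integrable L2_norm_mult_integrable)
    finally show ?thesis by (simp add: algebra_simps)
  qed
  then have "?I\<^sup>2 \<le> (L2_norm M f)\<^sup>2 * (L2_norm M g)\<^sup>2"
    by (intro discriminant_le) auto
  then have "?I\<^sup>2 \<le> (L2_norm M f * L2_norm M g)\<^sup>2"
    by (simp only: power_mult_distrib)
  then show ?thesis
    by (rule power2_le_imp_le) simp
qed

lemma L2_Cauchy_Schwarz:
  assumes f: "f \<in> L2 M" and g: "g \<in> L2 M"
  shows "cmod (L2_inner M f g) \<le> L2_norm M f * L2_norm M g"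
proof -
  have "cmod (L2_inner M f g) \<le> (LINT x|M. cmod (f x * cnj (g x)))"
    unfolding L2_inner_def by (rule integral_norm_bound)
  also have "\<dots> \<le> L2_norm M f * L2_norm M g"
    using L2_norm_mult_le[OF f g] by (simp add: norm_mult)
  finally show ?thesis .
qed

text \<open>Obtained by testing with the difference of \<open>f\<close> and \<open>g\<close>. It
  converts identities between scalar products into identities of operators on
  representatives.\<close>

lemma L2_eq_AE:
  assumes f: "f \<in> L2 M" and g: "g \<in> L2 M" and eq: "\<And>h. h \<in> L2 M \<Longrightarrow> L2_inner M f h = L2_inner M g h"
  shows "AE x in M. f x = g x"
proof -
  let ?d = "\<lambda>x. f x - g x"
  have d: "?d \<in> L2 M" by (rule L2_diff[OF f g])
  have "L2_inner M ?d ?d = 0"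
    using eq[OF d] by (simp add: L2_inner_diff_left f g d)
  then have "(LINT x|M. (cmod (?d x))\<^sup>2) = 0"
    by (simp add: L2_inner_self L2_norm_power2)
  then have "AE x in M. (cmod (?d x))\<^sup>2 = 0"
    by (subst (asm) integral_nonneg_eq_0_iff_AE) (use L2_integrable[OF d] in auto)
  then show ?thesis by eventually_elim simp
qed

lemma L2_inner_cong_AE:
  assumes "f \<in> L2 M" "f' \<in> L2 M" "g \<in> L2 M" "AE x in M. f x = f' x"
  shows "L2_inner M f g = L2_inner M f' g"
  unfolding L2_inner_def
  by (rule integral_cong_AE) (use assms assms(1-3)[THEN L2_measurable] in \<open>auto elim: eventually_mono\<close>)

section \<open>Completeness and the Riesz representation theorem\<close>

lemma L2_norm_add_square:
  assumes f: "f \<in> L2 M" and g: "g \<in> L2 M"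
  shows "(L2_norm M (\<lambda>x. f x + g x))\<^sup>2 = (L2_norm M f)\<^sup>2 + 2 * Re (L2_inner M f g) + (L2_norm M g)\<^sup>2"
proof -
  have "complex_of_real ((L2_norm M (\<lambda>x. f x + g x))\<^sup>2) =
     L2_inner M f f + L2_inner M f g + (L2_inner M g f + L2_inner M g g)"
    by (simp add: L2_inner_self[symmetric] L2_inner_add_left L2_inner_add_right f g L2_add del: of_real_power)
  also have "L2_inner M g f = cnj (L2_inner M f g)" by (simp add: L2_inner_cnj)
  finally have "complex_of_real ((L2_norm M (\<lambda>x. f x + g x))\<^sup>2) =
     complex_of_real ((L2_norm M f)\<^sup>2) + (L2_inner M f g + cnj (L2_inner M f g)) + complex_of_real ((L2_norm M g)\<^sup>2)"
    by (simp add: L2_inner_self)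
  also have "L2_inner M f g + cnj (L2_inner M f g) = complex_of_real (2 * Re (L2_inner M f g))"
    by (simp add: complex_add_cnj)
  finally show ?thesis
    by (simp only: of_real_add[symmetric] of_real_eq_iff)
qed

lemma L2_norm_scale: "L2_norm M (\<lambda>x. c * f x) = cmod c * L2_norm M f"
  by (simp add: L2_norm_def norm_mult power_mult_distrib real_sqrt_mult)

text \<open>
  The geometric rate allows convergence almost everywhere to be read off from one weighted series, since
  \<open>d \<le> 2 ^ k * d\<^sup>2 + (1/2) ^ k\<close>.
\<close>
lemma L2_complete:
  fixes f :: "nat \<Rightarrow> 'a \<Rightarrow> complex"
  assumes f: "\<And>k. f k \<in> L2 M"
    and cauchy: "\<And>j k. k \<le> j \<Longrightarrow> (L2_norm M (\<lambda>x. f j x - f k x))\<^sup>2 \<le> (1/8) ^ k"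
  obtains h where "h \<in> L2 M" "\<And>k. (L2_norm M (\<lambda>x. f k x - h x))\<^sup>2 \<le> (1/8) ^ k"
proof -
  have [measurable]: "f k \<in> borel_measurable M" for k using f[THEN L2_measurable] .
  let ?d = "\<lambda>k x. cmod (f (Suc k) x - f k x)"
  have nn: "(\<integral>\<^sup>+x. ennreal ((cmod (f j x - f k x))\<^sup>2) \<partial>M) \<le> ennreal ((1/8) ^ k)" if "k \<le> j" for j k
    by (subst L2_norm_nn[OF L2_diff[OF f f]]) (intro ennreal_leI cauchy that)
  have "(\<integral>\<^sup>+x. (\<Sum>k. ennreal (2 ^ k * (?d k x)\<^sup>2)) \<partial>M) = (\<Sum>k. \<integral>\<^sup>+x. ennreal (2 ^ k * (?d k x)\<^sup>2) \<partial>M)"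
    by (rule nn_integral_suminf) simp
  also have "\<dots> \<le> (\<Sum>k. ennreal ((1/4) ^ k))"
  proof (intro suminf_le allI)
    fix k
    have "(\<integral>\<^sup>+x. ennreal (2 ^ k * (?d k x)\<^sup>2) \<partial>M) = ennreal (2 ^ k) * (\<integral>\<^sup>+x. ennreal ((?d k x)\<^sup>2) \<partial>M)"
      by (subst nn_integral_cmult[symmetric]) (auto simp: ennreal_mult)
    also have "\<dots> \<le> ennreal (2 ^ k) * ennreal ((1/8) ^ k)"
      by (intro mult_left_mono nn) auto
    also have "\<dots> = ennreal ((1/4) ^ k)"
      by (simp add: ennreal_mult[symmetric] power_mult_distrib[symmetric])
    finally show "(\<integral>\<^sup>+x. ennreal (2 ^ k * (?d k x)\<^sup>2) \<partial>M) \<le> ennreal ((1/4) ^ k)" .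
  qed auto
  also have "\<dots> < \<infinity>"
    by (subst suminf_ennreal_eq[of "\<lambda>k. (1/4::real) ^ k"]) (auto intro!: summable_sums summable_geometric)
  finally have "AE x in M. (\<Sum>k. ennreal (2 ^ k * (?d k x)\<^sup>2)) \<noteq> \<infinity>"
    by (intro nn_integral_PInf_AE) auto
  then have conv: "AE x in M. convergent (\<lambda>k. f k x)"
  proof eventually_elim
    case (elim x)
    have sm: "summable (\<lambda>k. 2 ^ k * (?d k x)\<^sup>2)"
      by (rule summable_suminf_not_top) (use elim in auto)
    have "summable (\<lambda>k. 2 ^ k * (?d k x)\<^sup>2 + (1/2) ^ k)"
      by (intro summable_add sm summable_geometric) auto
    moreover have "norm (?d k x) \<le> 2 ^ k * (?d k x)\<^sup>2 + (1/2) ^ k" for k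
    proof -
      have "0 \<le> (1/2) ^ k * (2 ^ k * ?d k x - 1)\<^sup>2" by simp
      also have "\<dots> = 2 ^ k * (?d k x)\<^sup>2 - 2 * ?d k x + (1/2) ^ k"
        by (simp add: power2_eq_square algebra_simps power_divide)
      finally show ?thesis using norm_ge_zero[of "f (Suc k) x - f k x"] by (simp del: norm_ge_zero)
    qed
    ultimately have "summable (\<lambda>k. ?d k x)"
      by (rule summable_comparison_test'[where N = 0])
    then have "summable (\<lambda>k. f (Suc k) x - f k x)" by (rule summable_norm_cancel)
    then have "convergent (\<lambda>n. f n x - f 0 x)"
      using sum_lessThan_telescope[of "\<lambda>k. f k x"] by (simp add: summable_iff_convergent)
    then have "convergent (\<lambda>n. (f n x - f 0 x) + f 0 x)" by (intro convergent_add convergent_const)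
    then show ?case by simp
  qed
  \<comment> \<open>Where the sequence diverges, \<open>lim\<close> is an arbitrary value; by
    \<open>conv\<close> this concerns a null set only.\<close>
  define h where "h x = lim (\<lambda>k. f k x)" for x
  have [measurable]: "h \<in> borel_measurable M" unfolding h_def by measurable
  \<comment> \<open>Fatou's lemma, applied to the Cauchy estimate for all
    \<open>j \<ge> k\<close>.\<close>
  have bnd: "(\<integral>\<^sup>+x. ennreal ((cmod (f k x - h x))\<^sup>2) \<partial>M) \<le> ennreal ((1/8) ^ k)" for k
  proof -
    have "(\<integral>\<^sup>+x. ennreal ((cmod (f k x - h x))\<^sup>2) \<partial>M)
        = (\<integral>\<^sup>+x. liminf (\<lambda>j. ennreal ((cmod (f j x - f k x))\<^sup>2)) \<partial>M)"
    proof (rule nn_integral_cong_AE, use conv in eventually_elim)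
      fix x assume "convergent (\<lambda>k. f k x)"
      then have "(\<lambda>j. f j x) \<longlonglongrightarrow> h x" by (simp add: h_def convergent_LIMSEQ_iff)
      then have "(\<lambda>j. ennreal ((cmod (f j x - f k x))\<^sup>2)) \<longlonglongrightarrow> ennreal ((cmod (h x - f k x))\<^sup>2)"
        by (intro tendsto_intros tendsto_ennrealI)
      from lim_imp_Liminf[OF _ this]
      show "ennreal ((cmod (f k x - h x))\<^sup>2) = liminf (\<lambda>j. ennreal ((cmod (f j x - f k x))\<^sup>2))"
        by (simp add: norm_minus_commute)
    qed
    also have "\<dots> \<le> liminf (\<lambda>j. \<integral>\<^sup>+x. ennreal ((cmod (f j x - f k x))\<^sup>2) \<partial>M)"
      by (rule nn_integral_liminf) simp
    also have "\<dots> \<le> limsup (\<lambda>j. \<integral>\<^sup>+x. ennreal ((cmod (f j x - f k x))\<^sup>2) \<partial>M)"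
      by (rule Liminf_le_Limsup) simp
    also have "\<dots> \<le> ennreal ((1/8) ^ k)"
      by (rule Limsup_bounded) (auto intro!: eventually_sequentiallyI[of k] nn)
    finally show ?thesis .
  qed
  have d: "(\<lambda>x. f k x - h x) \<in> L2 M" for k
    using bnd[of k] by (subst L2_iff_nn) (auto intro: le_less_trans)
  have "h \<in> L2 M"
    using L2_diff[OF f[of 0] d[of 0]] by simp
  moreover have "(L2_norm M (\<lambda>x. f k x - h x))\<^sup>2 \<le> (1/8) ^ k" for k
    using bnd[of k] unfolding L2_norm_nn[OF d] by (simp add: ennreal_le_iff)
  ultimately show ?thesis by (rule that)
qed

text \<open>
  The representing vector minimises \<open>J f = \<parallel>f\<parallel>\<^sup>2 - 2 * Re (\<phi> f)\<close>; by the parallelogram law,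
  minimising sequences are Cauchy sequences.
\<close>
theorem L2_Riesz:
  fixes \<phi> :: "('a \<Rightarrow> complex) \<Rightarrow> complex"
  assumes add: "\<And>f g. f \<in> L2 M \<Longrightarrow> g \<in> L2 M \<Longrightarrow> \<phi> (\<lambda>x. f x + g x) = \<phi> f + \<phi> g"
    and scale: "\<And>c f. f \<in> L2 M \<Longrightarrow> \<phi> (\<lambda>x. c * f x) = c * \<phi> f"
    and bound: "\<And>f. f \<in> L2 M \<Longrightarrow> cmod (\<phi> f) \<le> C * L2_norm M f"
  obtains h where "h \<in> L2 M" "\<And>f. f \<in> L2 M \<Longrightarrow> \<phi> f = L2_inner M f h"
proof -
  define J where "J f = (L2_norm M f)\<^sup>2 - 2 * Re (\<phi> f)" for f
  have low: "- C\<^sup>2 \<le> J f" if "f \<in> L2 M" for f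
  proof -
    have "Re (\<phi> f) \<le> C * L2_norm M f"
      using bound[OF that] complex_Re_le_cmod order_trans by blast
    moreover have "0 \<le> (L2_norm M f - C)\<^sup>2" by simp
    ultimately show ?thesis by (simp add: J_def power2_eq_square algebra_simps)
  qed
  have zero: "(\<lambda>x. 0) \<in> L2 M" by (simp add: L2_def)
  define m where "m = (INF f\<in>L2 M. J f)"
  have bdd: "bdd_below (J ` L2 M)" using low by (intro bdd_belowI[where m = "- C\<^sup>2"]) auto
  have m: "m \<le> J f" if "f \<in> L2 M" for f
    unfolding m_def by (rule cINF_lower[OF bdd that])
  have ex: "\<exists>f\<in>L2 M. J f < m + e" if "e > 0" for e
  proof (rule ccontr)
    assume "\<not> ?thesis"
    then have "m + e \<le> (INF f\<in>L2 M. J f)" using zero by (intro cINF_greatest) (auto simp: not_less)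
    then show False using that by (simp add: m_def)
  qed
  \<comment> \<open>By \<open>par\<close>, the squared distance of \<open>F j\<close> and
    \<open>F k\<close> is at most \<open>2 * \<epsilon> j + 2 * \<epsilon> k\<close>, hence at most
    \<open>4 * \<epsilon> k\<close> for \<open>k \<le> j\<close>; the value is chosen to meet the
    rate demanded by \<open>L2_complete\<close>.\<close>
  define \<epsilon> :: "nat \<Rightarrow> real" where "\<epsilon> k = (1/8) ^ k / 4" for k
  have eps: "\<epsilon> k > 0" for k by (simp add: \<epsilon>_def)
  have "\<exists>F. \<forall>k. F k \<in> L2 M \<and> J (F k) < m + \<epsilon> k"
    by (intro choice allI) (use ex[OF eps] in blast)
  then obtain F where F: "\<And>k. F k \<in> L2 M" and JF: "\<And>k. J (F k) < m + \<epsilon> k" by blast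
  have J_line: "J (\<lambda>x. f x + c * g x) =
      J f + 2 * Re (cnj c * L2_inner M f g - c * \<phi> g) + (cmod c)\<^sup>2 * (L2_norm M g)\<^sup>2"
    if "f \<in> L2 M" "g \<in> L2 M" for f g c
    using that by (simp add: J_def L2_norm_add_square L2_scale add scale L2_inner_scale_right
        L2_norm_scale power_mult_distrib)
  have par: "(L2_norm M (\<lambda>x. f x - g x))\<^sup>2 = 2 * J f + 2 * J g - 4 * J (\<lambda>x. 1/2 * f x + 1/2 * g x)"
    if f: "f \<in> L2 M" and g: "g \<in> L2 M" for f g
  proof -
    have 1: "(L2_norm M (\<lambda>x. f x - g x))\<^sup>2 = (L2_norm M f)\<^sup>2 - 2 * Re (L2_inner M f g) + (L2_norm M g)\<^sup>2"
      using L2_norm_add_square[OF f L2_scale[OF g, of "-1"]] L2_inner_scale_right[of M f "-1" g]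
        L2_norm_scale[of M "-1" g] by simp
    have 2: "(L2_norm M (\<lambda>x. 1/2 * f x + 1/2 * g x))\<^sup>2 =
        1/4 * (L2_norm M f)\<^sup>2 + 1/2 * Re (L2_inner M f g) + 1/4 * (L2_norm M g)\<^sup>2"
      unfolding L2_norm_add_square[OF L2_scale[OF f] L2_scale[OF g]]
        L2_norm_scale L2_inner_scale_left L2_inner_scale_right
      by (simp add: power_mult_distrib power2_eq_square)
    have 3: "\<phi> (\<lambda>x. 1/2 * f x + 1/2 * g x) = 1/2 * \<phi> f + 1/2 * \<phi> g"
      by (simp only: add[OF L2_scale[OF f] L2_scale[OF g]] scale f g)
    show ?thesis unfolding J_def 1 2 3 by (simp add: algebra_simps)
  qed
  have F_Cauchy: "(L2_norm M (\<lambda>x. F j x - F k x))\<^sup>2 \<le> (1/8) ^ k" if "k \<le> j" for j k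
  proof -
    have "\<epsilon> j \<le> \<epsilon> k" using that by (simp add: \<epsilon>_def power_decreasing)
    then show ?thesis
      using m[OF L2_add[OF L2_scale[OF F[of j], of "1/2"] L2_scale[OF F[of k], of "1/2"]]] JF[of j] JF[of k]
      unfolding par[OF F F] \<epsilon>_def by linarith
  qed
  obtain h where h: "h \<in> L2 M" and Fh: "\<And>k. (L2_norm M (\<lambda>x. F k x - h x))\<^sup>2 \<le> (1/8) ^ k"
    using L2_complete[of F M, OF F F_Cauchy] by blast
  have "\<phi> f = L2_inner M f h" if f: "f \<in> L2 M" for f
  proof -
    \<comment> \<open>The defect of \<open>F k\<close> as a representing vector. Since
      \<open>F k\<close> almost minimises \<open>J\<close>, moving it along \<open>f\<close> cannot
      lower \<open>J\<close> by much, and this forces the defect to be small.\<close>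
    define E where "E k = \<phi> f - L2_inner M f (F k)" for k
    have small: "cmod (E k) ^ 2 \<le> \<epsilon> k * ((L2_norm M f)\<^sup>2 + 1)" for k
    proof -
      define N where "N = (L2_norm M f)\<^sup>2 + 1"
      have N: "N > 0" "(L2_norm M f)\<^sup>2 \<le> N" by (auto simp: N_def add_nonneg_pos)
      \<comment> \<open>The minimiser of the quadratic expression in \<open>c\<close> that
        \<open>J_line\<close> gives, with \<open>N\<close> in place of the squared norm of
        \<open>f\<close>; the summand 1 in \<open>N\<close> keeps the denominator positive.\<close>
      define c where "c = cnj (E k) / N"
      have "m \<le> J (\<lambda>x. F k x + c * f x)" by (intro m L2_add F L2_scale f)
      also have "\<dots> = J (F k) - 2 * Re (c * E k) + (cmod c)\<^sup>2 * (L2_norm M f)\<^sup>2"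
      proof -
        have "Re (cnj c * L2_inner M (F k) f) = Re (c * L2_inner M f (F k))"
          by (metis L2_inner_cnj complex_cnj_mult complex_cnj_cnj complex_cnj(1) cnj.simps(1))
        then show ?thesis unfolding J_line[OF F f] by (simp add: E_def algebra_simps)
      qed
      also have "c * E k = of_real ((cmod (E k))\<^sup>2 / N)"
        by (simp add: c_def complex_norm_square mult.commute del: of_real_power)
      also have "(cmod c)\<^sup>2 * (L2_norm M f)\<^sup>2 \<le> (cmod c)\<^sup>2 * N"
        by (intro mult_left_mono N) auto
      also have "(cmod c)\<^sup>2 * N = (cmod (E k))\<^sup>2 / N"
        using N by (simp add: c_def norm_divide power_divide power2_eq_square)
      finally have "m \<le> J (F k) - 2 * ((cmod (E k))\<^sup>2 / N) + (cmod (E k))\<^sup>2 / N" by simp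
      then have "(cmod (E k))\<^sup>2 / N \<le> \<epsilon> k" using JF[of k] by linarith
      then show ?thesis using N by (simp add: N_def field_simps)
    qed
    have eps0: "\<epsilon> \<longlonglongrightarrow> 0" unfolding \<epsilon>_def
      by (auto intro!: tendsto_divide_zero LIMSEQ_power_zero)
    have "(\<lambda>k. (cmod (E k))\<^sup>2) \<longlonglongrightarrow> 0"
      by (rule tendsto_sandwich[OF _ _ tendsto_const tendsto_mult_left_zero[OF eps0, of "(L2_norm M f)\<^sup>2 + 1"]])
        (use small in auto)
    then have "(\<lambda>k. sqrt ((cmod (E k))\<^sup>2)) \<longlonglongrightarrow> sqrt 0" by (rule tendsto_real_sqrt)
    then have "E \<longlonglongrightarrow> 0" by (simp add: tendsto_norm_zero_iff)
    then have 1: "(\<lambda>k. \<phi> f - E k) \<longlonglongrightarrow> \<phi> f - 0" by (intro tendsto_intros)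
    have "(\<lambda>k. sqrt ((1/8) ^ k)) \<longlonglongrightarrow> sqrt 0"
      by (intro tendsto_real_sqrt LIMSEQ_power_zero) auto
    then have lim0: "(\<lambda>k. L2_norm M f * sqrt ((1/8) ^ k)) \<longlonglongrightarrow> 0"
      by (intro tendsto_mult_right_zero) simp
    have "cmod (L2_inner M f (F k) - L2_inner M f h) \<le> L2_norm M f * sqrt ((1/8) ^ k)" for k
    proof -
      have "L2_norm M (\<lambda>x. F k x - h x) \<le> sqrt ((1/8) ^ k)"
        using Fh[of k] by (intro real_le_rsqrt)
      then have "L2_norm M f * L2_norm M (\<lambda>x. F k x - h x) \<le> L2_norm M f * sqrt ((1/8) ^ k)"
        by (intro mult_left_mono) auto
      with L2_Cauchy_Schwarz[OF f L2_diff[OF F[of k] h]] show ?thesis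
        unfolding L2_inner_diff_right[OF F[of k] h f] by (rule order_trans)
    qed
    then have "(\<lambda>k. L2_inner M f (F k) - L2_inner M f h) \<longlonglongrightarrow> 0"
      by (intro Lim_null_comparison[OF always_eventually lim0] allI)
    then have "(\<lambda>k. L2_inner M f (F k)) \<longlonglongrightarrow> L2_inner M f h" by (simp add: LIM_zero_iff)
    with 1 show ?thesis by (simp add: E_def LIMSEQ_unique)
  qed
  with h show ?thesis by (rule that)
qed

section \<open>Operators in the group von Neumann algebra from functionals on the Fourier algebra\<close>

text \<open>The vector \<zeta> is the adjoint of \<open>A\<close> applied to \<eta>, found by the
  Riesz theorem. As \<open>A\<close> is additive and homogeneous only almost everywhere, linearity
  of the functional passes through \<open>L2_inner_cong_AE\<close>.\<close>

lemma L2_operator_adjoint: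
  assumes A: "A \<in> L2_operators M" and \<eta>: "\<eta> \<in> L2 M"
  obtains \<zeta> where "\<zeta> \<in> L2 M" "\<And>f. f \<in> L2 M \<Longrightarrow> L2_inner M (A f) \<eta> = L2_inner M f \<zeta>"
proof -
  have AL: "A f \<in> L2 M" if "f \<in> L2 M" for f using A that by (simp add: L2_operators_def)
  obtain C where C: "\<And>f. f \<in> L2 M \<Longrightarrow> L2_norm M (A f) \<le> C * L2_norm M f"
    using A unfolding L2_operators_def by blast
  show ?thesis
  proof (rule L2_Riesz[of M "\<lambda>f. L2_inner M (A f) \<eta>" "C * L2_norm M \<eta>"])
    fix f g assume f: "f \<in> L2 M" and g: "g \<in> L2 M"
    have "L2_inner M (A (\<lambda>x. f x + g x)) \<eta> = L2_inner M (\<lambda>x. A f x + A g x) \<eta>"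
      using A f g by (intro L2_inner_cong_AE AL L2_add \<eta>) (auto simp: L2_operators_def)
    then show "L2_inner M (A (\<lambda>x. f x + g x)) \<eta> = L2_inner M (A f) \<eta> + L2_inner M (A g) \<eta>"
      by (simp add: L2_inner_add_left AL f g \<eta>)
  next
    fix c f assume f: "f \<in> L2 M"
    have "L2_inner M (A (\<lambda>x. c * f x)) \<eta> = L2_inner M (\<lambda>x. c * A f x) \<eta>"
      using A f by (intro L2_inner_cong_AE AL L2_scale \<eta>) (auto simp: L2_operators_def)
    then show "L2_inner M (A (\<lambda>x. c * f x)) \<eta> = c * L2_inner M (A f) \<eta>"
      by (simp add: L2_inner_scale_left)
  next
    fix f assume f: "f \<in> L2 M"
    have "cmod (L2_inner M (A f) \<eta>) \<le> L2_norm M (A f) * L2_norm M \<eta>"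
      by (intro L2_Cauchy_Schwarz AL f \<eta>)
    also have "\<dots> \<le> (C * L2_norm M f) * L2_norm M \<eta>"
      by (intro mult_right_mono C f) simp
    finally show "cmod (L2_inner M (A f) \<eta>) \<le> C * L2_norm M \<eta> * L2_norm M f"
      by (simp add: mult_ac)
  qed (use that in blast)
qed

text \<open>For fixed \<open>f\<close> the conjugate of the form is a bounded linear functional of
  \<eta>, and its Riesz vector is taken as \<open>T f\<close>. Linearity of \<open>T\<close> follows
  by testing, its bound by inserting \<open>T f\<close> for \<eta>.\<close>

lemma L2_operator_of_form:
  fixes B :: "('a \<Rightarrow> complex) \<Rightarrow> ('a \<Rightarrow> complex) \<Rightarrow> complex"
  assumes addl: "\<And>f g \<eta>. f \<in> L2 M \<Longrightarrow> g \<in> L2 M \<Longrightarrow> \<eta> \<in> L2 M \<Longrightarrow> B (\<lambda>x. f x + g x) \<eta> = B f \<eta> + B g \<eta>"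
    and scl: "\<And>c f \<eta>. f \<in> L2 M \<Longrightarrow> \<eta> \<in> L2 M \<Longrightarrow> B (\<lambda>x. c * f x) \<eta> = c * B f \<eta>"
    and addr: "\<And>f g \<eta>. f \<in> L2 M \<Longrightarrow> g \<in> L2 M \<Longrightarrow> \<eta> \<in> L2 M \<Longrightarrow> B \<eta> (\<lambda>x. f x + g x) = B \<eta> f + B \<eta> g"
    and scr: "\<And>c f \<eta>. f \<in> L2 M \<Longrightarrow> \<eta> \<in> L2 M \<Longrightarrow> B \<eta> (\<lambda>x. c * f x) = cnj c * B \<eta> f"
    and bound: "\<And>f \<eta>. f \<in> L2 M \<Longrightarrow> \<eta> \<in> L2 M \<Longrightarrow> cmod (B f \<eta>) \<le> C * L2_norm M f * L2_norm M \<eta>"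
    and C: "0 \<le> C"
  obtains T where "T \<in> L2_operators M" "\<And>f \<eta>. f \<in> L2 M \<Longrightarrow> \<eta> \<in> L2 M \<Longrightarrow> L2_inner M (T f) \<eta> = B f \<eta>"
proof -
  have "\<exists>h. h \<in> L2 M \<and> (\<forall>\<eta>\<in>L2 M. L2_inner M h \<eta> = B f \<eta>)" if f: "f \<in> L2 M" for f
  proof (rule L2_Riesz[of M "\<lambda>\<eta>. cnj (B f \<eta>)" "C * L2_norm M f"])
    fix h assume h: "h \<in> L2 M" and eq: "\<And>\<eta>. \<eta> \<in> L2 M \<Longrightarrow> cnj (B f \<eta>) = L2_inner M \<eta> h"
    have "L2_inner M h \<eta> = B f \<eta>" if "\<eta> \<in> L2 M" for \<eta>
      using eq[OF that] by (metis L2_inner_cnj complex_cnj_cnj)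
    with h show ?thesis by blast
  qed (use f addr scr bound in auto)
  then obtain T where T: "\<And>f. f \<in> L2 M \<Longrightarrow> T f \<in> L2 M"
    and TB: "\<And>f \<eta>. f \<in> L2 M \<Longrightarrow> \<eta> \<in> L2 M \<Longrightarrow> L2_inner M (T f) \<eta> = B f \<eta>"
    by metis
  have "T \<in> L2_operators M"
    unfolding L2_operators_def mem_Collect_eq
  proof (intro conjI ballI allI exI)
    fix f g assume f: "f \<in> L2 M" and g: "g \<in> L2 M"
    show "AE x in M. T (\<lambda>y. f y + g y) x = T f x + T g x"
      by (rule L2_eq_AE) (auto simp: T L2_add f g TB L2_inner_add_left addl)
  next
    fix c f assume f: "f \<in> L2 M"
    show "AE x in M. T (\<lambda>y. c * f y) x = c * T f x"
      by (rule L2_eq_AE) (auto simp: T L2_scale f TB L2_inner_scale_left scl)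
  next
    fix f assume f: "f \<in> L2 M"
    have "(L2_norm M (T f))\<^sup>2 = cmod (L2_inner M (T f) (T f))"
      by (simp add: L2_inner_self del: of_real_power)
    also have "\<dots> \<le> C * L2_norm M f * L2_norm M (T f)"
      using TB bound f T by simp
    finally have *: "(L2_norm M (T f))\<^sup>2 \<le> C * L2_norm M f * L2_norm M (T f)" .
    show "L2_norm M (T f) \<le> C * L2_norm M f"
    proof (cases "L2_norm M (T f) = 0")
      case True
      then show ?thesis using C by simp
    next
      case False
      then have "0 < L2_norm M (T f)" using L2_norm_nonneg[of M "T f"] by linarith
      with * show ?thesis by (simp add: power2_eq_square)
    qed
  qed (rule T)
  with TB show ?thesis using that by blast
qed

text \<open>
  A bounded sequence of functionals on the Fourier algebra has a cluster point by Tychonoff's theorem.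
  Its value on a coefficient function only depends on that function, which is why the associated
  operator commutes with the commutant of the left regular representation.
\<close>
theorem group_vN_cluster_point:
  fixes b :: "nat \<Rightarrow> ('a \<Rightarrow> complex) \<Rightarrow> complex"
  assumes inv: "\<And>g \<xi>. g \<in> carrier G \<Longrightarrow> \<xi> \<in> L2 M \<Longrightarrow> left_regular G g \<xi> \<in> L2 M"
    and cong: "\<And>N u u'. (\<And>g. g \<in> carrier G \<Longrightarrow> u g = u' g) \<Longrightarrow> b N u = b N u'"
    and add: "\<And>N u u' \<xi> \<eta> \<xi>' \<eta>'. represents G M \<xi> \<eta> u \<Longrightarrow> represents G M \<xi>' \<eta>' u' \<Longrightarrow>
                 b N (\<lambda>g. u g + u' g) = b N u + b N u'"
    and scale: "\<And>N u c. b N (\<lambda>g. c * u g) = c * b N u"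
    and bound: "\<And>N u \<xi> \<eta>. represents G M \<xi> \<eta> u \<Longrightarrow> cmod (b N u) \<le> C * L2_norm M \<xi> * L2_norm M \<eta>"
    and C: "0 \<le> C"
  obtains T where "T \<in> group_vN G M"
    "\<And>u l \<xi> \<eta>. represents G M \<xi> \<eta> u \<Longrightarrow> (\<lambda>N. b N u) \<longlonglongrightarrow> l \<Longrightarrow> vN_apply G M T u = l"
proof -
  define coef where "coef \<xi> \<eta> g = L2_inner M (left_regular G g \<xi>) \<eta>" for \<xi> \<eta> g
  have rep: "represents G M \<xi> \<eta> (coef \<xi> \<eta>)" if "\<xi> \<in> L2 M" "\<eta> \<in> L2 M" for \<xi> \<eta>
    using that by (simp add: represents_def coef_def)
  \<comment> \<open>Pairs that are not square integrable get the value 0, so that every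
    \<open>X N\<close> lies in one product of compact discs; \<open>0 \<le> C\<close> makes all
    their radii nonnegative.\<close>
  define X where "X N p = (if fst p \<in> L2 M \<and> snd p \<in> L2 M then b N (coef (fst p) (snd p)) else 0)"
    for N :: nat and p :: "('a \<Rightarrow> complex) \<times> ('a \<Rightarrow> complex)"
  have "compact (Pi\<^sub>E UNIV (\<lambda>p::('a \<Rightarrow> complex) \<times> ('a \<Rightarrow> complex). cball (0::complex) (C * L2_norm M (fst p) * L2_norm M (snd p))))"
    unfolding compactin_euclidean_iff[symmetric] euclidean_product_topology[symmetric] compactin_PiE
    by (simp add: compactin_euclidean_iff)
  moreover have XK: "X N \<in> Pi\<^sub>E UNIV (\<lambda>p. cball 0 (C * L2_norm M (fst p) * L2_norm M (snd p)))" for N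
    using bound[OF rep] C by (auto simp: X_def)
  ultimately obtain B where B: "inf (nhds B) (filtermap X sequentially) \<noteq> bot"
    unfolding compact_filter
    by (metis (no_types, lifting) always_eventually eventually_filtermap filtermap_bot_iff trivial_limit_sequentially)
  \<comment> \<open>The indices at which \<open>X\<close> is close to \<open>B\<close>; this filter
    plays the role of a convergent subnet. It is finer than \<open>sequentially\<close>, so limits
    of sequences persist along it, and it is proper because \<open>B\<close> is a cluster
    point.\<close>
  define F where "F = inf sequentially (filtercomap X (nhds B))"
  have F: "F \<noteq> bot"
  proof
    assume "F = bot"
    then have "eventually (\<lambda>_. False) F" by simp
    then obtain Q R where Q: "eventually Q sequentially" and R: "eventually R (filtercomap X (nhds B))"
      and QR: "\<And>N. Q N \<Longrightarrow> R N \<Longrightarrow> False"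
      unfolding F_def eventually_inf by blast
    from R obtain S where S: "eventually S (nhds B)" and SR: "\<And>N. S (X N) \<Longrightarrow> R N"
      unfolding eventually_filtercomap by blast
    have "eventually (\<lambda>y. \<exists>N. Q N \<and> y = X N) (filtermap X sequentially)"
      unfolding eventually_filtermap by (rule eventually_mono[OF Q]) blast
    with S have "eventually (\<lambda>_. False) (inf (nhds B) (filtermap X sequentially))"
      unfolding eventually_inf using QR SR by blast
    with B show False by (simp add: trivial_limit_def)
  qed
  have F_seq: "F \<le> sequentially" by (simp add: F_def)
  have "filterlim X (nhds B) F"
    unfolding F_def by (rule filterlim_mono[OF filterlim_filtercomap]) auto
  then have lim: "((\<lambda>N. X N p) \<longlongrightarrow> B p) F" for p
    by (rule continuous_on_tendsto_compose[OF continuous_on_product_coordinates[of p]]) auto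
  have limb: "((\<lambda>N. b N u) \<longlongrightarrow> B (\<xi>, \<eta>)) F" if "represents G M \<xi> \<eta> u" for \<xi> \<eta> u
  proof -
    have "b N u = X N (\<xi>, \<eta>)" for N
      using that by (auto simp: X_def represents_def coef_def intro!: cong)
    then show ?thesis using lim[of "(\<xi>, \<eta>)"] by simp
  qed
  note uniq = tendsto_unique[OF F]
  obtain T where T: "T \<in> L2_operators M"
    and TB: "\<And>\<xi> \<eta>. \<xi> \<in> L2 M \<Longrightarrow> \<eta> \<in> L2 M \<Longrightarrow> L2_inner M (T \<xi>) \<eta> = B (\<xi>, \<eta>)"
  proof (rule L2_operator_of_form[of M "\<lambda>\<xi> \<eta>. B (\<xi>, \<eta>)" C])
    fix f g \<eta> assume f: "f \<in> L2 M" and g: "g \<in> L2 M" and \<eta>: "\<eta> \<in> L2 M"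
    have "represents G M (\<lambda>x. f x + g x) \<eta> (\<lambda>s. coef f \<eta> s + coef g \<eta> s)"
      unfolding represents_def coef_def
      using L2_inner_add_left[OF inv inv \<eta>] L2_add[OF f g] f g \<eta> by (simp add: left_regular_def)
    from limb[OF this] show "B (\<lambda>x. f x + g x, \<eta>) = B (f, \<eta>) + B (g, \<eta>)"
      unfolding add[OF rep[OF f \<eta>] rep[OF g \<eta>]]
      by (rule uniq) (intro tendsto_add limb rep f g \<eta>)
    have "represents G M \<eta> (\<lambda>x. f x + g x) (\<lambda>s. coef \<eta> f s + coef \<eta> g s)"
      unfolding represents_def coef_def
      using L2_inner_add_right[OF f g inv[OF _ \<eta>]] L2_add[OF f g] f g \<eta> by simp
    from limb[OF this] show "B (\<eta>, \<lambda>x. f x + g x) = B (\<eta>, f) + B (\<eta>, g)"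
      unfolding add[OF rep[OF \<eta> f] rep[OF \<eta> g]]
      by (rule uniq) (intro tendsto_add limb rep f g \<eta>)
  next
    fix c f \<eta> assume f: "f \<in> L2 M" and \<eta>: "\<eta> \<in> L2 M"
    have "represents G M (\<lambda>x. c * f x) \<eta> (\<lambda>s. c * coef f \<eta> s)"
      unfolding represents_def coef_def
      using L2_scale[OF f] f \<eta> L2_inner_scale_left[of M c] by (simp add: left_regular_def)
    from limb[OF this] show "B (\<lambda>x. c * f x, \<eta>) = c * B (f, \<eta>)"
      unfolding scale by (rule uniq) (intro tendsto_mult tendsto_const limb rep f \<eta>)
    have "represents G M \<eta> (\<lambda>x. c * f x) (\<lambda>s. cnj c * coef \<eta> f s)"
      unfolding represents_def coef_def
      using L2_scale[OF f] f \<eta> L2_inner_scale_right[of M _ c] by simp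
    from limb[OF this] show "B (\<eta>, \<lambda>x. c * f x) = cnj c * B (\<eta>, f)"
      unfolding scale by (rule uniq) (intro tendsto_mult tendsto_const limb rep f \<eta>)
  next
    fix f \<eta> assume f: "f \<in> L2 M" and \<eta>: "\<eta> \<in> L2 M"
    show "cmod (B (f, \<eta>)) \<le> C * L2_norm M f * L2_norm M \<eta>"
      using tendsto_upperbound[OF tendsto_norm[OF limb[OF rep[OF f \<eta>]]] _ F] bound[OF rep[OF f \<eta>]]
      by simp
  qed (use C that in auto)
  have TL: "T f \<in> L2 M" if "f \<in> L2 M" for f using T that by (simp add: L2_operators_def)
  have "T \<in> group_vN G M"
    unfolding group_vN_def commutant_def[of M "commutant M _"] mem_Collect_eq
  proof (intro conjI T ballI)
    fix A f assume "A \<in> commutant M (left_regular G ` carrier G)" and f: "f \<in> L2 M"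
    then have A: "A \<in> L2_operators M"
      and comm: "\<And>g f. g \<in> carrier G \<Longrightarrow> f \<in> L2 M \<Longrightarrow> AE x in M. A (left_regular G g f) x = left_regular G g (A f) x"
      by (auto simp: commutant_def)
    have AL: "A f \<in> L2 M" if "f \<in> L2 M" for f using A that by (simp add: L2_operators_def)
    show "AE x in M. T (A f) x = A (T f) x"
    proof (rule L2_eq_AE)
      fix \<eta> assume \<eta>: "\<eta> \<in> L2 M"
      \<comment> \<open>Moving \<open>A\<close> to the other side shows that the pairs
        \<open>(A f, \<eta>)\<close> and \<open>(f, \<zeta>)\<close> represent the same function, so
        the cluster point has the same value at both.\<close>
      obtain \<zeta> where \<zeta>: "\<zeta> \<in> L2 M" and adj: "\<And>f. f \<in> L2 M \<Longrightarrow> L2_inner M (A f) \<eta> = L2_inner M f \<zeta>"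
        using L2_operator_adjoint[OF A \<eta>] by blast
      have "coef (A f) \<eta> g = coef f \<zeta> g" if g: "g \<in> carrier G" for g
      proof -
        have "L2_inner M (left_regular G g (A f)) \<eta> = L2_inner M (A (left_regular G g f)) \<eta>"
          by (rule L2_inner_cong_AE) (use comm[OF g f] in \<open>auto simp: inv AL g f \<eta> elim: eventually_mono\<close>)
        also have "\<dots> = L2_inner M (left_regular G g f) \<zeta>" by (intro adj inv g f)
        finally show ?thesis by (simp add: coef_def)
      qed
      then have "represents G M (A f) \<eta> (coef f \<zeta>)"
        by (simp add: represents_def coef_def AL f \<eta>)
      from limb[OF this] limb[OF rep[OF f \<zeta>]] have "B (A f, \<eta>) = B (f, \<zeta>)" by (rule uniq)
      then show "L2_inner M (T (A f)) \<eta> = L2_inner M (A (T f)) \<eta>"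
        by (simp add: TB AL TL f \<eta> \<zeta> adj)
    qed (intro AL TL f)+
  qed
  moreover have "vN_apply G M T u = l"
    if u: "represents G M \<xi> \<eta> u" and l: "(\<lambda>N. b N u) \<longlonglongrightarrow> l" for u l \<xi> \<eta>
  proof -
    \<comment> \<open>The value is the same for every representing pair, as the description in
      \<open>vN_apply\<close> requires.\<close>
    have *: "L2_inner M (T \<xi>') \<eta>' = l" if "represents G M \<xi>' \<eta>' u" for \<xi>' \<eta>'
      using uniq[OF limb[OF that] tendsto_mono[OF F_seq l]] that by (simp add: TB represents_def)
    show ?thesis
      unfolding vN_apply_def by (rule the_equality) (use * u in blast)+
  qed
  ultimately show ?thesis by (rule that)
qed

section \<open>The Fourier transform on the real line\<close>

lemma borel_measurable_cis [measurable (raw)]: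
  "f \<in> borel_measurable M \<Longrightarrow> (\<lambda>x. cis (f x)) \<in> borel_measurable M"
  by (rule borel_measurable_continuous_on [where f = cis]) (auto intro: continuous_intros)

lemma borel_measurable_fourier [measurable]:
  assumes [measurable]: "f \<in> borel_measurable borel"
  shows "fourier f \<in> borel_measurable borel"
  unfolding fourier_def by measurable

lemma integrable_pair_mult:
  fixes f :: "'a \<Rightarrow> complex" and g :: "'b \<Rightarrow> complex"
  assumes "sigma_finite_measure M1" "sigma_finite_measure M2"
    and f: "integrable M1 f" and g: "integrable M2 g"
  shows "integrable (M1 \<Otimes>\<^sub>M M2) (\<lambda>p. f (fst p) * g (snd p))"
    and "(LINT p|(M1 \<Otimes>\<^sub>M M2). f (fst p) * g (snd p)) = (LINT x|M1. f x) * (LINT y|M2. g y)"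
proof -
  interpret pair_sigma_finite M1 M2 using assms by (simp add: pair_sigma_finite_def)
  have [measurable]: "f \<in> borel_measurable M1" "g \<in> borel_measurable M2" using f g by auto
  show int: "integrable (M1 \<Otimes>\<^sub>M M2) (\<lambda>p. f (fst p) * g (snd p))"
    by (rule Fubini_integrable) (use f g in \<open>auto simp: norm_mult\<close>)
  show "(LINT p|(M1 \<Otimes>\<^sub>M M2). f (fst p) * g (snd p)) = (LINT x|M1. f x) * (LINT y|M2. g y)"
    using integral_fst'[OF int] by simp
qed

section \<open>Gaussians and the Plancherel inequality\<close>

lemma gaussian_fourier:
  assumes "0 < \<sigma>"
  shows "integrable lborel (\<lambda>x. complex_of_real (normal_density 0 \<sigma> x) * cis (t * x))"
    and "(LINT x|lborel. complex_of_real (normal_density 0 \<sigma> x) * cis (t * x)) = of_real (exp (- (t * \<sigma>)\<^sup>2 / 2))"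
proof -
  have nd: "normal_density 0 \<sigma> (\<sigma> * x) = std_normal_density x / \<sigma>" for x
    using assms by (simp add: normal_density_def power_mult_distrib real_sqrt_mult)
  have int_std: "integrable lborel (\<lambda>x. complex_of_real (std_normal_density x) * cis (s * x))" for s
    by (rule Bochner_Integration.integrable_bound[OF integrable_normal_density[of 1 0]])
      (auto simp: norm_mult)
  have "(\<integral>x. complex_of_real (std_normal_density x) * cis (s * x) \<partial>lborel) = of_real (exp (- s\<^sup>2 / 2))" for s
  proof -
    have "char std_normal_distribution s = (\<integral>x. complex_of_real (std_normal_density x) * cis (s * x) \<partial>lborel)"
      unfolding char_def
      by (subst integral_density) (auto simp: scaleR_conv_of_real cis_conv_exp mult_ac)
    then show ?thesis by (simp add: char_std_normal_distribution)
  qed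
  note std = this
  show int: "integrable lborel (\<lambda>x. complex_of_real (normal_density 0 \<sigma> x) * cis (t * x))"
    using assms by (intro Bochner_Integration.integrable_bound[OF integrable_normal_density[of \<sigma> 0]])
      (auto simp: norm_mult)
  have "(LINT x|lborel. complex_of_real (normal_density 0 \<sigma> x) * cis (t * x)) =
      \<bar>\<sigma>\<bar> *\<^sub>R (LINT x|lborel. complex_of_real (normal_density 0 \<sigma> (0 + \<sigma> * x)) * cis (t * (0 + \<sigma> * x)))"
    using assms by (intro lborel_integral_real_affine) auto
  also have "\<dots> = (LINT x|lborel. complex_of_real (std_normal_density x) * cis ((t * \<sigma>) * x))"
    using assms by (simp add: nd scaleR_conv_of_real mult.assoc)
  finally show "(LINT x|lborel. complex_of_real (normal_density 0 \<sigma> x) * cis (t * x)) = of_real (exp (- (t * \<sigma>)\<^sup>2 / 2))"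
    by (simp add: std)
qed

text \<open>
  A Gaussian weight makes the double integral absolutely convergent. Its kernel is positive with total
  mass \<open>2 * pi\<close>, so the weighted inequality holds by Schur's test, and the weight is then removed by
  monotone convergence.
\<close>
lemma fourier_Plancherel_le:
  assumes f: "integrable lborel f" "f \<in> L2 lborel"
  shows "(\<integral>\<^sup>+q. ennreal ((cmod (fourier f q))\<^sup>2) \<partial>lborel) \<le> ennreal (2 * pi) * (\<integral>\<^sup>+x. ennreal ((cmod (f x))\<^sup>2) \<partial>lborel)"
proof -
  have [measurable]: "f \<in> borel_measurable borel" using f(1) by auto
  define S where "S = (LINT x|lborel. (cmod (f x))\<^sup>2)"
  have S: "(\<integral>\<^sup>+x. ennreal ((cmod (f x))\<^sup>2) \<partial>lborel) = ennreal S"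
    unfolding S_def by (rule nn_integral_eq_integral) (use f in \<open>auto simp: L2_integrable\<close>)
  have S0: "0 \<le> S" by (simp add: S_def)
  define w where "w k q = exp (- (q * inverse (real (Suc k)))\<^sup>2 / 2)" for k q
  have w0: "0 \<le> w k q" for k q by (simp add: w_def)
  have wle: "(\<integral>\<^sup>+q. ennreal ((cmod (fourier f q))\<^sup>2 * w k q) \<partial>lborel) \<le> ennreal (2 * pi * S)" for k
  proof -
    define s where "s = real (Suc k)"
    have s: "0 < s" by (simp add: s_def)
    \<comment> \<open>The Fourier transform of the weight \<open>w k\<close>, which is itself a
      multiple of the normal density of deviation \<open>s\<close>.\<close>
    let ?K = "\<lambda>x. 2 * pi * normal_density 0 (1 / s) x"
    let ?P = "lborel \<Otimes>\<^sub>M lborel :: (real \<times> real) measure"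
    let ?f2 = "\<lambda>p. f (fst p) * cnj (f (snd p))"
    have w_eq: "w k q = sqrt (2 * pi) * s * normal_density 0 s q" for q
      unfolding w_def s_def[symmetric] normal_density_def using s by (simp add: real_sqrt_mult field_simps)
    have intw: "integrable lborel (\<lambda>q. w k q)"
      unfolding w_eq using s by simp
    have K_eq: "sqrt (2 * pi) * s * exp (- (t * s)\<^sup>2 / 2) = ?K t" for t
    proof -
      have "sqrt (2 * pi * (1 / s)\<^sup>2) = sqrt (2 * pi) / s"
        using s by (simp add: real_sqrt_mult real_sqrt_divide power_divide)
      moreover have "2 * pi / sqrt (2 * pi) = sqrt (2 * pi)"
        by (rule real_div_sqrt) simp
      ultimately have "2 * pi * (1 / sqrt (2 * pi * (1 / s)\<^sup>2)) = sqrt (2 * pi) * s"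
        by (metis divide_divide_eq_right mult.right_neutral times_divide_eq_left times_divide_eq_right mult.commute)
      moreover have "- (t - 0)\<^sup>2 / (2 * (1 / s)\<^sup>2) = - (t * s)\<^sup>2 / 2"
        using s by (simp add: power_divide power_mult_distrib)
      ultimately show ?thesis
        unfolding normal_density_def by (simp only: mult.assoc[symmetric])
    qed
    have f2: "integrable ?P ?f2"
      using integrable_pair_mult(1)[OF lborel.sigma_finite_measure_axioms lborel.sigma_finite_measure_axioms
          f(1) integrable_cnj[OF f(1)]] .
    have four: "fourier f q * cnj (fourier f q) = (LINT p|?P. ?f2 p * cis ((snd p - fst p) * q))" for q
    proof -
      have 1: "integrable lborel (\<lambda>x. f x * cis (- (q * x)))"
        by (rule Bochner_Integration.integrable_bound[OF f(1)]) (auto simp: norm_mult)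
      have "fourier f q * cnj (fourier f q) = (LINT x|lborel. f x * cis (- (q * x))) * (LINT x|lborel. cnj (f x * cis (- (q * x))))"
        unfolding fourier_def by (simp flip: Bochner_Integration.integral_cnj)
      also have "\<dots> = (LINT p|?P. (f (fst p) * cis (- (q * fst p))) * cnj (f (snd p) * cis (- (q * snd p))))"
        by (rule integrable_pair_mult(2)[symmetric])
          (intro lborel.sigma_finite_measure_axioms 1 integrable_cnj[OF 1])+
      also have "\<dots> = (LINT p|?P. ?f2 p * cis ((snd p - fst p) * q))"
        by (rule Bochner_Integration.integral_cong)
          (auto simp: cis_cnj cis_mult algebra_simps simp flip: mult.assoc)
      finally show ?thesis .
    qed
    have int3: "integrable (lborel \<Otimes>\<^sub>M ?P) (\<lambda>(q, p). of_real (w k q) * (?f2 p * cis ((snd p - fst p) * q)))"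
    proof (rule Bochner_Integration.integrable_bound)
      show "integrable (lborel \<Otimes>\<^sub>M ?P) (\<lambda>r. complex_of_real (w k (fst r)) * ?f2 (snd r))"
        by (intro integrable_pair_mult f2 integrable_of_real intw lborel.sigma_finite_measure_axioms
            sigma_finite_pair_measure)
      show "(\<lambda>(q, p). of_real (w k q) * (?f2 p * cis ((snd p - fst p) * q))) \<in> borel_measurable (lborel \<Otimes>\<^sub>M ?P)"
        unfolding w_def by measurable
    qed (auto simp: norm_mult)
    interpret P3: pair_sigma_finite lborel ?P
      by (simp add: pair_sigma_finite_def lborel.sigma_finite_measure_axioms sigma_finite_pair_measure)
    have "complex_of_real (LINT q|lborel. (cmod (fourier f q))\<^sup>2 * w k q)
        = (LINT q|lborel. of_real (w k q) * (fourier f q * cnj (fourier f q)))"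
      by (subst integral_complex_of_real[symmetric]) (simp add: complex_norm_square mult_ac del: of_real_power)
    also have "\<dots> = (LINT q|lborel. (LINT p|?P. of_real (w k q) * (?f2 p * cis ((snd p - fst p) * q))))"
      by (simp add: four)
    also have "\<dots> = (LINT p|?P. (LINT q|lborel. of_real (w k q) * (?f2 p * cis ((snd p - fst p) * q))))"
      by (rule P3.Fubini_integral[symmetric]) (rule int3)
    also have "\<dots> = (LINT p|?P. ?f2 p * of_real (?K (snd p - fst p)))"
    proof (rule Bochner_Integration.integral_cong)
      fix p :: "real \<times> real"
      let ?t = "snd p - fst p"
      have "(LINT q|lborel. of_real (w k q) * (?f2 p * cis (?t * q)))
          = (LINT q|lborel. (?f2 p * of_real (sqrt (2 * pi) * s)) * (complex_of_real (normal_density 0 s q) * cis (?t * q)))"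
        by (simp add: w_eq mult_ac)
      also have "\<dots> = ?f2 p * of_real (sqrt (2 * pi) * s * exp (- (?t * s)\<^sup>2 / 2))"
        by (simp add: gaussian_fourier(2)[OF s])
      also have "sqrt (2 * pi) * s * exp (- (?t * s)\<^sup>2 / 2) = ?K ?t"
        by (rule K_eq)
      finally show "(LINT q|lborel. of_real (w k q) * (?f2 p * cis (?t * q))) = ?f2 p * of_real (?K ?t)" .
    qed simp
    finally have eq: "complex_of_real (LINT q|lborel. (cmod (fourier f q))\<^sup>2 * w k q) = (LINT p|?P. ?f2 p * of_real (?K (snd p - fst p)))" .
    have K0: "0 \<le> ?K x" for x by simp
    have K_le: "?K t \<le> sqrt (2 * pi) * s" for t
      unfolding K_eq[symmetric] using s by (simp add: mult_left_le)
    \<comment> \<open>In Schur's test the product of two values of \<open>f\<close> is replaced by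
      half the sum of their squares; each half, integrated against the kernel of mass
      \<open>2 * pi\<close>, contributes \<open>pi * S\<close>.\<close>
    have half: "(\<integral>\<^sup>+x. ennreal (1/2 * (cmod (f x))\<^sup>2) * ennreal (2 * pi) \<partial>lborel) = ennreal (pi * S)"
    proof -
      have "(\<integral>\<^sup>+x. ennreal (1/2 * (cmod (f x))\<^sup>2) * ennreal (2 * pi) \<partial>lborel) = (\<integral>\<^sup>+x. ennreal pi * ennreal ((cmod (f x))\<^sup>2) \<partial>lborel)"
        by (intro nn_integral_cong) (simp flip: ennreal_mult)
      also have "\<dots> = ennreal pi * ennreal S" by (subst nn_integral_cmult) (auto simp: S)
      finally show ?thesis by (simp add: ennreal_mult S0)
    qed
    have KB: "norm (?f2 p * of_real (?K (snd p - fst p))) \<le> norm ((sqrt (2 * pi) * s) *\<^sub>R ?f2 p)" for p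
    proof -
      have "norm (?f2 p * of_real (?K (snd p - fst p))) = norm (?f2 p) * ?K (snd p - fst p)"
        by (simp only: norm_mult norm_of_real abs_of_nonneg[OF K0])
      also have "\<dots> \<le> norm (?f2 p) * (sqrt (2 * pi) * s)"
        by (intro mult_left_mono K_le) simp
      finally show ?thesis using s by (simp add: mult.commute)
    qed
    have Kint: "(\<integral>\<^sup>+x. ennreal (?K (c * x + d)) \<partial>lborel) = ennreal (2 * pi)" if "c = 1 \<or> c = -1" for c d
    proof -
      have "(\<integral>\<^sup>+x. ennreal (?K x) \<partial>lborel) = ennreal (2 * pi) * (\<integral>\<^sup>+x. ennreal (normal_density 0 (1 / s) x) \<partial>lborel)"
        by (subst nn_integral_cmult[symmetric]) (auto simp: ennreal_mult)
      also have "(\<integral>\<^sup>+x. ennreal (normal_density 0 (1 / s) x) \<partial>lborel) = 1"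
        using prob_space.emeasure_space_1[OF prob_space_normal_density[of "1/s" 0]] s by (simp add: emeasure_density)
      finally have "(\<integral>\<^sup>+x. ennreal (?K x) \<partial>lborel) = ennreal (2 * pi)" by simp
      moreover have "c \<noteq> 0" "\<bar>c\<bar> = 1" using that by auto
      ultimately show ?thesis
        using nn_integral_real_affine[of "\<lambda>x. ennreal (?K x)" c d] by (simp add: add.commute[of d])
    qed
    have "ennreal (cmod (LINT p|?P. ?f2 p * of_real (?K (snd p - fst p)))) \<le> (\<integral>\<^sup>+p. ennreal (cmod (?f2 p * of_real (?K (snd p - fst p)))) \<partial>?P)"
      by (rule integral_norm_bound_ennreal)
        (rule Bochner_Integration.integrable_bound[where f = "\<lambda>p. (sqrt (2 * pi) * s) *\<^sub>R ?f2 p"],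
          use f2 in simp, measurable, rule AE_I2, rule KB)
    also have "\<dots> \<le> (\<integral>\<^sup>+p. ennreal (1/2 * (cmod (f (fst p)))\<^sup>2) * ennreal (?K (snd p - fst p)) + ennreal (1/2 * (cmod (f (snd p)))\<^sup>2) * ennreal (?K (snd p - fst p)) \<partial>?P)"
    proof (rule nn_integral_mono)
      fix p :: "real \<times> real"
      let ?a = "cmod (f (fst p))" and ?b = "cmod (f (snd p))"
      have "?a * ?b \<le> 1/2 * ?a\<^sup>2 + 1/2 * ?b\<^sup>2"
        using sum_squares_bound[of ?a ?b] by simp
      from mult_right_mono[OF this K0[of "snd p - fst p"]]
      show "ennreal (cmod (?f2 p * of_real (?K (snd p - fst p)))) \<le> ennreal (1/2 * ?a\<^sup>2) * ennreal (?K (snd p - fst p)) + ennreal (1/2 * ?b\<^sup>2) * ennreal (?K (snd p - fst p))"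
        by (simp add: norm_mult distrib_right flip: ennreal_mult ennreal_plus)
    qed
    also have "\<dots> = (\<integral>\<^sup>+p. ennreal (1/2 * (cmod (f (fst p)))\<^sup>2) * ennreal (?K (snd p - fst p)) \<partial>?P)
        + (\<integral>\<^sup>+p. ennreal (1/2 * (cmod (f (snd p)))\<^sup>2) * ennreal (?K (snd p - fst p)) \<partial>?P)"
      by (rule nn_integral_add) auto
    also have "(\<integral>\<^sup>+p. ennreal (1/2 * (cmod (f (fst p)))\<^sup>2) * ennreal (?K (snd p - fst p)) \<partial>?P)
        = (\<integral>\<^sup>+a. (\<integral>\<^sup>+b. ennreal (1/2 * (cmod (f a))\<^sup>2) * ennreal (?K (1 * b + (- a))) \<partial>lborel) \<partial>lborel)"
      by (subst lborel.nn_integral_fst[symmetric]) auto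
    also have "\<dots> = (\<integral>\<^sup>+a. ennreal (1/2 * (cmod (f a))\<^sup>2) * ennreal (2 * pi) \<partial>lborel)"
      by (intro nn_integral_cong, subst nn_integral_cmult, measurable, subst Kint) auto
    also have "\<dots> = ennreal (pi * S)" by (rule half)
    also have "(\<integral>\<^sup>+p. ennreal (1/2 * (cmod (f (snd p)))\<^sup>2) * ennreal (?K (snd p - fst p)) \<partial>?P)
        = (\<integral>\<^sup>+b. (\<integral>\<^sup>+a. ennreal (1/2 * (cmod (f b))\<^sup>2) * ennreal (?K ((-1) * a + b)) \<partial>lborel) \<partial>lborel)"
      by (subst lborel_pair.nn_integral_snd[symmetric]) auto
    also have "\<dots> = (\<integral>\<^sup>+b. ennreal (1/2 * (cmod (f b))\<^sup>2) * ennreal (2 * pi) \<partial>lborel)"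
      by (intro nn_integral_cong, subst nn_integral_cmult, measurable, subst Kint) auto
    also have "\<dots> = ennreal (pi * S)" by (rule half)
    finally have "ennreal (cmod (LINT p|?P. ?f2 p * of_real (?K (snd p - fst p)))) \<le> ennreal (2 * pi * S)"
      using S0 by (simp add: mult_ac flip: ennreal_plus)
    then have X: "ennreal (LINT q|lborel. (cmod (fourier f q))\<^sup>2 * w k q) \<le> ennreal (2 * pi * S)"
      unfolding eq[symmetric] using w0 by simp
    have "cmod (fourier f q) \<le> (LINT x|lborel. cmod (f x))" for q
      unfolding fourier_def by (rule order_trans[OF integral_norm_bound]) (simp add: norm_mult)
    then have "(cmod (fourier f q))\<^sup>2 \<le> (LINT x|lborel. cmod (f x))\<^sup>2" for q
      by (intro power_mono) auto
    then have "integrable lborel (\<lambda>q. (cmod (fourier f q))\<^sup>2 * w k q)"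
      by (intro Bochner_Integration.integrable_bound[OF integrable_mult_right[OF intw, of "(LINT x|lborel. cmod (f x))\<^sup>2"]])
        (auto simp: w_def intro!: mult_right_mono AE_I2)
    then have "(\<integral>\<^sup>+q. ennreal ((cmod (fourier f q))\<^sup>2 * w k q) \<partial>lborel) = ennreal (LINT q|lborel. (cmod (fourier f q))\<^sup>2 * w k q)"
      by (rule nn_integral_eq_integral) (simp add: w_def)
    with X show ?thesis by simp
  qed
  have "(\<integral>\<^sup>+q. ennreal ((cmod (fourier f q))\<^sup>2) \<partial>lborel) = (\<integral>\<^sup>+q. (SUP k. ennreal ((cmod (fourier f q))\<^sup>2 * w k q)) \<partial>lborel)"
  proof (rule nn_integral_cong)
    fix q :: real
    have "(\<lambda>k. (cmod (fourier f q))\<^sup>2 * w k q) \<longlonglongrightarrow> (cmod (fourier f q))\<^sup>2 * exp (- (q * 0)\<^sup>2 / 2)"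
      unfolding w_def by (intro tendsto_intros LIMSEQ_inverse_real_of_nat) auto
    then have "(\<lambda>k. ennreal ((cmod (fourier f q))\<^sup>2 * w k q)) \<longlonglongrightarrow> ennreal ((cmod (fourier f q))\<^sup>2)"
      by (intro tendsto_ennrealI) simp
    moreover have "incseq (\<lambda>k. ennreal ((cmod (fourier f q))\<^sup>2 * w k q))"
      unfolding w_def
      by (intro incseq_SucI ennreal_leI mult_left_mono) (auto simp: power_mult_distrib field_simps intro!: mult_left_mono power_mono)
    ultimately show "ennreal ((cmod (fourier f q))\<^sup>2) = (SUP k. ennreal ((cmod (fourier f q))\<^sup>2 * w k q))"
      using LIMSEQ_SUP LIMSEQ_unique by blast
  qed
  also have "\<dots> = (SUP k. \<integral>\<^sup>+q. ennreal ((cmod (fourier f q))\<^sup>2 * w k q) \<partial>lborel)"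
  proof (rule nn_integral_monotone_convergence_SUP)
    show "incseq (\<lambda>k q. ennreal ((cmod (fourier f q))\<^sup>2 * w k q))"
      unfolding w_def
      by (intro incseq_SucI le_funI ennreal_leI mult_left_mono) (auto simp: power_mult_distrib field_simps intro!: mult_left_mono power_mono)
  qed (simp add: w_def)
  also have "\<dots> \<le> ennreal (2 * pi * S)" by (intro SUP_least wle)
  also have "\<dots> = ennreal (2 * pi) * (\<integral>\<^sup>+x. ennreal ((cmod (f x))\<^sup>2) \<partial>lborel)"
    by (simp add: S ennreal_mult S0)
  finally show ?thesis .
qed

section \<open>Uniqueness and inversion of the Fourier transform\<close>

text \<open>The positive and the negative part of \<open>d\<close> have equal transforms and, by the
  frequency 0, equal mass. Divided by this mass they are probability densities with the same
  characteristic function, and Levy's uniqueness theorem applies.\<close>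

lemma real_signed_density_zero:
  fixes d :: "real \<Rightarrow> real"
  assumes d: "integrable lborel d" and zero: "\<And>t. (LINT x|lborel. complex_of_real (d x) * cis (t * x)) = 0"
  shows "AE x in lborel. d x = 0"
proof -
  have [measurable]: "d \<in> borel_measurable borel" using d by auto
  define p n where "p x = max 0 (d x)" and "n x = max 0 (- d x)" for x
  have [measurable]: "p \<in> borel_measurable borel" "n \<in> borel_measurable borel"
    unfolding p_def n_def by measurable
  have pn: "d x = p x - n x" and p0: "0 \<le> p x" and n0: "0 \<le> n x" for x by (auto simp: p_def n_def)
  have ip: "integrable lborel p" and in': "integrable lborel n"
    unfolding p_def n_def using d by (auto intro: integrable_max)
  have icis: "integrable lborel (\<lambda>x. complex_of_real (r x) * cis (t * x))"
    if "integrable lborel r" for t and r :: "real \<Rightarrow> real"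
    using that by (intro Bochner_Integration.integrable_bound[OF that]) (auto simp: norm_mult)
  have eq: "(LINT x|lborel. complex_of_real (p x) * cis (t * x)) = (LINT x|lborel. complex_of_real (n x) * cis (t * x))" for t
  proof -
    have "0 = (LINT x|lborel. complex_of_real (p x) * cis (t * x) - complex_of_real (n x) * cis (t * x))"
      using zero[of t] by (simp add: pn left_diff_distrib)
    also have "\<dots> = (LINT x|lborel. complex_of_real (p x) * cis (t * x)) - (LINT x|lborel. complex_of_real (n x) * cis (t * x))"
      by (intro Bochner_Integration.integral_diff icis ip in')
    finally show ?thesis by simp
  qed
  define m where "m = (LINT x|lborel. p x)"
  have mn: "m = (LINT x|lborel. n x)"
    using eq[of 0] by (simp add: m_def)
  show ?thesis
  proof (cases "m = 0")
    case True
    have "AE x in lborel. p x = 0" "AE x in lborel. n x = 0"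
      using integral_nonneg_eq_0_iff_AE[OF ip] integral_nonneg_eq_0_iff_AE[OF in'] p0 n0 True mn
      unfolding m_def by auto
    then show ?thesis by eventually_elim (simp add: pn)
  next
    case False
    have m: "0 < m" using False p0 by (auto simp: m_def less_le)
    let ?\<mu> = "\<lambda>r. density lborel (\<lambda>x. ennreal (r x / m))"
    have dist: "real_distribution (?\<mu> r)"
      if "integrable lborel r" "\<And>x. 0 \<le> r x" "(LINT x|lborel. r x) = m" and [measurable]: "r \<in> borel_measurable borel" for r
    proof -
      have "emeasure (?\<mu> r) (space (?\<mu> r)) = (\<integral>\<^sup>+x. ennreal (r x / m) \<partial>lborel)"
        by (simp add: emeasure_density)
      also have "\<dots> = ennreal (LINT x|lborel. r x / m)"
        using that m by (intro nn_integral_eq_integral) auto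
      also have "\<dots> = 1" using that m by simp
      finally have "prob_space (?\<mu> r)" by (rule prob_spaceI)
      then show ?thesis by (simp add: real_distribution_def real_distribution_axioms_def)
    qed
    have char: "char (?\<mu> r) t = (LINT x|lborel. complex_of_real (r x) * cis (t * x)) / m"
      if "\<And>x. 0 \<le> r x" and [measurable]: "r \<in> borel_measurable borel" for r t
    proof -
      have "char (?\<mu> r) t = (LINT x|lborel. (complex_of_real (r x) * cis (t * x)) / m)"
        unfolding char_def using m that
        by (subst integral_density) (auto simp: scaleR_conv_of_real cis_conv_exp mult_ac)
      then show ?thesis by simp
    qed
    have "?\<mu> p = ?\<mu> n"
      by (intro Levy_uniqueness dist ip in' p0 n0 ext) (simp_all add: char p0 n0 eq m_def[symmetric] mn[symmetric])
    then have "AE x in lborel. ennreal (p x / m) = ennreal (n x / m)"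
      by (subst (asm) sigma_finite_measure.density_unique_iff[OF lborel.sigma_finite_measure_axioms]) auto
    then show ?thesis
      by eventually_elim (use m p0 n0 in \<open>auto simp: pn\<close>)
  qed
qed

text \<open>Conjugating \<open>d\<close> conjugates the transform and reflects the frequency, so the
  transforms of the real and the imaginary part vanish as well.\<close>

lemma fourier_eq_0_AE:
  assumes d: "integrable lborel d" and zero: "\<And>t. fourier d t = 0"
  shows "AE x in lborel. d x = 0"
proof -
  have i1: "integrable lborel (\<lambda>x. d x * cis (t * x))" for t
    using d by (intro Bochner_Integration.integrable_bound[OF d]) (auto simp: norm_mult)
  have i2: "integrable lborel (\<lambda>x. cnj (d x) * cis (t * x))" for t
    using d by (intro Bochner_Integration.integrable_bound[OF d]) (auto simp: norm_mult)
  have z1: "(LINT x|lborel. d x * cis (t * x)) = 0" for t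
    using zero[of "-t"] by (simp add: fourier_def)
  have z2: "(LINT x|lborel. cnj (d x) * cis (t * x)) = 0" for t
  proof -
    have "(LINT x|lborel. cnj (d x) * cis (t * x)) = (LINT x|lborel. cnj (d x * cis (- (t * x))))"
      by (simp add: cis_cnj)
    also have "\<dots> = cnj (fourier d t)"
      unfolding fourier_def by (rule Bochner_Integration.integral_cnj)
    finally show ?thesis by (simp add: zero)
  qed
  have re: "complex_of_real (Re w) * c = (w * c + cnj w * c) / 2" for w c
    by (simp only: distrib_right[symmetric] complex_add_cnj) simp
  have im: "complex_of_real (Im w) * c = (w * c - cnj w * c) / (2 * \<i>)" for w c
  proof -
    have "(a * \<i>) * c / (2 * \<i>) = a * c / 2" for a by (simp add: field_simps del: complex_i_mult_minus)
    then show ?thesis by (simp only: left_diff_distrib[symmetric] complex_diff_cnj) simp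
  qed
  have "AE x in lborel. Re (d x) = 0"
    by (rule real_signed_density_zero) (use d in \<open>auto simp: re i1 i2 z1 z2\<close>)
  moreover have "AE x in lborel. Im (d x) = 0"
    by (rule real_signed_density_zero) (use d in \<open>auto simp: im i1 i2 z1 z2\<close>)
  ultimately show ?thesis by eventually_elim (simp add: complex_eq_iff)
qed

text \<open>
  Both sides of the inversion formula, multiplied by a Gaussian, are integrable and have the same
  Fourier transform, namely the convolution of the Fourier transform of \<open>f\<close> with a Gaussian.
\<close>
theorem fourier_inversion_AE:
  assumes f: "integrable lborel f" and F: "integrable lborel (fourier f)"
  shows "AE x in lborel. f x = (LINT s|lborel. fourier f s * cis (s * x)) / (2 * pi)"
proof -
  have [measurable]: "f \<in> borel_measurable borel" using f by auto
  let ?\<gamma> = "\<lambda>x. complex_of_real (std_normal_density x)"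
  let ?h = "\<lambda>x. (LINT s|lborel. fourier f s * cis (s * x)) / (2 * pi)"
  have [measurable]: "?h \<in> borel_measurable borel" by measurable
  have \<gamma>_le: "std_normal_density x \<le> 1" for x
  proof -
    have "1 \<le> sqrt (2 * pi)" using pi_gt3 by (intro real_le_rsqrt) simp
    moreover have "exp (- x\<^sup>2 / 2) \<le> 1" by simp
    ultimately have "exp (- x\<^sup>2 / 2) \<le> sqrt (2 * pi)" by linarith
    then show ?thesis by (simp add: normal_density_def divide_le_eq)
  qed
  have g: "integrable lborel ?\<gamma>" by (intro integrable_of_real integrable_normal_density) simp
  \<comment> \<open>The Gaussian is its own transform up to a factor, so multiplication by it can be
    written as an integral over frequency shifts.\<close>
  have \<gamma>F: "(LINT x|lborel. ?\<gamma> x * cis (t * x)) = of_real (sqrt (2 * pi)) * ?\<gamma> t" for t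
    using gaussian_fourier(2)[of 1 t] by (simp add: normal_density_def)
  have cis_diff: "cis (a - b) = cis a * cis (- b)" for a b
    by (simp add: cis_mult)
  have bound2: "integrable (lborel \<Otimes>\<^sub>M lborel) (\<lambda>p. (a (fst p) * b (snd p)) * cis (k p))"
    if a: "integrable lborel a" and b: "integrable lborel b" and [measurable]: "k \<in> borel_measurable (borel \<Otimes>\<^sub>M borel)"
    for a b :: "real \<Rightarrow> complex" and k :: "real \<times> real \<Rightarrow> real"
  proof -
    have [measurable]: "a \<in> borel_measurable borel" "b \<in> borel_measurable borel" using a b by auto
    show ?thesis
      by (rule Bochner_Integration.integrable_bound[OF integrable_pair_mult(1)[OF lborel.sigma_finite_measure_axioms lborel.sigma_finite_measure_axioms a b]])
        (auto simp: norm_mult)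
  qed
  have fg: "integrable lborel (\<lambda>x. f x * ?\<gamma> x)"
    by (rule Bochner_Integration.integrable_bound[OF f]) (use \<gamma>_le in \<open>auto simp: norm_mult mult_left_le\<close>)
  have "cmod (LINT s|lborel. fourier f s * cis (s * x)) \<le> (LINT s|lborel. cmod (fourier f s))" for x
    by (rule order_trans[OF integral_norm_bound]) (simp add: norm_mult)
  \<comment> \<open>The right-hand side of the inversion formula is known to be bounded; the
    Gaussian factor makes it integrable, as \<open>fourier_eq_0_AE\<close> demands.\<close>
  then have hg: "integrable lborel (\<lambda>x. ?h x * ?\<gamma> x)"
    by (intro Bochner_Integration.integrable_bound[OF integrable_mult_right[OF g, of "(LINT s|lborel. cmod (fourier f s)) / (2 * pi)"]])
      (auto simp: norm_mult norm_divide intro!: mult_right_mono divide_right_mono AE_I2)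
  have "fourier (\<lambda>x. f x * ?\<gamma> x) t = fourier (\<lambda>x. ?h x * ?\<gamma> x) t" for t
  proof -
    have "of_real (sqrt (2 * pi)) * fourier (\<lambda>x. f x * ?\<gamma> x) t
        = (LINT x|lborel. f x * cis (- (t * x)) * (LINT r|lborel. ?\<gamma> r * cis (x * r)))"
      unfolding fourier_def \<gamma>F integral_mult_right_zero[symmetric]
      by (intro Bochner_Integration.integral_cong refl) (simp only: mult_ac)
    also have "\<dots> = (LINT x|lborel. (LINT r|lborel. (f x * ?\<gamma> r) * cis (x * r - t * x)))"
      by (intro Bochner_Integration.integral_cong refl, subst integral_mult_right_zero[symmetric],
          intro Bochner_Integration.integral_cong refl)
        (simp only: cis_diff mult_ac)
    also have "\<dots> = (LINT r|lborel. (LINT x|lborel. (f x * ?\<gamma> r) * cis (x * r - t * x)))"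
      by (rule lborel_pair.Fubini_integral[symmetric])
        (use bound2[OF f g, of "\<lambda>p. fst p * snd p - t * fst p"] in \<open>simp add: case_prod_beta'\<close>)
    also have "\<dots> = (LINT r|lborel. ?\<gamma> r * fourier f (t - r))"
      unfolding fourier_def integral_mult_right_zero[symmetric]
      by (intro Bochner_Integration.integral_cong refl) (simp add: algebra_simps)
    also have "\<dots> = (LINT s|lborel. ?\<gamma> (s - t) * fourier f s)"
      by (subst lborel_integral_real_affine[where c = "-1" and t = t]) (auto simp: normal_density_def power2_commute)
    finally have 1: "of_real (sqrt (2 * pi)) * fourier (\<lambda>x. f x * ?\<gamma> x) t = (LINT s|lborel. ?\<gamma> (s - t) * fourier f s)" .
    have "2 * pi * fourier (\<lambda>x. ?h x * ?\<gamma> x) t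
        = (LINT x|lborel. (LINT s|lborel. (fourier f s * ?\<gamma> x) * cis (s * x - t * x)))"
    proof -
      have "2 * pi * (?h x * ?\<gamma> x * cis (- (t * x))) = (LINT s|lborel. (fourier f s * ?\<gamma> x) * cis (s * x - t * x))" for x
      proof -
        have "2 * pi * (?h x * ?\<gamma> x * cis (- (t * x))) = (LINT s|lborel. fourier f s * cis (s * x)) * (?\<gamma> x * cis (- (t * x)))"
          by simp
        also have "\<dots> = (LINT s|lborel. (fourier f s * cis (s * x)) * (?\<gamma> x * cis (- (t * x))))"
          by (rule integral_mult_left_zero[symmetric])
        also have "\<dots> = (LINT s|lborel. (fourier f s * ?\<gamma> x) * cis (s * x - t * x))"
          by (rule Bochner_Integration.integral_cong) (simp_all only: cis_diff mult_ac)
        finally show ?thesis .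
      qed
      then show ?thesis
        unfolding fourier_def[of "\<lambda>x. ?h x * ?\<gamma> x"] integral_mult_right_zero[symmetric] by simp
    qed
    also have "\<dots> = (LINT s|lborel. (LINT x|lborel. (fourier f s * ?\<gamma> x) * cis (s * x - t * x)))"
      by (rule lborel_pair.Fubini_integral)
        (use bound2[OF F g, of "\<lambda>p. fst p * snd p - t * snd p"] in \<open>simp add: case_prod_beta'\<close>)
    also have "\<dots> = (LINT s|lborel. fourier f s * (of_real (sqrt (2 * pi)) * ?\<gamma> (s - t)))"
    proof (rule Bochner_Integration.integral_cong)
      fix s
      have "(LINT x|lborel. (fourier f s * ?\<gamma> x) * cis (s * x - t * x)) = fourier f s * (LINT x|lborel. ?\<gamma> x * cis ((s - t) * x))"
        by (simp add: mult.assoc left_diff_distrib)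
      then show "(LINT x|lborel. (fourier f s * ?\<gamma> x) * cis (s * x - t * x)) = fourier f s * (of_real (sqrt (2 * pi)) * ?\<gamma> (s - t))"
        unfolding \<gamma>F .
    qed simp
    also have "\<dots> = of_real (sqrt (2 * pi)) * (LINT s|lborel. ?\<gamma> (s - t) * fourier f s)"
      by (subst integral_mult_right_zero[symmetric]) (simp add: mult_ac)
    also have "\<dots> = 2 * pi * fourier (\<lambda>x. f x * ?\<gamma> x) t"
      unfolding 1[symmetric] by (simp flip: mult.assoc of_real_mult)
    finally show ?thesis by simp
  qed
  then have "fourier (\<lambda>x. f x * ?\<gamma> x - ?h x * ?\<gamma> x) t = 0" for t
  proof -
    have i: "integrable lborel (\<lambda>x. a x * cis (- (t * x)))" if "integrable lborel a" for a :: "real \<Rightarrow> complex"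
      using that by (intro Bochner_Integration.integrable_bound[OF that]) (auto simp: norm_mult)
    show ?thesis
      using \<open>fourier (\<lambda>x. f x * ?\<gamma> x) t = fourier (\<lambda>x. ?h x * ?\<gamma> x) t\<close> Bochner_Integration.integral_diff[OF i[OF fg] i[OF hg]]
      unfolding fourier_def left_diff_distrib by simp
  qed
  then have "AE x in lborel. f x * ?\<gamma> x - ?h x * ?\<gamma> x = 0"
    by (intro fourier_eq_0_AE) (use fg hg in auto)
  then show ?thesis
  proof eventually_elim
    case (elim x)
    then have "(f x - ?h x) * ?\<gamma> x = 0" by (simp add: left_diff_distrib)
    moreover have "?\<gamma> x \<noteq> 0" using normal_density_pos[of 1 0 x] by simp
    ultimately show ?case by simp
  qed
qed

section \<open>Measure preserving maps and slices\<close>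

definition mpres :: "'a measure \<Rightarrow> 'b measure \<Rightarrow> ('a \<Rightarrow> 'b) \<Rightarrow> bool" where
  "mpres M N T \<longleftrightarrow> T \<in> measurable M N \<and> distr M N T = N"

lemma mpres_measurable: "mpres M N T \<Longrightarrow> T \<in> measurable M N"
  by (simp add: mpres_def)

lemma mpres_nn_integral:
  "mpres M N T \<Longrightarrow> f \<in> borel_measurable N \<Longrightarrow> (\<integral>\<^sup>+x. f (T x) \<partial>M) = (\<integral>\<^sup>+y. f y \<partial>N)"
  by (metis mpres_def nn_integral_distr)

lemma mpres_integral:
  fixes f :: "'b \<Rightarrow> complex"
  shows "mpres M N T \<Longrightarrow> f \<in> borel_measurable N \<Longrightarrow> (LINT x|M. f (T x)) = (LINT y|N. f y)"
  by (metis mpres_def integral_distr)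

lemma mpres_AE: "mpres M N T \<Longrightarrow> AE y in N. P y \<Longrightarrow> AE x in M. P (T x)"
  by (metis mpres_def AE_distrD)

lemma mpresI:
  assumes T: "T \<in> measurable M N"
    and eq: "\<And>f. f \<in> borel_measurable N \<Longrightarrow> (\<integral>\<^sup>+x. f (T x) \<partial>M) = (\<integral>\<^sup>+y. f y \<partial>N)"
  shows "mpres M N T"
  unfolding mpres_def
proof (intro conjI T measure_eqI)
  fix A assume "A \<in> sets (distr M N T)"
  then have A: "A \<in> sets N" by simp
  have "emeasure (distr M N T) A = (\<integral>\<^sup>+y. indicator A y \<partial>distr M N T)" using A by simp
  also have "\<dots> = (\<integral>\<^sup>+x. indicator A (T x) \<partial>M)" by (rule nn_integral_distr[OF T]) (use A in simp)
  also have "\<dots> = (\<integral>\<^sup>+y. indicator A y \<partial>N)" by (rule eq) (use A in simp)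
  finally show "emeasure (distr M N T) A = emeasure N A" using A by simp
qed simp

lemma mpres_comp:
  assumes "mpres M N S" "mpres N P T"
  shows "mpres M P (\<lambda>x. T (S x))"
proof (rule mpresI)
  show "(\<lambda>x. T (S x)) \<in> measurable M P"
    using assms by (auto dest!: mpres_measurable intro: measurable_compose)
  fix f :: "'c \<Rightarrow> ennreal" assume f: "f \<in> borel_measurable P"
  have "(\<lambda>y. f (T y)) \<in> borel_measurable N"
    using f assms(2) by (auto dest!: mpres_measurable intro: measurable_compose)
  from mpres_nn_integral[OF assms(1) this] mpres_nn_integral[OF assms(2) f]
  show "(\<integral>\<^sup>+x. f (T (S x)) \<partial>M) = (\<integral>\<^sup>+y. f y \<partial>P)" by simp
qed

lemma mpres_swap:
  assumes "sigma_finite_measure M" "sigma_finite_measure N"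
  shows "mpres (M \<Otimes>\<^sub>M N) (N \<Otimes>\<^sub>M M) (\<lambda>p. (snd p, fst p))"
proof -
  interpret pair_sigma_finite N M using assms by (simp add: pair_sigma_finite_def)
  have eq: "(\<lambda>p. (snd p, fst p)) = (\<lambda>(x, y). (y, x))" by auto
  show ?thesis
    unfolding mpres_def eq by (intro conjI measurable_pair_swap' distr_pair_swap[symmetric])
qed

text \<open>Fubini: the base coordinate is kept and every fibre map preserves measure. Together with
  swaps and products this is the main ingredient of the changes of variables below.\<close>

lemma mpres_shear:
  assumes N: "sigma_finite_measure N" and N': "sigma_finite_measure N'"
    and m: "(\<lambda>p. \<phi> (fst p) (snd p)) \<in> measurable (M \<Otimes>\<^sub>M N) N'"
    and \<phi>: "\<And>x. x \<in> space M \<Longrightarrow> mpres N N' (\<phi> x)"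
  shows "mpres (M \<Otimes>\<^sub>M N) (M \<Otimes>\<^sub>M N') (\<lambda>p. (fst p, \<phi> (fst p) (snd p)))"
proof (rule mpresI)
  note [measurable] = m
  show T [measurable]: "(\<lambda>p. (fst p, \<phi> (fst p) (snd p))) \<in> measurable (M \<Otimes>\<^sub>M N) (M \<Otimes>\<^sub>M N')"
    by measurable
  fix f :: "'c \<times> 'b \<Rightarrow> ennreal" assume f [measurable]: "f \<in> borel_measurable (M \<Otimes>\<^sub>M N')"
  have "(\<integral>\<^sup>+p. f (fst p, \<phi> (fst p) (snd p)) \<partial>(M \<Otimes>\<^sub>M N)) = (\<integral>\<^sup>+x. \<integral>\<^sup>+y. f (x, \<phi> x y) \<partial>N \<partial>M)"
    by (subst sigma_finite_measure.nn_integral_fst[OF N, symmetric]) auto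
  also have "\<dots> = (\<integral>\<^sup>+x. \<integral>\<^sup>+y. f (x, y) \<partial>N' \<partial>M)"
    by (intro nn_integral_cong mpres_nn_integral[OF \<phi>, where f = "\<lambda>y. f (_, y)"]) auto
  also have "\<dots> = (\<integral>\<^sup>+p. f p \<partial>(M \<Otimes>\<^sub>M N'))"
    by (rule sigma_finite_measure.nn_integral_fst[OF N']) simp
  finally show "(\<integral>\<^sup>+p. f (fst p, \<phi> (fst p) (snd p)) \<partial>(M \<Otimes>\<^sub>M N)) = (\<integral>\<^sup>+p. f p \<partial>(M \<Otimes>\<^sub>M N'))" .
qed

lemma mpres_assoc:
  assumes M: "sigma_finite_measure M2" "sigma_finite_measure M3"
  shows "mpres ((M1 \<Otimes>\<^sub>M M2) \<Otimes>\<^sub>M M3) (M1 \<Otimes>\<^sub>M (M2 \<Otimes>\<^sub>M M3)) (\<lambda>p. (fst (fst p), (snd (fst p), snd p)))"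
proof (rule mpresI)
  note fst2 = sigma_finite_measure.nn_integral_fst[OF M(1)] and fst3 = sigma_finite_measure.nn_integral_fst[OF M(2)]
    and fst23 = sigma_finite_measure.nn_integral_fst[OF sigma_finite_pair_measure[OF M]]
  interpret M3: sigma_finite_measure M3 by (rule M)
  interpret M2: sigma_finite_measure M2 by (rule M)
  show [measurable]: "(\<lambda>p. (fst (fst p), (snd (fst p), snd p))) \<in> measurable ((M1 \<Otimes>\<^sub>M M2) \<Otimes>\<^sub>M M3) (M1 \<Otimes>\<^sub>M (M2 \<Otimes>\<^sub>M M3))"
    by measurable
  fix f :: "'c \<times> 'a \<times> 'b \<Rightarrow> ennreal" assume [measurable]: "f \<in> borel_measurable (M1 \<Otimes>\<^sub>M (M2 \<Otimes>\<^sub>M M3))"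
  have "(\<integral>\<^sup>+p. f (fst (fst p), (snd (fst p), snd p)) \<partial>((M1 \<Otimes>\<^sub>M M2) \<Otimes>\<^sub>M M3))
      = (\<integral>\<^sup>+q. \<integral>\<^sup>+c. f (fst q, snd q, c) \<partial>M3 \<partial>(M1 \<Otimes>\<^sub>M M2))"
    by (subst fst3[symmetric]) auto
  also have "\<dots> = (\<integral>\<^sup>+a. \<integral>\<^sup>+b. \<integral>\<^sup>+c. f (a, b, c) \<partial>M3 \<partial>M2 \<partial>M1)"
    by (subst fst2[symmetric]) auto
  also have "\<dots> = (\<integral>\<^sup>+a. \<integral>\<^sup>+q. f (a, q) \<partial>(M2 \<Otimes>\<^sub>M M3) \<partial>M1)"
    by (intro nn_integral_cong, subst fst3[symmetric]) auto
  also have "\<dots> = (\<integral>\<^sup>+p. f p \<partial>(M1 \<Otimes>\<^sub>M (M2 \<Otimes>\<^sub>M M3)))"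
    by (subst fst23) auto
  finally show "(\<integral>\<^sup>+p. f (fst (fst p), (snd (fst p), snd p)) \<partial>((M1 \<Otimes>\<^sub>M M2) \<Otimes>\<^sub>M M3)) = (\<integral>\<^sup>+p. f p \<partial>(M1 \<Otimes>\<^sub>M (M2 \<Otimes>\<^sub>M M3)))" .
qed

lemma mpres_interchange:
  assumes M: "sigma_finite_measure M1" "sigma_finite_measure M2" "sigma_finite_measure M3" "sigma_finite_measure M4"
  shows "mpres ((M1 \<Otimes>\<^sub>M M2) \<Otimes>\<^sub>M (M3 \<Otimes>\<^sub>M M4)) ((M1 \<Otimes>\<^sub>M M3) \<Otimes>\<^sub>M (M2 \<Otimes>\<^sub>M M4))
     (\<lambda>p. ((fst (fst p), fst (snd p)), (snd (fst p), snd (snd p))))"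
proof (rule mpresI)
  interpret M2: sigma_finite_measure M2 by (rule M)
  interpret M3: sigma_finite_measure M3 by (rule M)
  interpret M4: sigma_finite_measure M4 by (rule M)
  have nn4: "(\<integral>\<^sup>+p. g p \<partial>((A \<Otimes>\<^sub>M B) \<Otimes>\<^sub>M (C \<Otimes>\<^sub>M D))) = (\<integral>\<^sup>+a. \<integral>\<^sup>+b. \<integral>\<^sup>+c. \<integral>\<^sup>+d. g ((a, b), (c, d)) \<partial>D \<partial>C \<partial>B \<partial>A)"
    if [measurable]: "g \<in> borel_measurable ((A \<Otimes>\<^sub>M B) \<Otimes>\<^sub>M (C \<Otimes>\<^sub>M D))"
      and B: "sigma_finite_measure B" and C: "sigma_finite_measure C" and D: "sigma_finite_measure D"
    for A :: "'s measure" and B :: "'t measure" and C :: "'u measure" and D :: "'v measure" and g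
  proof -
    interpret B: sigma_finite_measure B by (rule B)
    interpret C: sigma_finite_measure C by (rule C)
    interpret D: sigma_finite_measure D by (rule D)
    have "(\<integral>\<^sup>+p. g p \<partial>((A \<Otimes>\<^sub>M B) \<Otimes>\<^sub>M (C \<Otimes>\<^sub>M D))) = (\<integral>\<^sup>+p. \<integral>\<^sup>+q. g (p, q) \<partial>(C \<Otimes>\<^sub>M D) \<partial>(A \<Otimes>\<^sub>M B))"
      by (rule sigma_finite_measure.nn_integral_fst[OF sigma_finite_pair_measure[OF C D], symmetric]) simp
    also have "\<dots> = (\<integral>\<^sup>+p. \<integral>\<^sup>+c. \<integral>\<^sup>+d. g (p, (c, d)) \<partial>D \<partial>C \<partial>(A \<Otimes>\<^sub>M B))"
      by (intro nn_integral_cong, subst sigma_finite_measure.nn_integral_fst[OF D, symmetric]) auto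
    also have "\<dots> = (\<integral>\<^sup>+a. \<integral>\<^sup>+b. \<integral>\<^sup>+c. \<integral>\<^sup>+d. g ((a, b), (c, d)) \<partial>D \<partial>C \<partial>B \<partial>A)"
      by (subst sigma_finite_measure.nn_integral_fst[OF B, symmetric]) auto
    finally show ?thesis .
  qed
  show [measurable]: "(\<lambda>p. ((fst (fst p), fst (snd p)), (snd (fst p), snd (snd p)))) \<in>
     measurable ((M1 \<Otimes>\<^sub>M M2) \<Otimes>\<^sub>M (M3 \<Otimes>\<^sub>M M4)) ((M1 \<Otimes>\<^sub>M M3) \<Otimes>\<^sub>M (M2 \<Otimes>\<^sub>M M4))"
    by measurable
  fix f :: "('a \<times> 'c) \<times> ('b \<times> 'd) \<Rightarrow> ennreal"
  assume f [measurable]: "f \<in> borel_measurable ((M1 \<Otimes>\<^sub>M M3) \<Otimes>\<^sub>M (M2 \<Otimes>\<^sub>M M4))"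
  interpret P: pair_sigma_finite M2 M3 using M by (simp add: pair_sigma_finite_def)
  have "(\<integral>\<^sup>+p. f ((fst (fst p), fst (snd p)), (snd (fst p), snd (snd p))) \<partial>((M1 \<Otimes>\<^sub>M M2) \<Otimes>\<^sub>M (M3 \<Otimes>\<^sub>M M4)))
     = (\<integral>\<^sup>+a. \<integral>\<^sup>+b. \<integral>\<^sup>+c. \<integral>\<^sup>+d. f ((a, c), (b, d)) \<partial>M4 \<partial>M3 \<partial>M2 \<partial>M1)"
    by (subst nn4) (use M in auto)
  also have "\<dots> = (\<integral>\<^sup>+a. \<integral>\<^sup>+c. \<integral>\<^sup>+b. \<integral>\<^sup>+d. f ((a, c), (b, d)) \<partial>M4 \<partial>M2 \<partial>M3 \<partial>M1)"
  proof (rule nn_integral_cong)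
    fix a assume [measurable]: "a \<in> space M1"
    have "(\<lambda>q. \<integral>\<^sup>+d. f ((a, snd q), (fst q, d)) \<partial>M4) \<in> borel_measurable (M2 \<Otimes>\<^sub>M M3)" by measurable
    from P.Fubini'[of "\<lambda>b c. \<integral>\<^sup>+d. f ((a, c), (b, d)) \<partial>M4"] this
    show "(\<integral>\<^sup>+b. \<integral>\<^sup>+c. \<integral>\<^sup>+d. f ((a, c), (b, d)) \<partial>M4 \<partial>M3 \<partial>M2) = (\<integral>\<^sup>+c. \<integral>\<^sup>+b. \<integral>\<^sup>+d. f ((a, c), (b, d)) \<partial>M4 \<partial>M2 \<partial>M3)"
      by (simp add: case_prod_beta')
  qed
  also have "\<dots> = (\<integral>\<^sup>+p. f p \<partial>((M1 \<Otimes>\<^sub>M M3) \<Otimes>\<^sub>M (M2 \<Otimes>\<^sub>M M4)))"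
    by (rule nn4[symmetric]) (use M in auto)
  finally show "(\<integral>\<^sup>+p. f ((fst (fst p), fst (snd p)), (snd (fst p), snd (snd p))) \<partial>((M1 \<Otimes>\<^sub>M M2) \<Otimes>\<^sub>M (M3 \<Otimes>\<^sub>M M4)))
     = (\<integral>\<^sup>+p. f p \<partial>((M1 \<Otimes>\<^sub>M M3) \<Otimes>\<^sub>M (M2 \<Otimes>\<^sub>M M4)))" .
qed

section \<open>Null sets, products and slices\<close>

lemma AE_pair_snd:
  assumes N: "sigma_finite_measure N" and P: "AE y in N. P y"
  shows "AE p in M \<Otimes>\<^sub>M N. P (snd p)"
proof -
  interpret N: sigma_finite_measure N by (rule N)
  from P obtain Z where Z: "{y \<in> space N. \<not> P y} \<subseteq> Z" "emeasure N Z = 0" "Z \<in> sets N"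
    by (rule AE_E)
  have "emeasure (M \<Otimes>\<^sub>M N) (space M \<times> Z) = 0"
    using Z by (simp add: N.emeasure_pair_measure_Times)
  then have "space M \<times> Z \<in> null_sets (M \<Otimes>\<^sub>M N)"
    using Z by (intro null_setsI) auto
  then show ?thesis
    by (rule AE_I') (use Z in \<open>auto simp: space_pair_measure\<close>)
qed

lemma AE_pair_fst:
  assumes M: "AE x in M. P x" and N: "sigma_finite_measure N"
  shows "AE p in M \<Otimes>\<^sub>M N. P (fst p)"
proof -
  interpret N: sigma_finite_measure N by (rule N)
  from M obtain Z where Z: "{y \<in> space M. \<not> P y} \<subseteq> Z" "emeasure M Z = 0" "Z \<in> sets M"
    by (rule AE_E)
  have "emeasure (M \<Otimes>\<^sub>M N) (Z \<times> space N) = 0"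
    using Z by (simp add: N.emeasure_pair_measure_Times)
  then have "Z \<times> space N \<in> null_sets (M \<Otimes>\<^sub>M N)"
    using Z by (intro null_setsI) auto
  then show ?thesis
    by (rule AE_I') (use Z in \<open>auto simp: space_pair_measure\<close>)
qed

lemma mpres_prod:
  assumes S: "mpres M M' S" and T: "mpres N N' T"
    and M: "sigma_finite_measure M'" and N: "sigma_finite_measure N'"
  shows "mpres (M \<Otimes>\<^sub>M N) (M' \<Otimes>\<^sub>M N') (\<lambda>p. (S (fst p), T (snd p)))"
proof -
  have "distr M M' S \<Otimes>\<^sub>M distr N N' T = distr (M \<Otimes>\<^sub>M N) (M' \<Otimes>\<^sub>M N') (\<lambda>(x, y). (S x, T y))"
    by (rule pair_measure_distr) (use S T N in \<open>auto simp: mpres_def\<close>)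
  moreover have "(\<lambda>(x, y). (S x, T y)) = (\<lambda>p. (S (fst p), T (snd p)))" by auto
  moreover have "(\<lambda>p. (S (fst p), T (snd p))) \<in> measurable (M \<Otimes>\<^sub>M N) (M' \<Otimes>\<^sub>M N')"
    using mpres_measurable[OF S] mpres_measurable[OF T] by measurable
  ultimately show ?thesis using S T by (simp add: mpres_def)
qed

lemma mpres_id: "mpres M M (\<lambda>x. x)"
  by (rule mpresI) auto

lemma mpres_lborel_plus: "mpres lborel lborel (\<lambda>x :: 'a :: euclidean_space. c + x)"
  using lborel_distr_plus[of c] by (simp add: mpres_def cong: distr_cong)

lemma mpres_lborel_minus: "mpres lborel lborel (\<lambda>x :: 'a :: euclidean_space. c - x)"
proof (rule mpresI)
  fix f :: "'a \<Rightarrow> ennreal" assume f: "f \<in> borel_measurable lborel"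
  have "lborel = distr lborel borel (\<lambda>x :: 'a. c - x)"
    using lborel_affine[of "-1" c] by (simp add: density_1)
  then have "(\<integral>\<^sup>+x. f x \<partial>lborel) = (\<integral>\<^sup>+x. f x \<partial>distr lborel borel (\<lambda>x :: 'a. c - x))" by simp
  also have "\<dots> = (\<integral>\<^sup>+x. f (c - x) \<partial>lborel)"
    using f by (intro nn_integral_distr) auto
  finally show "(\<integral>\<^sup>+x. f (c - x) \<partial>lborel) = (\<integral>\<^sup>+x. f x \<partial>lborel)" ..
qed simp

text \<open>Square integrability is derived from the two bounds and finiteness is part of the
  conclusion, so the inequality can be used to prove integrability by iterated integrals.\<close>

lemma nn_integral_Cauchy_Schwarz:
  fixes a b :: "'a \<Rightarrow> complex"
  assumes [measurable]: "a \<in> borel_measurable M" "b \<in> borel_measurable M"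
    and A: "(\<integral>\<^sup>+x. ennreal ((cmod (a x))\<^sup>2) \<partial>M) \<le> ennreal (A\<^sup>2)" "0 \<le> A"
    and B: "(\<integral>\<^sup>+x. ennreal ((cmod (b x))\<^sup>2) \<partial>M) \<le> ennreal (B\<^sup>2)" "0 \<le> B"
  shows "(\<integral>\<^sup>+x. ennreal (cmod (a x) * cmod (b x)) \<partial>M) \<le> ennreal (A * B)"
proof -
  have a: "a \<in> L2 M" and b: "b \<in> L2 M"
    using A(1) B(1) by (auto simp: L2_iff_nn intro: le_less_trans)
  have "L2_norm M a \<le> A" "L2_norm M b \<le> B"
    using A B by (auto simp: L2_norm_nn a b intro: power2_le_imp_le)
  then have "L2_norm M a * L2_norm M b \<le> A * B" using A(2) by (intro mult_mono) auto
  then have "(LINT x|M. cmod (a x) * cmod (b x)) \<le> A * B"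
    using L2_norm_mult_le[OF a b] by linarith
  then show ?thesis
    by (subst nn_integral_eq_integral[OF L2_norm_mult_integrable[OF a b]]) (auto intro: ennreal_leI)
qed

text \<open>Tonelli's theorem. On the slices of infinite norm, which form a null set,
  \<open>L2_norm\<close> has the default value 0 of a divergent integral.\<close>

lemma L2_slices:
  assumes N: "sigma_finite_measure N" and f: "f \<in> L2 (M \<Otimes>\<^sub>M N)"
  shows "AE x in M. (\<lambda>y. f (x, y)) \<in> L2 N"
    and "(\<lambda>x. L2_norm N (\<lambda>y. f (x, y))) \<in> borel_measurable M"
    and "(\<integral>\<^sup>+x. ennreal ((L2_norm N (\<lambda>y. f (x, y)))\<^sup>2) \<partial>M) = ennreal ((L2_norm (M \<Otimes>\<^sub>M N) f)\<^sup>2)"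
proof -
  interpret N: sigma_finite_measure N by (rule N)
  note [measurable] = L2_measurable[OF f]
  have fst: "(\<integral>\<^sup>+x. \<integral>\<^sup>+y. ennreal ((cmod (f (x, y)))\<^sup>2) \<partial>N \<partial>M) = ennreal ((L2_norm (M \<Otimes>\<^sub>M N) f)\<^sup>2)"
    unfolding L2_norm_nn[OF f, symmetric] by (rule N.nn_integral_fst) simp
  then have "AE x in M. (\<integral>\<^sup>+y. ennreal ((cmod (f (x, y)))\<^sup>2) \<partial>N) \<noteq> \<infinity>"
    by (intro nn_integral_PInf_AE) auto
  then have ae: "AE x in M. x \<in> space M \<and> (\<lambda>y. f (x, y)) \<in> L2 N"
    using AE_space[of M] by eventually_elim (auto simp: L2_iff_nn less_top)
  then show "AE x in M. (\<lambda>y. f (x, y)) \<in> L2 N" by eventually_elim simp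
  show "(\<lambda>x. L2_norm N (\<lambda>y. f (x, y))) \<in> borel_measurable M"
    unfolding L2_norm_def by measurable
  have "(\<integral>\<^sup>+x. ennreal ((L2_norm N (\<lambda>y. f (x, y)))\<^sup>2) \<partial>M) = (\<integral>\<^sup>+x. \<integral>\<^sup>+y. ennreal ((cmod (f (x, y)))\<^sup>2) \<partial>N \<partial>M)"
    by (rule nn_integral_cong_AE, use ae in eventually_elim) (simp add: L2_norm_nn)
  then show "(\<integral>\<^sup>+x. ennreal ((L2_norm N (\<lambda>y. f (x, y)))\<^sup>2) \<partial>M) = ennreal ((L2_norm (M \<Otimes>\<^sub>M N) f)\<^sup>2)"
    using fst by simp
qed

section \<open>The basic estimate on the plane\<close>

lemma integrable_fourier_kernel:
  assumes "integrable lborel f"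
  shows "integrable lborel (\<lambda>x. f x * cis (t * x))"
  using assms by (intro Bochner_Integration.integrable_bound[OF assms]) (auto simp: norm_mult)

lemma cnj_fourier: "cnj (fourier h t) = (LINT y|lborel. cnj (h y) * cis (t * y))"
  unfolding fourier_def by (simp flip: Bochner_Integration.integral_cnj add: cis_cnj)

text \<open>Write \<open>a\<close> and \<open>y\<close> for the two coordinates of \<open>p\<close>.
  After insertion of the inversion formula for \<open>v\<close>, the product
  \<open>cis (s * (y - a)) * cis (\<nu> * (c - a - y))\<close> equals \<open>cis (\<nu> * c) * cis
  (- ((s + \<nu>) * a)) * cis ((s - \<nu>) * y)\<close>. For fixed \<open>s\<close> the double
  integral is therefore a product of two transforms, and \<open>c\<close> survives only in a factor
  of modulus 1.\<close>

lemma fourier_pair_bound: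
  assumes v: "integrable lborel v" "integrable lborel (fourier v)"
    and f: "integrable lborel f" and h: "integrable lborel h"
  shows "ennreal (cmod (LINT p|(lborel \<Otimes>\<^sub>M lborel). v (snd p - fst p) * cis (\<nu> * (c - fst p - snd p)) * f (fst p) * cnj (h (snd p))))
    \<le> (\<integral>\<^sup>+s. ennreal (cmod (fourier v s) * (cmod (fourier f (s + \<nu>)) * cmod (fourier h (s - \<nu>)))) \<partial>lborel) * ennreal (1 / (2 * pi))"
proof -
  let ?L2 = "lborel \<Otimes>\<^sub>M lborel :: (real \<times> real) measure"
  have [measurable]: "v \<in> borel_measurable borel" "f \<in> borel_measurable borel" "h \<in> borel_measurable borel"
    using v f h by auto
  define W where "W y = (LINT s|lborel. fourier v s * cis (s * y)) / (2 * pi)" for y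
  have [measurable]: "W \<in> borel_measurable borel" unfolding W_def by measurable
  have "AE y in lborel. v y = W y"
    using fourier_inversion_AE[OF v] by (simp add: W_def)
  then have "AE p in ?L2. v (snd p) = W (snd p)"
    by (rule AE_pair_snd[OF lborel.sigma_finite_measure_axioms])
  \<comment> \<open>The inversion formula holds for almost every real argument; the shear turns this
    into a statement on almost every pair.\<close>
  moreover have "mpres ?L2 ?L2 (\<lambda>p. (fst p, snd p - fst p))"
    by (rule mpres_shear[where \<phi> = "\<lambda>a y. y - a"])
      (use mpres_lborel_plus[of "- a" for a :: real] in \<open>auto intro: lborel.sigma_finite_measure_axioms\<close>)
  ultimately have vW: "AE p in ?L2. v (snd p - fst p) = W (snd p - fst p)"
    using mpres_AE[of ?L2 ?L2 "\<lambda>p. (fst p, snd p - fst p)" "\<lambda>p. v (snd p) = W (snd p)"] by simp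
  define G where "G p s = cis (\<nu> * c) / (2 * pi) * fourier v s * ((f (fst p) * cis (- ((s + \<nu>) * fst p))) * (cnj (h (snd p)) * cis ((s - \<nu>) * snd p)))"
    for p :: "real \<times> real" and s
  have G: "W (snd p - fst p) * cis (\<nu> * (c - fst p - snd p)) * f (fst p) * cnj (h (snd p)) = (LINT s|lborel. G p s)" for p
  proof -
    have "G p s = (fourier v s * cis (s * (snd p - fst p))) * (cis (\<nu> * (c - fst p - snd p)) * f (fst p) * cnj (h (snd p)) / (2 * pi))" for s
    proof -
      have "cis (\<nu> * c) * (cis (- ((s + \<nu>) * fst p)) * cis ((s - \<nu>) * snd p)) = cis (s * (snd p - fst p)) * cis (\<nu> * (c - fst p - snd p))"
        by (simp add: cis_mult algebra_simps)
      then show ?thesis unfolding G_def by (simp add: field_simps)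
    qed
    then have "(LINT s|lborel. G p s) = (LINT s|lborel. (fourier v s * cis (s * (snd p - fst p)))) * (cis (\<nu> * (c - fst p - snd p)) * f (fst p) * cnj (h (snd p)) / (2 * pi))"
      by (simp only: integral_mult_left_zero)
    then show ?thesis by (simp add: W_def)
  qed
  interpret P: pair_sigma_finite ?L2 lborel
    by (simp add: pair_sigma_finite_def lborel.sigma_finite_measure_axioms sigma_finite_pair_measure)
  have int: "integrable (?L2 \<Otimes>\<^sub>M lborel) (\<lambda>(p, s). G p s)"
  proof (rule Bochner_Integration.integrable_bound)
    have "integrable ?L2 (\<lambda>p. f (fst p) * cnj (h (snd p)))"
      by (rule integrable_pair_mult[where g = "\<lambda>y. cnj (h y)"]) (use f h in \<open>auto intro: lborel.sigma_finite_measure_axioms\<close>)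
    then show "integrable (?L2 \<Otimes>\<^sub>M lborel) (\<lambda>r. (f (fst (fst r)) * cnj (h (snd (fst r)))) * fourier v (snd r))"
      by (rule integrable_pair_mult[rotated 2]) (use v in \<open>auto intro: lborel.sigma_finite_measure_axioms sigma_finite_pair_measure\<close>)
    show "(\<lambda>(p, s). G p s) \<in> borel_measurable (?L2 \<Otimes>\<^sub>M lborel)"
      unfolding G_def by measurable
    have "x / (2 * pi) \<le> x" if "0 \<le> x" for x
      using mult_right_mono[of 1 "2 * pi" x] that pi_gt3 by (simp add: divide_le_eq mult.commute)
    then show "AE r in ?L2 \<Otimes>\<^sub>M lborel. cmod (case r of (p, s) \<Rightarrow> G p s) \<le> cmod ((f (fst (fst r)) * cnj (h (snd (fst r)))) * fourier v (snd r))"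
      by (intro AE_I2) (simp add: G_def norm_mult norm_divide case_prod_beta mult_ac)
  qed
  have "(LINT p|?L2. v (snd p - fst p) * cis (\<nu> * (c - fst p - snd p)) * f (fst p) * cnj (h (snd p)))
      = (LINT p|?L2. W (snd p - fst p) * cis (\<nu> * (c - fst p - snd p)) * f (fst p) * cnj (h (snd p)))"
    by (rule integral_cong_AE) (measurable, use vW in eventually_elim, simp)
  also have "\<dots> = (LINT p|?L2. LINT s|lborel. G p s)" by (simp add: G)
  also have "\<dots> = (LINT s|lborel. LINT p|?L2. G p s)" by (rule P.Fubini_integral[OF int, symmetric])
  also have "ennreal (cmod \<dots>) \<le> (\<integral>\<^sup>+s. ennreal (cmod (LINT p|?L2. G p s)) \<partial>lborel)"
    by (rule integral_norm_bound_ennreal) (rule P.integrable_snd[OF int])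
  also have "\<dots> = (\<integral>\<^sup>+s. ennreal (cmod (fourier v s) * (cmod (fourier f (s + \<nu>)) * cmod (fourier h (s - \<nu>)))) * ennreal (1 / (2 * pi)) \<partial>lborel)"
  proof (rule nn_integral_cong)
    fix s :: real
    have "(LINT p|?L2. (f (fst p) * cis (- ((s + \<nu>) * fst p))) * (cnj (h (snd p)) * cis ((s - \<nu>) * snd p)))
        = fourier f (s + \<nu>) * cnj (fourier h (s - \<nu>))"
      unfolding cnj_fourier fourier_def[of f]
      by (rule integrable_pair_mult(2)[where f = "\<lambda>x. f x * cis (- ((s + \<nu>) * x))" and g = "\<lambda>y. cnj (h y) * cis ((s - \<nu>) * y)"])
        (use integrable_fourier_kernel[OF f, of "- (s + \<nu>)", unfolded mult_minus_left] integrable_fourier_kernel[of "\<lambda>y. cnj (h y)" "s - \<nu>"] h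
          in \<open>auto intro: lborel.sigma_finite_measure_axioms\<close>)
    then have "(LINT p|?L2. G p s) = cis (\<nu> * c) / (2 * pi) * fourier v s * (fourier f (s + \<nu>) * cnj (fourier h (s - \<nu>)))"
      unfolding G_def by simp
    then show "ennreal (cmod (LINT p|?L2. G p s)) = ennreal (cmod (fourier v s) * (cmod (fourier f (s + \<nu>)) * cmod (fourier h (s - \<nu>)))) * ennreal (1 / (2 * pi))"
      by (simp add: norm_mult norm_divide flip: ennreal_mult)
  qed
  also have "\<dots> = (\<integral>\<^sup>+s. ennreal (cmod (fourier v s) * (cmod (fourier f (s + \<nu>)) * cmod (fourier h (s - \<nu>)))) \<partial>lborel) * ennreal (1 / (2 * pi))"
    by (rule nn_integral_multc) measurable
  finally show ?thesis .
qed

lemma partial_Plancherel_le: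
  assumes f: "f \<in> L2 (lborel \<Otimes>\<^sub>M lborel :: (real \<times> real) measure)"
    and int: "AE b in lborel. integrable lborel (\<lambda>a. f (a, b))"
  shows "(\<integral>\<^sup>+b. \<integral>\<^sup>+q. ennreal ((cmod (fourier (\<lambda>a. f (a, b)) q))\<^sup>2) \<partial>lborel \<partial>lborel)
    \<le> ennreal (2 * pi * (L2_norm (lborel \<Otimes>\<^sub>M lborel) f)\<^sup>2)"
proof -
  let ?L2 = "lborel \<Otimes>\<^sub>M lborel :: (real \<times> real) measure"
  note [measurable] = L2_measurable[OF f]
  have "(\<integral>\<^sup>+b. \<integral>\<^sup>+a. ennreal ((cmod (f (a, b)))\<^sup>2) \<partial>lborel \<partial>lborel) = (\<integral>\<^sup>+p. ennreal ((cmod (f p))\<^sup>2) \<partial>?L2)"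
    by (rule lborel_pair.nn_integral_snd) measurable
  also have "\<dots> = ennreal ((L2_norm ?L2 f)\<^sup>2)" by (rule L2_norm_nn[OF f])
  finally have total: "(\<integral>\<^sup>+b. \<integral>\<^sup>+a. ennreal ((cmod (f (a, b)))\<^sup>2) \<partial>lborel \<partial>lborel) = ennreal ((L2_norm ?L2 f)\<^sup>2)" .
  then have "AE b in lborel. (\<integral>\<^sup>+a. ennreal ((cmod (f (a, b)))\<^sup>2) \<partial>lborel) \<noteq> \<infinity>"
    by (intro nn_integral_PInf_AE) auto
  with int have "(\<integral>\<^sup>+b. \<integral>\<^sup>+q. ennreal ((cmod (fourier (\<lambda>a. f (a, b)) q))\<^sup>2) \<partial>lborel \<partial>lborel)
      \<le> (\<integral>\<^sup>+b. ennreal (2 * pi) * (\<integral>\<^sup>+a. ennreal ((cmod (f (a, b)))\<^sup>2) \<partial>lborel) \<partial>lborel)"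
    by (intro nn_integral_mono_AE, eventually_elim) (auto intro!: fourier_Plancherel_le simp: L2_iff_nn less_top)
  also have "\<dots> = ennreal (2 * pi) * ennreal ((L2_norm ?L2 f)\<^sup>2)"
    by (subst nn_integral_cmult) (auto simp: total)
  finally show ?thesis by (simp add: ennreal_mult)
qed

text \<open>The source of the factor \<open>1 / \<bar>n\<bar>\<close>: at fixed second coordinate
  the frequency \<open>s + n * x\<close> runs through the line with speed |n|. The shear by
  \<open>c * x\<close> preserves the measure. It is applied with \<open>c = 1\<close> to
  \<open>f\<close>, which is evaluated at \<open>b - x\<close>, and with \<open>c = 0\<close> to
  \<open>h\<close>.\<close>

lemma partial_Plancherel_shear:
  assumes f: "f \<in> L2 (lborel \<Otimes>\<^sub>M lborel :: (real \<times> real) measure)"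
    and int: "AE b in lborel. integrable lborel (\<lambda>a. f (a, b))" and n: "n \<noteq> 0"
  shows "(\<integral>\<^sup>+p. ennreal ((cmod (fourier (\<lambda>a. f (a, snd p - c * fst p)) (s + n * fst p)))\<^sup>2) \<partial>(lborel \<Otimes>\<^sub>M lborel))
    \<le> ennreal (2 * pi / \<bar>n\<bar> * (L2_norm (lborel \<Otimes>\<^sub>M lborel) f)\<^sup>2)"
proof -
  let ?L2 = "lborel \<Otimes>\<^sub>M lborel :: (real \<times> real) measure"
  note [measurable] = L2_measurable[OF f]
  let ?k = "\<lambda>b q. ennreal ((cmod (fourier (\<lambda>a. f (a, b)) q))\<^sup>2)"
  have k [measurable]: "(\<lambda>r. ?k (fst r) (snd r)) \<in> borel_measurable (borel \<Otimes>\<^sub>M borel)"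
    unfolding fourier_def by measurable
  have "(\<integral>\<^sup>+p. ?k (snd p - c * fst p) (s + n * fst p) \<partial>?L2) = (\<integral>\<^sup>+p. ?k (snd p) (s + n * fst p) \<partial>?L2)"
  proof -
    have mp: "mpres ?L2 ?L2 (\<lambda>p. (fst p, snd p - c * fst p))"
      by (rule mpres_shear[where \<phi> = "\<lambda>x b. b - c * x"])
        (use mpres_lborel_plus[of "- (c * x)" for x :: real] in \<open>auto intro: lborel.sigma_finite_measure_axioms\<close>)
    have "(\<lambda>p. ?k (snd p) (s + n * fst p)) \<in> borel_measurable ?L2"
      using measurable_compose[of "\<lambda>p. (snd p, s + n * fst p)" ?L2 "borel \<Otimes>\<^sub>M borel", OF _ k] by simp
    from mpres_nn_integral[OF mp this] show ?thesis by simp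
  qed
  also have "\<dots> = (\<integral>\<^sup>+b. \<integral>\<^sup>+x. ?k b (s + n * x) \<partial>lborel \<partial>lborel)"
    by (subst lborel_pair.nn_integral_snd[symmetric])
      (use measurable_compose[of "\<lambda>p. (snd p, s + n * fst p)" ?L2 "borel \<Otimes>\<^sub>M borel", OF _ k] in auto)
  also have "\<dots> = (\<integral>\<^sup>+b. ennreal (1 / \<bar>n\<bar>) * (\<integral>\<^sup>+q. ?k b q \<partial>lborel) \<partial>lborel)"
  proof (rule nn_integral_cong)
    fix b :: real
    have "(\<lambda>q. ?k b q) \<in> borel_measurable borel"
      using measurable_compose[of "\<lambda>q. (b, q)" borel "borel \<Otimes>\<^sub>M borel", OF _ k] by simp
    from nn_integral_real_affine[OF this n, of s]
    show "(\<integral>\<^sup>+x. ?k b (s + n * x) \<partial>lborel) = ennreal (1 / \<bar>n\<bar>) * (\<integral>\<^sup>+q. ?k b q \<partial>lborel)"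
      using n by (simp add: mult.assoc[symmetric] flip: ennreal_mult)
  qed
  also have "\<dots> = ennreal (1 / \<bar>n\<bar>) * (\<integral>\<^sup>+b. \<integral>\<^sup>+q. ?k b q \<partial>lborel \<partial>lborel)"
    by (rule nn_integral_cmult) (use lborel.borel_measurable_nn_integral_fst[of "\<lambda>r. ?k (fst r) (snd r)" borel] k in simp)
  also have "\<dots> \<le> ennreal (1 / \<bar>n\<bar>) * ennreal (2 * pi * (L2_norm ?L2 f)\<^sup>2)"
    by (intro mult_left_mono partial_Plancherel_le f int) simp
  also have "\<dots> = ennreal (2 * pi / \<bar>n\<bar> * (L2_norm ?L2 f)\<^sup>2)"
    by (simp flip: ennreal_mult)
  finally show ?thesis .
qed


text \<open>
  \<open>c\<close> is the fixed sum of the two \<open>y\<close>-coordinates, \<open>a\<close> and \<open>y\<close> are the first \<open>y\<close>-coordinate before and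
  after translation by \<open>y - a\<close>, and \<open>b\<close> is the first \<open>x\<close>-coordinate after translation by \<open>x\<close>.
\<close>
definition plane_kernel :: "(real \<Rightarrow> complex) \<Rightarrow> (real \<Rightarrow> complex) \<Rightarrow> real \<Rightarrow> real \<Rightarrow> (real \<times> real \<Rightarrow> complex) \<Rightarrow> (real \<times> real \<Rightarrow> complex) \<Rightarrow>
    (real \<times> real) \<times> (real \<times> real) \<Rightarrow> complex" where
  "plane_kernel v1 v2 n c f h = (\<lambda>((x, b), (a, y)).
     v1 x * (v2 (y - a) * cis (n * x * (c - a - y)) * f (a, b - x) * cnj (h (y, b))))"

lemma measurable_plane_kernel [measurable]:
  assumes [measurable]: "v1 \<in> borel_measurable borel" "v2 \<in> borel_measurable borel"
    "f \<in> borel_measurable (borel \<Otimes>\<^sub>M borel)" "h \<in> borel_measurable (borel \<Otimes>\<^sub>M borel)"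
  shows "plane_kernel v1 v2 n c f h \<in> borel_measurable ((borel \<Otimes>\<^sub>M borel) \<Otimes>\<^sub>M (borel \<Otimes>\<^sub>M borel))"
  unfolding plane_kernel_def case_prod_beta' by measurable

text \<open>The truncation makes the slices integrable, so that the Fourier transform can be applied to them.\<close>
lemma plane_bound_truncated:
  fixes f h :: "real \<times> real \<Rightarrow> complex"
  assumes v1: "integrable lborel v1" "AE x in lborel. cmod (v1 x) \<le> C" "0 \<le> C"
    and v2: "integrable lborel v2" "integrable lborel (fourier v2)"
    and f: "f \<in> L2 (lborel \<Otimes>\<^sub>M lborel)" and h: "h \<in> L2 (lborel \<Otimes>\<^sub>M lborel)"
    and fi: "AE b in lborel. integrable lborel (\<lambda>a. f (a, b))"
    and hi: "AE b in lborel. integrable lborel (\<lambda>a. h (a, b))"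
    and n: "n \<noteq> 0"
    and int: "integrable ((lborel \<Otimes>\<^sub>M lborel) \<Otimes>\<^sub>M (lborel \<Otimes>\<^sub>M lborel)) (plane_kernel v1 v2 n c f h)"
  shows "\<bar>n\<bar> * cmod (integral\<^sup>L ((lborel \<Otimes>\<^sub>M lborel) \<Otimes>\<^sub>M (lborel \<Otimes>\<^sub>M lborel)) (plane_kernel v1 v2 n c f h))
     \<le> C * (LINT s|lborel. cmod (fourier v2 s)) * L2_norm (lborel \<Otimes>\<^sub>M lborel) f * L2_norm (lborel \<Otimes>\<^sub>M lborel) h"
proof -
  let ?L = "lborel \<Otimes>\<^sub>M lborel :: (real \<times> real) measure"
  have m [measurable]: "v1 \<in> borel_measurable borel" "v2 \<in> borel_measurable borel"
    "f \<in> borel_measurable (borel \<Otimes>\<^sub>M borel)" "h \<in> borel_measurable (borel \<Otimes>\<^sub>M borel)"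
    using v1 v2 L2_measurable[OF f] L2_measurable[OF h] by (auto cong: measurable_cong_sets)
  interpret LL: pair_sigma_finite ?L ?L
    by (simp add: pair_sigma_finite_def sigma_finite_pair_measure lborel.sigma_finite_measure_axioms)
  define J where "J q = (LINT r|?L. v2 (snd r - fst r) * cis (n * fst q * (c - fst r - snd r)) * f (fst r, snd q - fst q) * cnj (h (snd r, snd q)))" for q :: "real \<times> real"
  define A where "A s q = fourier (\<lambda>a. f (a, snd q - fst q)) (s + n * fst q)" for s and q :: "real \<times> real"
  define B where "B s q = fourier (\<lambda>a. h (a, snd q)) (s - n * fst q)" for s and q :: "real \<times> real"
  \<comment> \<open>For every frequency \<open>s\<close>, the norms of \<open>A s\<close> and
    \<open>B s\<close> are at most \<open>sqrt (2 * pi / \<bar>n\<bar>)\<close> times those of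
    \<open>f\<close> and \<open>h\<close>; this is the product of the two bounds, uniform in
    \<open>s\<close>.\<close>
  define N where "N = 2 * pi / \<bar>n\<bar> * (L2_norm ?L f * L2_norm ?L h)"
  have N0: "0 \<le> N" by (simp add: N_def)
  have mA: "(\<lambda>r. A (fst r) (snd r)) \<in> borel_measurable (borel \<Otimes>\<^sub>M (borel \<Otimes>\<^sub>M borel))"
    unfolding A_def fourier_def by measurable
  have mB: "(\<lambda>r. B (fst r) (snd r)) \<in> borel_measurable (borel \<Otimes>\<^sub>M (borel \<Otimes>\<^sub>M borel))"
    unfolding B_def fourier_def by measurable
  have mA' [measurable]: "A s \<in> borel_measurable (borel \<Otimes>\<^sub>M borel)" for s
    unfolding A_def fourier_def by measurable
  have mB' [measurable]: "B s \<in> borel_measurable (borel \<Otimes>\<^sub>M borel)" for s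
    unfolding B_def fourier_def by measurable
  have sq: "(2 * pi / \<bar>n\<bar>) * x\<^sup>2 = (sqrt (2 * pi / \<bar>n\<bar>) * x)\<^sup>2" for x
    by (simp add: power_mult_distrib)
  have CS: "(\<integral>\<^sup>+q. ennreal (cmod (A s q) * cmod (B s q)) \<partial>?L) \<le> ennreal N" for s
  proof -
    have a: "(\<integral>\<^sup>+q. ennreal ((cmod (A s q))\<^sup>2) \<partial>?L) \<le> ennreal ((sqrt (2 * pi / \<bar>n\<bar>) * L2_norm ?L f)\<^sup>2)"
      using partial_Plancherel_shear[OF f fi n, of 1 s] by (simp add: A_def sq[symmetric])
    have b: "(\<integral>\<^sup>+q. ennreal ((cmod (B s q))\<^sup>2) \<partial>?L) \<le> ennreal ((sqrt (2 * pi / \<bar>n\<bar>) * L2_norm ?L h)\<^sup>2)"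
      using partial_Plancherel_shear[OF h hi, of "-n" 0 s] n by (simp add: B_def sq[symmetric])
    have "(\<integral>\<^sup>+q. ennreal (cmod (A s q) * cmod (B s q)) \<partial>?L) \<le> ennreal ((sqrt (2 * pi / \<bar>n\<bar>) * L2_norm ?L f) * (sqrt (2 * pi / \<bar>n\<bar>) * L2_norm ?L h))"
      by (intro nn_integral_Cauchy_Schwarz a b) (auto intro!: mult_nonneg_nonneg)
    also have "(sqrt (2 * pi / \<bar>n\<bar>) * L2_norm ?L f) * (sqrt (2 * pi / \<bar>n\<bar>) * L2_norm ?L h)
       = (sqrt (2 * pi / \<bar>n\<bar>) * sqrt (2 * pi / \<bar>n\<bar>)) * (L2_norm ?L f * L2_norm ?L h)"
      by (simp only: mult_ac)
    also have "\<dots> = N" by (simp add: N_def del: real_sqrt_divide)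
    finally show ?thesis .
  qed
  have aeJ: "AE q in ?L. ennreal (cmod (J q)) \<le> (\<integral>\<^sup>+s. ennreal (cmod (fourier v2 s) * (cmod (A s q) * cmod (B s q))) \<partial>lborel) * ennreal (1 / (2 * pi))"
  proof -
    have mp: "mpres ?L ?L (\<lambda>p. (fst p, snd p - fst p))"
      by (rule mpres_shear[where \<phi> = "\<lambda>a y. y - a"])
        (use mpres_lborel_plus[of "- a" for a :: real] in \<open>auto intro: lborel.sigma_finite_measure_axioms\<close>)
    have "AE q in ?L. integrable lborel (\<lambda>a. f (a, snd q))"
      by (rule AE_pair_snd[OF lborel.sigma_finite_measure_axioms fi])
    from mpres_AE[OF mp this] have "AE q in ?L. integrable lborel (\<lambda>a. f (a, snd q - fst q))" by simp
    moreover have "AE q in ?L. integrable lborel (\<lambda>a. h (a, snd q))"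
      by (rule AE_pair_snd[OF lborel.sigma_finite_measure_axioms hi])
    ultimately show ?thesis
    proof eventually_elim
      case (elim q)
      show ?case
        using fourier_pair_bound[OF v2 elim, of "n * fst q" c] by (simp add: J_def A_def B_def)
    qed
  qed
  have "ennreal (cmod (integral\<^sup>L (?L \<Otimes>\<^sub>M ?L) (plane_kernel v1 v2 n c f h)))
     = ennreal (cmod (LINT q|?L. LINT r|?L. plane_kernel v1 v2 n c f h (q, r)))"
    by (simp add: LL.integral_fst'[OF int])
  also have "\<dots> \<le> (\<integral>\<^sup>+q. ennreal (cmod (LINT r|?L. plane_kernel v1 v2 n c f h (q, r))) \<partial>?L)"
    by (rule integral_norm_bound_ennreal) (rule LL.integrable_fst'[OF int])
  also have "\<dots> = (\<integral>\<^sup>+q. ennreal (cmod (v1 (fst q)) * cmod (J q)) \<partial>?L)"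
    by (simp add: plane_kernel_def J_def case_prod_beta norm_mult)
  also have "\<dots> \<le> (\<integral>\<^sup>+q. ennreal (C / (2 * pi)) * (\<integral>\<^sup>+s. ennreal (cmod (fourier v2 s)) * ennreal (cmod (A s q) * cmod (B s q)) \<partial>lborel) \<partial>?L)"
  proof (rule nn_integral_mono_AE)
    have "AE q in ?L. cmod (v1 (fst q)) \<le> C"
      by (rule AE_pair_fst[OF v1(2) lborel.sigma_finite_measure_axioms])
    with aeJ show "AE q in ?L. ennreal (cmod (v1 (fst q)) * cmod (J q)) \<le> ennreal (C / (2 * pi)) * (\<integral>\<^sup>+s. ennreal (cmod (fourier v2 s)) * ennreal (cmod (A s q) * cmod (B s q)) \<partial>lborel)"
    proof eventually_elim
      case (elim q)
      have "ennreal (cmod (v1 (fst q)) * cmod (J q)) = ennreal (cmod (v1 (fst q))) * ennreal (cmod (J q))"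
        by (simp add: ennreal_mult)
      also have "\<dots> \<le> ennreal C * ((\<integral>\<^sup>+s. ennreal (cmod (fourier v2 s) * (cmod (A s q) * cmod (B s q))) \<partial>lborel) * ennreal (1 / (2 * pi)))"
        by (intro mult_mono elim ennreal_leI) auto
      also have "\<dots> = (ennreal C * ennreal (1 / (2 * pi))) * (\<integral>\<^sup>+s. ennreal (cmod (fourier v2 s) * (cmod (A s q) * cmod (B s q))) \<partial>lborel)"
        by (simp only: mult_ac)
      also have "ennreal C * ennreal (1 / (2 * pi)) = ennreal (C / (2 * pi))"
        using v1(3) by (simp flip: ennreal_mult)
      finally show ?case by (simp add: ennreal_mult)
    qed
  qed
  also have "\<dots> = ennreal (C / (2 * pi)) * (\<integral>\<^sup>+q. \<integral>\<^sup>+s. ennreal (cmod (fourier v2 s)) * ennreal (cmod (A s q) * cmod (B s q)) \<partial>lborel \<partial>?L)"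
  proof (rule nn_integral_cmult)
    show "(\<lambda>q. \<integral>\<^sup>+s. ennreal (cmod (fourier v2 s)) * ennreal (cmod (A s q) * cmod (B s q)) \<partial>lborel) \<in> borel_measurable ?L"
      unfolding A_def B_def fourier_def by measurable
  qed
  also have "(\<integral>\<^sup>+q. \<integral>\<^sup>+s. ennreal (cmod (fourier v2 s)) * ennreal (cmod (A s q) * cmod (B s q)) \<partial>lborel \<partial>?L)
      = (\<integral>\<^sup>+s. \<integral>\<^sup>+q. ennreal (cmod (fourier v2 s)) * ennreal (cmod (A s q) * cmod (B s q)) \<partial>?L \<partial>lborel)"
  proof -
    interpret SL: pair_sigma_finite lborel ?L
      by (simp add: pair_sigma_finite_def sigma_finite_pair_measure lborel.sigma_finite_measure_axioms)
    have "(\<lambda>r. ennreal (cmod (fourier v2 (fst r))) * ennreal (cmod (A (fst r) (snd r)) * cmod (B (fst r) (snd r)))) \<in> borel_measurable (lborel \<Otimes>\<^sub>M ?L)"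
      unfolding A_def B_def fourier_def by measurable
    then show ?thesis
      using SL.Fubini'[of "\<lambda>s q. ennreal (cmod (fourier v2 s)) * ennreal (cmod (A s q) * cmod (B s q))"]
      by (simp add: case_prod_beta')
  qed
  also have "\<dots> \<le> (\<integral>\<^sup>+s. ennreal (cmod (fourier v2 s)) * ennreal N \<partial>lborel)"
    by (intro nn_integral_mono, subst nn_integral_cmult) (auto intro!: mult_left_mono CS)
  also have "\<dots> = ennreal (LINT s|lborel. cmod (fourier v2 s)) * ennreal N"
    by (subst nn_integral_multc) (use v2 in \<open>auto simp: nn_integral_eq_integral\<close>)
  finally have "ennreal (cmod (integral\<^sup>L (?L \<Otimes>\<^sub>M ?L) (plane_kernel v1 v2 n c f h)))
     \<le> ennreal (C / (2 * pi)) * (ennreal (LINT s|lborel. cmod (fourier v2 s)) * ennreal N)"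
    by (simp add: mult_left_mono)
  also have "\<dots> = ennreal (C / (2 * pi) * ((LINT s|lborel. cmod (fourier v2 s)) * N))"
    using v1(3) N0 by (simp flip: ennreal_mult)
  finally have "cmod (integral\<^sup>L (?L \<Otimes>\<^sub>M ?L) (plane_kernel v1 v2 n c f h)) \<le> C / (2 * pi) * ((LINT s|lborel. cmod (fourier v2 s)) * N)"
    by (subst (asm) ennreal_le_iff) (use v1(3) N0 in auto)
  from mult_left_mono[OF this, of "\<bar>n\<bar>"]
  have "\<bar>n\<bar> * cmod (integral\<^sup>L (?L \<Otimes>\<^sub>M ?L) (plane_kernel v1 v2 n c f h)) \<le> \<bar>n\<bar> * (C / (2 * pi) * ((LINT s|lborel. cmod (fourier v2 s)) * N))"
    by simp
  also have "\<dots> = C * (LINT s|lborel. cmod (fourier v2 s)) * L2_norm ?L f * L2_norm ?L h"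
    using n by (simp add: N_def field_simps)
  finally show ?thesis .
qed


text \<open>A square integrable slice need not be integrable, but its restriction to a bounded
  interval is, by Cauchy-Schwarz. The truncated estimate does not depend on the interval, and the
  kernel itself dominates when the truncation is removed.\<close>

lemma plane_bound:
  fixes f h :: "real \<times> real \<Rightarrow> complex"
  assumes v1: "integrable lborel v1" "AE x in lborel. cmod (v1 x) \<le> C" "0 \<le> C"
    and v2: "integrable lborel v2" "integrable lborel (fourier v2)"
    and f: "f \<in> L2 (lborel \<Otimes>\<^sub>M lborel)" and h: "h \<in> L2 (lborel \<Otimes>\<^sub>M lborel)"
    and n: "n \<noteq> 0"
    and int: "integrable ((lborel \<Otimes>\<^sub>M lborel) \<Otimes>\<^sub>M (lborel \<Otimes>\<^sub>M lborel)) (plane_kernel v1 v2 n c f h)"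
  shows "\<bar>n\<bar> * cmod (integral\<^sup>L ((lborel \<Otimes>\<^sub>M lborel) \<Otimes>\<^sub>M (lborel \<Otimes>\<^sub>M lborel)) (plane_kernel v1 v2 n c f h))
     \<le> C * (LINT s|lborel. cmod (fourier v2 s)) * L2_norm (lborel \<Otimes>\<^sub>M lborel) f * L2_norm (lborel \<Otimes>\<^sub>M lborel) h"
proof -
  let ?L = "lborel \<Otimes>\<^sub>M lborel :: (real \<times> real) measure"
  have m [measurable]: "v1 \<in> borel_measurable borel" "v2 \<in> borel_measurable borel"
    "f \<in> borel_measurable (borel \<Otimes>\<^sub>M borel)" "h \<in> borel_measurable (borel \<Otimes>\<^sub>M borel)"
    using v1 v2 L2_measurable[OF f] L2_measurable[OF h] by (auto cong: measurable_cong_sets)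
  define tr :: "nat \<Rightarrow> (real \<times> real \<Rightarrow> complex) \<Rightarrow> real \<times> real \<Rightarrow> complex"
    where "tr k g p = indicator {- real k..real k} (fst p) * g p" for k g p
  have tr_le: "cmod (tr k g p) \<le> cmod (g p)" for k g p
    by (auto simp: tr_def split: split_indicator)
  have tr_m [measurable]: "tr k g \<in> borel_measurable (borel \<Otimes>\<^sub>M borel)" if "g \<in> borel_measurable (borel \<Otimes>\<^sub>M borel)" for k g
    unfolding tr_def using that by measurable
  have tr: "tr k g \<in> L2 ?L" "L2_norm ?L (tr k g) \<le> L2_norm ?L g" "AE b in lborel. integrable lborel (\<lambda>a. tr k g (a, b))"
    if g: "g \<in> L2 ?L" for k g
  proof -
    have gm [measurable]: "g \<in> borel_measurable (borel \<Otimes>\<^sub>M borel)"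
      using L2_measurable[OF g] by (simp cong: measurable_cong_sets)
    have le: "(cmod (tr k g p))\<^sup>2 \<le> (cmod (g p))\<^sup>2" for p by (intro power_mono tr_le) simp
    have i: "integrable ?L (\<lambda>p. (cmod (tr k g p))\<^sup>2)"
      by (rule Bochner_Integration.integrable_bound[OF L2_integrable[OF g]]) (use le in auto)
    show "tr k g \<in> L2 ?L" by (rule L2I) (simp_all add: i)
    show "L2_norm ?L (tr k g) \<le> L2_norm ?L g"
      unfolding L2_norm_def by (intro real_sqrt_le_mono integral_mono i L2_integrable g le)
    have "(\<integral>\<^sup>+b. \<integral>\<^sup>+a. ennreal ((cmod (g (a, b)))\<^sup>2) \<partial>lborel \<partial>lborel) = (\<integral>\<^sup>+p. ennreal ((cmod (g p))\<^sup>2) \<partial>?L)"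
      by (rule lborel_pair.nn_integral_snd) measurable
    also have "\<dots> \<noteq> \<infinity>" using g by (simp add: L2_norm_nn)
    finally have "AE b in lborel. (\<integral>\<^sup>+a. ennreal ((cmod (g (a, b)))\<^sup>2) \<partial>lborel) \<noteq> \<infinity>"
      by (intro nn_integral_PInf_AE) auto
    then show "AE b in lborel. integrable lborel (\<lambda>a. tr k g (a, b))"
    proof eventually_elim
      case (elim b)
      have gb: "(\<lambda>a. g (a, b)) \<in> L2 lborel"
        using elim by (auto simp: L2_iff_nn less_top)
      have ib: "(\<lambda>a. indicator {- real k..real k} a) \<in> L2 lborel"
      proof (rule L2I)
        have "(\<lambda>x. (cmod (indicator {- real k..real k} x))\<^sup>2) = (indicator {- real k..real k} :: real \<Rightarrow> real)"
          by (auto split: split_indicator)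
        then show "integrable lborel (\<lambda>x. (cmod (indicator {- real k..real k} x))\<^sup>2)" by simp
      qed simp
      have "tr k g (a, b) = g (a, b) * cnj (indicator {- real k..real k} a)" for a
        by (simp add: tr_def split: split_indicator)
      then show ?case using L2_mult_integrable[OF gb ib] by simp
    qed
  qed
  have ind: "plane_kernel v1 v2 n c (tr k f) (tr k h) r = (indicator {- real k..real k} (fst (snd r)) * indicator {- real k..real k} (snd (snd r))) * plane_kernel v1 v2 n c f h r" for k r
    by (auto simp: plane_kernel_def tr_def case_prod_beta split: split_indicator)
  have ki: "integrable (?L \<Otimes>\<^sub>M ?L) (plane_kernel v1 v2 n c (tr k f) (tr k h))" for k
  proof (rule Bochner_Integration.integrable_bound[OF int])
    show "plane_kernel v1 v2 n c (tr k f) (tr k h) \<in> borel_measurable (?L \<Otimes>\<^sub>M ?L)" by measurable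
  qed (auto simp: ind norm_mult split: split_indicator)
  have bk: "\<bar>n\<bar> * cmod (integral\<^sup>L (?L \<Otimes>\<^sub>M ?L) (plane_kernel v1 v2 n c (tr k f) (tr k h)))
     \<le> C * (LINT s|lborel. cmod (fourier v2 s)) * L2_norm ?L f * L2_norm ?L h" for k
  proof -
    have "C * (LINT s|lborel. cmod (fourier v2 s)) * L2_norm ?L (tr k f) * L2_norm ?L (tr k h)
       \<le> C * (LINT s|lborel. cmod (fourier v2 s)) * L2_norm ?L f * L2_norm ?L h"
      using v1(3) by (intro mult_mono tr f h order_refl mult_nonneg_nonneg) auto
    then show ?thesis
      using plane_bound_truncated[OF v1 v2 tr(1)[OF f] tr(1)[OF h] tr(3)[OF f] tr(3)[OF h] n ki[of k]]
      by linarith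
  qed
  have "(\<lambda>k. integral\<^sup>L (?L \<Otimes>\<^sub>M ?L) (plane_kernel v1 v2 n c (tr k f) (tr k h))) \<longlonglongrightarrow> integral\<^sup>L (?L \<Otimes>\<^sub>M ?L) (plane_kernel v1 v2 n c f h)"
  proof (rule integral_dominated_convergence[where w = "\<lambda>r. cmod (plane_kernel v1 v2 n c f h r)"])
    show "AE r in ?L \<Otimes>\<^sub>M ?L. (\<lambda>k. plane_kernel v1 v2 n c (tr k f) (tr k h) r) \<longlonglongrightarrow> plane_kernel v1 v2 n c f h r"
    proof (intro AE_I2)
      fix r :: "(real \<times> real) \<times> (real \<times> real)"
      obtain K :: nat where K: "max \<bar>fst (snd r)\<bar> \<bar>snd (snd r)\<bar> \<le> real K" using real_arch_simple by blast
      have "plane_kernel v1 v2 n c (tr k f) (tr k h) r = plane_kernel v1 v2 n c f h r" if "K \<le> k" for k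
        using K of_nat_mono[OF that, where 'a = real] by (auto simp: ind abs_le_iff)
      then show "(\<lambda>k. plane_kernel v1 v2 n c (tr k f) (tr k h) r) \<longlonglongrightarrow> plane_kernel v1 v2 n c f h r"
        by (intro tendsto_eventually eventually_sequentiallyI[of K])
    qed
  qed (use int in \<open>auto simp: ind norm_mult split: split_indicator\<close>)
  then have "(\<lambda>k. \<bar>n\<bar> * cmod (integral\<^sup>L (?L \<Otimes>\<^sub>M ?L) (plane_kernel v1 v2 n c (tr k f) (tr k h))))
      \<longlonglongrightarrow> \<bar>n\<bar> * cmod (integral\<^sup>L (?L \<Otimes>\<^sub>M ?L) (plane_kernel v1 v2 n c f h))"
    by (intro tendsto_intros)
  then show ?thesis by (rule LIMSEQ_le_const2) (use bk in auto)
qed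

section \<open>The circle and the reduced Heisenberg group as measure spaces\<close>

lemma space_circle [simp]: "space circle_measure = sphere 0 1"
  and sets_circle [measurable_cong]: "sets circle_measure = sets (restrict_space borel (sphere 0 1))"
  by (simp_all add: circle_measure_def space_restrict_space)

lemma measurable_circleI:
  assumes "f \<in> borel_measurable M" "\<And>x. x \<in> space M \<Longrightarrow> cmod (f x) = 1"
  shows "f \<in> measurable M circle_measure"
proof -
  have "f \<in> measurable M (restrict_space borel (sphere 0 1))"
    by (rule measurable_restrict_space2) (use assms in auto)
  then show ?thesis by (simp add: sets_circle cong: measurable_cong_sets)
qed

lemma measurable_circle_borel [measurable]: "(\<lambda>z. z) \<in> measurable circle_measure borel"
proof -
  have "(\<lambda>z. z) \<in> measurable (restrict_space borel (sphere 0 1)) borel"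
    by (rule measurable_restrict_space1) simp
  then show ?thesis by (simp add: sets_circle cong: measurable_cong_sets)
qed

lemma measurable_circle_norm: "f \<in> measurable M circle_measure \<Longrightarrow> x \<in> space M \<Longrightarrow> cmod (f x) = 1"
  using measurable_space[of f M circle_measure x] by simp

lemma measurable_circle_borel' [measurable (raw)]:
  "f \<in> measurable M circle_measure \<Longrightarrow> f \<in> borel_measurable M"
  using measurable_compose[OF _ measurable_circle_borel] by simp

lemma measurable_circle_cis [measurable (raw)]:
  "f \<in> borel_measurable M \<Longrightarrow> (\<lambda>x. cis (f x)) \<in> measurable M circle_measure"
  by (rule measurable_circleI) auto

lemma measurable_circle_mult [measurable (raw)]:
  assumes f: "f \<in> measurable M circle_measure" and g: "g \<in> measurable M circle_measure"
  shows "(\<lambda>x. f x * g x) \<in> measurable M circle_measure"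
proof (rule measurable_circleI)
  show "(\<lambda>x. f x * g x) \<in> borel_measurable M"
    using measurable_circle_borel'[OF f] measurable_circle_borel'[OF g] by measurable
qed (simp add: norm_mult measurable_circle_norm[OF f] measurable_circle_norm[OF g])

lemma measurable_circle_cnj [measurable (raw)]:
  assumes f: "f \<in> measurable M circle_measure"
  shows "(\<lambda>x. cnj (f x)) \<in> measurable M circle_measure"
proof (rule measurable_circleI)
  show "(\<lambda>x. cnj (f x)) \<in> borel_measurable M"
    using measurable_circle_borel'[OF f] by measurable
qed (simp add: measurable_circle_norm[OF f])

lemma prob_space_uniform_2pi: "prob_space (uniform_measure lborel {0..<2 * pi})"
  by (rule prob_space_uniform_measure) auto

lemma measurable_cis_restrict: "cis \<in> measurable (uniform_measure lborel {0..<2 * pi}) (restrict_space borel (sphere 0 1))"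
  by (rule measurable_restrict_space2) auto

lemma prob_space_circle: "prob_space circle_measure"
  unfolding circle_measure_def
  by (rule prob_space.prob_space_distr[OF prob_space_uniform_2pi measurable_cis_restrict])

interpretation circle: prob_space circle_measure
  by (rule prob_space_circle)

lemma borel_measurable_circle_cis:
  assumes [measurable]: "f \<in> borel_measurable circle_measure"
  shows "(\<lambda>t. f (cis t)) \<in> borel_measurable borel"
  by measurable

lemma nn_integral_circle:
  assumes f: "f \<in> borel_measurable circle_measure"
  shows "(\<integral>\<^sup>+z. f z \<partial>circle_measure) = (\<integral>\<^sup>+t. f (cis t) * indicator {0..<2 * pi} t \<partial>lborel) / ennreal (2 * pi)"
proof -
  have "(\<integral>\<^sup>+z. f z \<partial>circle_measure) = (\<integral>\<^sup>+t. f (cis t) \<partial>uniform_measure lborel {0..<2 * pi})"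
    unfolding circle_measure_def
    by (rule nn_integral_distr[OF measurable_cis_restrict]) (use f in \<open>simp add: sets_circle cong: measurable_cong_sets\<close>)
  also have "\<dots> = (\<integral>\<^sup>+t. f (cis t) * indicator {0..<2 * pi} t \<partial>lborel) / emeasure lborel {0..<2 * pi}"
    by (rule nn_integral_uniform_measure) (use borel_measurable_circle_cis[OF f] in auto)
  finally show ?thesis by simp
qed

text \<open>The closed interval suits the fundamental theorem of calculus; it differs by a null set
  from the half-open one that defines the measure.\<close>

lemma integral_circle:
  fixes f :: "complex \<Rightarrow> complex"
  assumes f: "f \<in> borel_measurable circle_measure"
  shows "(LINT z|circle_measure. f z) = (LINT t:{0..2 * pi}|lborel. f (cis t)) / (2 * pi)"
proof -
  have m: "(\<lambda>t. f (cis t)) \<in> borel_measurable borel" by (rule borel_measurable_circle_cis[OF f])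
  have "(LINT z|circle_measure. f z) = (LINT t|uniform_measure lborel {0..<2 * pi}. f (cis t))"
    unfolding circle_measure_def
    by (rule integral_distr[OF measurable_cis_restrict]) (use f in \<open>simp add: sets_circle cong: measurable_cong_sets\<close>)
  also have "\<dots> = (LINT t|lborel. (indicator {0..<2 * pi} t / (2 * pi)) *\<^sub>R f (cis t))"
    unfolding uniform_measure_def
    by (subst integral_density[symmetric])
      (use m in \<open>auto intro!: arg_cong2[where f = "integral\<^sup>L"] density_cong AE_I2 split: split_indicator simp: divide_ennreal[symmetric] ennreal_1\<close>)
  also have "\<dots> = (LINT t|lborel. indicator {0..2 * pi} t *\<^sub>R f (cis t) / (2 * pi))"
  proof (rule integral_cong_AE)
    have "AE t in lborel. t \<noteq> 2 * pi" by (rule AE_lborel_singleton)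
    then show "AE t in lborel. (indicator {0..<2 * pi} t / (2 * pi)) *\<^sub>R f (cis t) = indicator {0..2 * pi} t *\<^sub>R f (cis t) / (2 * pi)"
      by eventually_elim (auto split: split_indicator simp: scaleR_conv_of_real)
  qed (use m in measurable)
  finally show ?thesis by (simp add: set_lebesgue_integral_def)
qed

text \<open>Periodicity moves the part of the shifted interval that lies beyond \<open>p\<close>
  back to the beginning.\<close>

lemma nn_integral_periodic_shift:
  fixes F :: "real \<Rightarrow> ennreal"
  assumes [measurable]: "F \<in> borel_measurable borel" and per: "\<And>t. F (t + p) = F t" and \<phi>: "0 \<le> \<phi>" "\<phi> \<le> p"
  shows "(\<integral>\<^sup>+t. F (\<phi> + t) * indicator {0..<p} t \<partial>lborel) = (\<integral>\<^sup>+t. F t * indicator {0..<p} t \<partial>lborel)"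
proof -
  have "(\<integral>\<^sup>+t. F t * indicator {\<phi>..<\<phi> + p} t \<partial>lborel) = (\<integral>\<^sup>+t. F (\<phi> + 1 * t) * indicator {\<phi>..<\<phi> + p} (\<phi> + 1 * t) \<partial>lborel)"
    by (subst nn_integral_real_affine[where c = 1 and t = \<phi>]) auto
  also have "\<dots> = (\<integral>\<^sup>+t. F (\<phi> + t) * indicator {0..<p} t \<partial>lborel)"
    by (rule nn_integral_cong) (auto split: split_indicator)
  finally have 1: "(\<integral>\<^sup>+t. F (\<phi> + t) * indicator {0..<p} t \<partial>lborel) = (\<integral>\<^sup>+t. F t * indicator {\<phi>..<\<phi> + p} t \<partial>lborel)" ..
  have "(\<integral>\<^sup>+t. F t * indicator {p..<\<phi> + p} t \<partial>lborel) = (\<integral>\<^sup>+t. F (p + 1 * t) * indicator {p..<\<phi> + p} (p + 1 * t) \<partial>lborel)"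
    by (subst nn_integral_real_affine[where c = 1 and t = p]) auto
  also have "\<dots> = (\<integral>\<^sup>+t. F t * indicator {0..<\<phi>} t \<partial>lborel)"
    by (rule nn_integral_cong) (auto split: split_indicator simp: per add.commute[of p])
  finally have 2: "(\<integral>\<^sup>+t. F t * indicator {p..<\<phi> + p} t \<partial>lborel) = (\<integral>\<^sup>+t. F t * indicator {0..<\<phi>} t \<partial>lborel)" .
  have "(\<integral>\<^sup>+t. F t * indicator {\<phi>..<\<phi> + p} t \<partial>lborel) = (\<integral>\<^sup>+t. F t * indicator {\<phi>..<p} t + F t * indicator {p..<\<phi> + p} t \<partial>lborel)"
    by (rule nn_integral_cong) (use \<phi> in \<open>auto split: split_indicator\<close>)
  also have "\<dots> = (\<integral>\<^sup>+t. F t * indicator {\<phi>..<p} t \<partial>lborel) + (\<integral>\<^sup>+t. F t * indicator {0..<\<phi>} t \<partial>lborel)"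
    by (subst nn_integral_add) (auto simp: 2)
  also have "\<dots> = (\<integral>\<^sup>+t. F t * indicator {\<phi>..<p} t + F t * indicator {0..<\<phi>} t \<partial>lborel)"
    by (subst nn_integral_add) auto
  also have "\<dots> = (\<integral>\<^sup>+t. F t * indicator {0..<p} t \<partial>lborel)"
    by (rule nn_integral_cong) (use \<phi> in \<open>auto split: split_indicator\<close>)
  finally show ?thesis using 1 by simp
qed

lemma nn_integral_circle_rotate:
  assumes [measurable]: "f \<in> borel_measurable circle_measure" and w: "cmod w = 1"
  shows "(\<integral>\<^sup>+z. f (w * z) \<partial>circle_measure) = (\<integral>\<^sup>+z. f z \<partial>circle_measure)"
proof -
  define \<phi> where "\<phi> = Arg2pi w"
  have \<phi>: "0 \<le> \<phi>" "\<phi> \<le> 2 * pi" and w_eq: "w = cis \<phi>"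
    using w Arg2pi[of w] complex_norm_eq_1_exp[of w] by (auto simp: \<phi>_def cis_conv_exp less_imp_le)
  have "(\<lambda>z. f (w * z)) \<in> borel_measurable circle_measure"
    unfolding w_eq by measurable
  then have "(\<integral>\<^sup>+z. f (w * z) \<partial>circle_measure) = (\<integral>\<^sup>+t. f (cis (\<phi> + t)) * indicator {0..<2 * pi} t \<partial>lborel) / ennreal (2 * pi)"
    by (subst nn_integral_circle) (simp_all add: w_eq cis_mult)
  also have "(\<integral>\<^sup>+t. f (cis (\<phi> + t)) * indicator {0..<2 * pi} t \<partial>lborel) = (\<integral>\<^sup>+t. f (cis t) * indicator {0..<2 * pi} t \<partial>lborel)"
    by (rule nn_integral_periodic_shift) (use \<phi> in \<open>auto simp flip: cis_mult intro: borel_measurable_circle_cis\<close>)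
  finally show ?thesis by (simp add: nn_integral_circle)
qed

lemma distr_circle_rotate:
  assumes w: "cmod w = 1"
  shows "distr circle_measure circle_measure (\<lambda>z. w * z) = circle_measure"
proof (rule measure_eqI)
  have m [measurable]: "(\<lambda>z. w * z) \<in> measurable circle_measure circle_measure"
    by (rule measurable_circleI) (use w in \<open>auto simp: norm_mult\<close>)
  fix A assume "A \<in> sets (distr circle_measure circle_measure (\<lambda>z. w * z))"
  then have A [measurable]: "A \<in> sets circle_measure" by simp
  have "emeasure (distr circle_measure circle_measure (\<lambda>z. w * z)) A = (\<integral>\<^sup>+z. indicator A z \<partial>distr circle_measure circle_measure (\<lambda>z. w * z))"
    by simp
  also have "\<dots> = (\<integral>\<^sup>+z. indicator A (w * z) \<partial>circle_measure)"
    by (rule nn_integral_distr) auto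
  also have "\<dots> = (\<integral>\<^sup>+z. indicator A z \<partial>circle_measure)"
    by (rule nn_integral_circle_rotate) (use w in auto)
  finally show "emeasure (distr circle_measure circle_measure (\<lambda>z. w * z)) A = emeasure circle_measure A" by simp
qed simp

lemma integral_circle_rotate:
  fixes f :: "complex \<Rightarrow> complex"
  assumes f: "f \<in> borel_measurable circle_measure" and w: "cmod w = 1"
  shows "(LINT z|circle_measure. f (w * z)) = (LINT z|circle_measure. f z)"
proof -
  have m: "(\<lambda>z. w * z) \<in> measurable circle_measure circle_measure"
    by (rule measurable_circleI) (use w in \<open>auto simp: norm_mult\<close>)
  show ?thesis
    using integral_distr[OF m f] by (simp add: distr_circle_rotate[OF w])
qed

lemma borel_measurable_power_int [measurable (raw)]:
  "f \<in> borel_measurable M \<Longrightarrow> (\<lambda>x. (f x :: complex) powi n) \<in> borel_measurable M"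
  by (cases "0 \<le> n") (auto simp: power_int_def)

lemma circle_orthogonal:
  "(LINT z|circle_measure. z powi n) = (if n = 0 then 1 else 0)"
proof (cases "n = 0")
  case True
  then show ?thesis using circle.prob_space by simp
next
  case False
  \<comment> \<open>Rotation by this angle multiplies \<open>z powi n\<close> by -1, so the integral
    equals its own negative.\<close>
  let ?w = "cis (pi / of_int n)"
  have "(LINT z|circle_measure. (?w * z) powi n) = (LINT z|circle_measure. z powi n)"
    by (rule integral_circle_rotate) auto
  then have "- (LINT z|circle_measure. z powi n) = (LINT z|circle_measure. z powi n)"
    using False by (simp add: power_int_mult_distrib cis_power_int)
  then show ?thesis using False by simp
qed


section \<open>Haar measure on the group and on its square\<close>

lemma nn_integral_shift:
  fixes f :: "real \<Rightarrow> ennreal"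
  shows "f \<in> borel_measurable borel \<Longrightarrow> (\<integral>\<^sup>+x. f (a + x) \<partial>lborel) = (\<integral>\<^sup>+x. f x \<partial>lborel)"
  using nn_integral_real_affine[of f 1 a] by simp

lemma sigma_finite_haar_Hr: "sigma_finite_measure haar_Hr"
  unfolding haar_Hr_def
  by (intro sigma_finite_pair_measure lborel.sigma_finite_measure_axioms circle.sigma_finite_measure_axioms)

interpretation haar: sigma_finite_measure haar_Hr
  by (rule sigma_finite_haar_Hr)

abbreviation haar2 where "haar2 \<equiv> haar_Hr \<Otimes>\<^sub>M haar_Hr"

interpretation haar2: sigma_finite_measure haar2
  by (intro sigma_finite_pair_measure haar.sigma_finite_measure_axioms)

lemma space_haar2: "space haar2 = carrier (Hr \<times>\<times> Hr)"
  by (simp add: space_pair_measure space_haar_Hr)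

lemma measurable_haar_HrI [measurable (raw)]:
  "f \<in> borel_measurable M \<Longrightarrow> g \<in> measurable M circle_measure \<Longrightarrow> h \<in> borel_measurable M \<Longrightarrow>
   (\<lambda>x. (f x, g x, h x)) \<in> measurable M haar_Hr"
  unfolding haar_Hr_def by (intro measurable_Pair) simp_all

lemma measurable_haar_Hr_components [measurable]:
  "fst \<in> borel_measurable haar_Hr"
  "(\<lambda>g. fst (snd g)) \<in> measurable haar_Hr circle_measure"
  "(\<lambda>g. snd (snd g)) \<in> borel_measurable haar_Hr"
  unfolding haar_Hr_def by measurable

text \<open>The circle comes innermost because a left translation rotates it by an angle depending
  on \<open>y\<close>; rotation invariance is then available at fixed \<open>y\<close>.\<close>

lemma nn_integral_haar_Hr:
  assumes [measurable]: "f \<in> borel_measurable haar_Hr"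
  shows "(\<integral>\<^sup>+g. f g \<partial>haar_Hr) = (\<integral>\<^sup>+y. \<integral>\<^sup>+x. \<integral>\<^sup>+z. f (y, z, x) \<partial>circle_measure \<partial>lborel \<partial>lborel)"
proof -
  have [measurable]: "f \<in> borel_measurable (lborel \<Otimes>\<^sub>M circle_measure \<Otimes>\<^sub>M lborel)"
    using assms by (simp add: haar_Hr_def)
  interpret cl: pair_sigma_finite circle_measure lborel
    by (simp add: pair_sigma_finite_def circle.sigma_finite_measure_axioms lborel.sigma_finite_measure_axioms)
  have sf: "sigma_finite_measure (circle_measure \<Otimes>\<^sub>M (lborel :: real measure))"
    by (intro sigma_finite_pair_measure lborel.sigma_finite_measure_axioms circle.sigma_finite_measure_axioms)
  have "(\<integral>\<^sup>+g. f g \<partial>haar_Hr) = (\<integral>\<^sup>+y. \<integral>\<^sup>+p. f (y, p) \<partial>(circle_measure \<Otimes>\<^sub>M lborel) \<partial>lborel)"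
    unfolding haar_Hr_def by (rule sigma_finite_measure.nn_integral_fst[OF sf, symmetric]) simp
  also have "\<dots> = (\<integral>\<^sup>+y. \<integral>\<^sup>+x. \<integral>\<^sup>+z. f (y, z, x) \<partial>circle_measure \<partial>lborel \<partial>lborel)"
    by (intro nn_integral_cong, subst cl.nn_integral_snd[symmetric]) auto
  finally show ?thesis .
qed

definition transl :: "real \<times> complex \<times> real \<Rightarrow> real \<times> complex \<times> real \<Rightarrow> real \<times> complex \<times> real" where
  "transl = (\<lambda>(y, z, x) (y', z', x'). (y + y', z * z' * cis (x * y'), x + x'))"

lemma mult_Hr: "g \<otimes>\<^bsub>Hr\<^esub> h = transl g h"
  by (simp add: Hr_def transl_def)

lemma carrier_Hr: "g \<in> carrier Hr \<longleftrightarrow> cmod (fst (snd g)) = 1"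
  by (cases g) (auto simp: Hr_def)

lemma measurable_transl [measurable (raw)]:
  assumes [measurable]: "f \<in> measurable M haar_Hr" "h \<in> measurable M haar_Hr"
  shows "(\<lambda>x. transl (f x) (h x)) \<in> measurable M haar_Hr"
  unfolding transl_def case_prod_beta by measurable

text \<open>The inverse in the group record is a definite description, which hides measurability;
  this formula agrees with it on the carrier.\<close>

definition inver :: "real \<times> complex \<times> real \<Rightarrow> real \<times> complex \<times> real" where
  "inver = (\<lambda>(y, z, x). (- y, cnj z * cis (x * y), - x))"

lemma inver_Hr: "g \<in> carrier Hr \<Longrightarrow> inv\<^bsub>Hr\<^esub> g = inver g"
  by (cases g) (auto simp: inver_def inv_Hr carrier_Hr)

lemma measurable_inver [measurable (raw)]:
  assumes [measurable]: "f \<in> measurable M haar_Hr"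
  shows "(\<lambda>x. inver (f x)) \<in> measurable M haar_Hr"
  unfolding inver_def case_prod_beta by measurable

lemma inver_carrier: "g \<in> carrier Hr \<Longrightarrow> inver g \<in> carrier Hr"
  by (cases g) (auto simp: inver_def carrier_Hr norm_mult)

lemma nn_integral_haar_Hr_transl:
  assumes f [measurable]: "f \<in> borel_measurable haar_Hr" and g: "g \<in> carrier Hr"
  shows "(\<integral>\<^sup>+s. f (transl g s) \<partial>haar_Hr) = (\<integral>\<^sup>+s. f s \<partial>haar_Hr)"
proof -
  obtain b w a where g_eq: "g = (b, w, a)" and w: "cmod w = 1" using g by (cases g) (auto simp: carrier_Hr)
  have gm [measurable]: "(\<lambda>_. g) \<in> measurable M haar_Hr" for M
    using g by (intro measurable_const) (simp add: space_haar_Hr)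
  have "(\<integral>\<^sup>+s. f (transl g s) \<partial>haar_Hr)
      = (\<integral>\<^sup>+y. \<integral>\<^sup>+x. \<integral>\<^sup>+z. f (transl g (y, z, x)) \<partial>circle_measure \<partial>lborel \<partial>lborel)"
    by (rule nn_integral_haar_Hr) simp
  also have "\<dots> = (\<integral>\<^sup>+y. \<integral>\<^sup>+x. \<integral>\<^sup>+z. f (b + y, (w * cis (a * y)) * z, a + x) \<partial>circle_measure \<partial>lborel \<partial>lborel)"
    by (simp add: g_eq transl_def mult_ac)
  also have "\<dots> = (\<integral>\<^sup>+y. \<integral>\<^sup>+x. \<integral>\<^sup>+z. f (b + y, z, a + x) \<partial>circle_measure \<partial>lborel \<partial>lborel)"
  proof (rule nn_integral_cong, rule nn_integral_cong)
    fix x y :: real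
    show "(\<integral>\<^sup>+z. f (b + y, (w * cis (a * y)) * z, a + x) \<partial>circle_measure) = (\<integral>\<^sup>+z. f (b + y, z, a + x) \<partial>circle_measure)"
      by (rule nn_integral_circle_rotate) (use w in \<open>auto simp: norm_mult\<close>)
  qed
  also have "\<dots> = (\<integral>\<^sup>+y. \<integral>\<^sup>+x. \<integral>\<^sup>+z. f (b + y, z, x) \<partial>circle_measure \<partial>lborel \<partial>lborel)"
    by (rule nn_integral_cong, rule nn_integral_shift[where f = "\<lambda>x. \<integral>\<^sup>+z. f (_, z, x) \<partial>circle_measure"]) measurable
  also have "\<dots> = (\<integral>\<^sup>+y. \<integral>\<^sup>+x. \<integral>\<^sup>+z. f (y, z, x) \<partial>circle_measure \<partial>lborel \<partial>lborel)"
    by (rule nn_integral_shift[where f = "\<lambda>y. \<integral>\<^sup>+x. \<integral>\<^sup>+z. f (y, z, x) \<partial>circle_measure \<partial>lborel"]) measurable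
  also have "\<dots> = (\<integral>\<^sup>+s. f s \<partial>haar_Hr)" by (rule nn_integral_haar_Hr[symmetric]) simp
  finally show ?thesis .
qed

definition transl2 where "transl2 = (\<lambda>(g, h) (s, t). (transl g s, transl h t))"

lemma measurable_transl2 [measurable (raw)]:
  assumes [measurable]: "f \<in> measurable M haar2" "h \<in> measurable M haar2"
  shows "(\<lambda>x. transl2 (f x) (h x)) \<in> measurable M haar2"
  unfolding transl2_def case_prod_beta by measurable

lemma nn_integral_haar2_transl2:
  assumes f [measurable]: "f \<in> borel_measurable haar2" and g: "g \<in> carrier (Hr \<times>\<times> Hr)"
  shows "(\<integral>\<^sup>+s. f (transl2 g s) \<partial>haar2) = (\<integral>\<^sup>+s. f s \<partial>haar2)"
proof -
  obtain a b where g_eq: "g = (a, b)" and a: "a \<in> carrier Hr" and b: "b \<in> carrier Hr" using g by auto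
  have gm [measurable]: "(\<lambda>_. g) \<in> measurable M haar2" "(\<lambda>_. a) \<in> measurable M haar_Hr" "(\<lambda>_. b) \<in> measurable M haar_Hr" for M :: "'c measure"
    using g a b by (auto intro!: measurable_const simp: space_haar_Hr space_pair_measure)
  have "(\<integral>\<^sup>+s. f (transl2 g s) \<partial>haar2) = (\<integral>\<^sup>+s. \<integral>\<^sup>+t. f (transl2 g (s, t)) \<partial>haar_Hr \<partial>haar_Hr)"
    by (rule haar.nn_integral_fst[symmetric]) simp
  also have "\<dots> = (\<integral>\<^sup>+s. \<integral>\<^sup>+t. f (transl a s, transl b t) \<partial>haar_Hr \<partial>haar_Hr)"
    by (simp add: transl2_def g_eq)
  also have "\<dots> = (\<integral>\<^sup>+s. \<integral>\<^sup>+t. f (transl a s, t) \<partial>haar_Hr \<partial>haar_Hr)"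
  proof (rule nn_integral_cong)
    fix s assume [measurable]: "s \<in> space haar_Hr"
    show "(\<integral>\<^sup>+t. f (transl a s, transl b t) \<partial>haar_Hr) = (\<integral>\<^sup>+t. f (transl a s, t) \<partial>haar_Hr)"
      by (rule nn_integral_haar_Hr_transl[OF _ b, of "\<lambda>t. f (transl a s, t)"]) measurable
  qed
  also have "\<dots> = (\<integral>\<^sup>+s. \<integral>\<^sup>+t. f (s, t) \<partial>haar_Hr \<partial>haar_Hr)"
    by (rule nn_integral_haar_Hr_transl[OF _ a, of "\<lambda>s. \<integral>\<^sup>+t. f (s, t) \<partial>haar_Hr"]) measurable
  also have "\<dots> = (\<integral>\<^sup>+s. f s \<partial>haar2)" by (rule haar.nn_integral_fst) simp
  finally show ?thesis .
qed

lemma distr_haar2_transl2: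
  assumes g: "g \<in> carrier (Hr \<times>\<times> Hr)"
  shows "distr haar2 haar2 (transl2 g) = haar2"
proof (rule measure_eqI)
  have [measurable]: "(\<lambda>_. g) \<in> measurable haar2 haar2"
    using g by (intro measurable_const) (simp add: space_haar2)
  have m [measurable]: "transl2 g \<in> measurable haar2 haar2" by measurable
  fix A assume "A \<in> sets (distr haar2 haar2 (transl2 g))"
  then have A [measurable]: "A \<in> sets haar2" by simp
  have "emeasure (distr haar2 haar2 (transl2 g)) A = (\<integral>\<^sup>+z. indicator A z \<partial>distr haar2 haar2 (transl2 g))"
    using A by simp
  also have "\<dots> = (\<integral>\<^sup>+z. indicator A (transl2 g z) \<partial>haar2)"
    by (rule nn_integral_distr) auto
  also have "\<dots> = (\<integral>\<^sup>+z. indicator A z \<partial>haar2)"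
    by (rule nn_integral_haar2_transl2) (use g in auto)
  finally show "emeasure (distr haar2 haar2 (transl2 g)) A = emeasure haar2 A" using A by simp
qed simp

lemma integral_haar2_transl2:
  fixes f :: "_ \<Rightarrow> complex"
  assumes f: "f \<in> borel_measurable haar2" and g: "g \<in> carrier (Hr \<times>\<times> Hr)"
  shows "(LINT s|haar2. f (transl2 g s)) = (LINT s|haar2. f s)"
proof -
  have [measurable]: "(\<lambda>_. g) \<in> measurable haar2 haar2"
    using g by (intro measurable_const) (simp add: space_haar2)
  have "transl2 g \<in> measurable haar2 haar2" by measurable
  from integral_distr[OF this f] show ?thesis by (simp add: distr_haar2_transl2[OF g])
qed

definition inver2 where "inver2 = (\<lambda>(g, h). (inver g, inver h))"

lemma measurable_inver2 [measurable (raw)]: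
  assumes [measurable]: "f \<in> measurable M haar2"
  shows "(\<lambda>x. inver2 (f x)) \<in> measurable M haar2"
  unfolding inver2_def case_prod_beta by measurable

lemma inver2_carrier: "g \<in> carrier (Hr \<times>\<times> Hr) \<Longrightarrow> inver2 g \<in> carrier (Hr \<times>\<times> Hr)"
  by (cases g) (auto simp: inver2_def inver_carrier)

lemma left_regular_eq:
  assumes "g \<in> carrier (Hr \<times>\<times> Hr)"
  shows "left_regular (Hr \<times>\<times> Hr) g \<xi> = (\<lambda>s. \<xi> (transl2 (inver2 g) s))"
proof -
  obtain a b where g: "g = (a, b)" "a \<in> carrier Hr" "b \<in> carrier Hr" using assms by auto
  show ?thesis
    unfolding left_regular_def fun_eq_iff g
    by (simp add: inv_DirProd[OF group_Hr group_Hr g(2,3)] transl2_def inver2_def inver_Hr g mult_Hr mult_DirProd' case_prod_beta)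
qed

lemma left_regular_L2:
  assumes g: "g \<in> carrier (Hr \<times>\<times> Hr)" and \<xi>: "\<xi> \<in> L2 haar2"
  shows "left_regular (Hr \<times>\<times> Hr) g \<xi> \<in> L2 haar2"
    and "L2_norm haar2 (left_regular (Hr \<times>\<times> Hr) g \<xi>) = L2_norm haar2 \<xi>"
proof -
  note [measurable] = L2_measurable[OF \<xi>]
  have [measurable]: "(\<lambda>_. inver2 g) \<in> measurable haar2 haar2"
    using inver2_carrier[OF g] by (intro measurable_const) (simp add: space_haar2)
  have eq: "(\<integral>\<^sup>+s. ennreal ((cmod (\<xi> (transl2 (inver2 g) s)))\<^sup>2) \<partial>haar2) = (\<integral>\<^sup>+s. ennreal ((cmod (\<xi> s))\<^sup>2) \<partial>haar2)"
    by (rule nn_integral_haar2_transl2[OF _ inver2_carrier[OF g], of "\<lambda>s. ennreal ((cmod (\<xi> s))\<^sup>2)"]) simp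
  show L: "left_regular (Hr \<times>\<times> Hr) g \<xi> \<in> L2 haar2"
    unfolding left_regular_eq[OF g] by (subst L2_iff_nn) (use \<xi> eq in \<open>auto simp: L2_iff_nn\<close>)
  show "L2_norm haar2 (left_regular (Hr \<times>\<times> Hr) g \<xi>) = L2_norm haar2 \<xi>"
    using eq unfolding left_regular_eq[OF g] L2_norm_nn[OF \<xi>] L2_norm_nn[OF L[unfolded left_regular_eq[OF g]]]
    by simp
qed

section \<open>Coefficient functions on the product group\<close>

abbreviation Hr2 where "Hr2 \<equiv> Hr \<times>\<times> Hr"
abbreviation plane :: "(real \<times> real) measure" where "plane \<equiv> lborel \<Otimes>\<^sub>M lborel"
abbreviation torus :: "(complex \<times> complex) measure" where "torus \<equiv> circle_measure \<Otimes>\<^sub>M circle_measure"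

lemma sigma_finite_plane: "sigma_finite_measure plane"
  by (intro sigma_finite_pair_measure lborel.sigma_finite_measure_axioms)

lemma sigma_finite_circle: "sigma_finite_measure circle_measure"
  by (rule circle.sigma_finite_measure_axioms)

interpretation torus: pair_prob_space circle_measure circle_measure ..

lemma sigma_finite_torus: "sigma_finite_measure torus"
  by (intro sigma_finite_pair_measure sigma_finite_circle)

lemma sigma_finite_plane2: "sigma_finite_measure (plane \<Otimes>\<^sub>M plane)"
  by (intro sigma_finite_pair_measure sigma_finite_plane)

lemma represents_eq:
  assumes "represents Hr2 haar2 \<xi> \<eta> u" "g \<in> carrier Hr2"
  shows "u g = (LINT s|haar2. \<xi> (transl2 (inver2 g) s) * cnj (\<eta> s))"
proof -
  have "u g = L2_inner haar2 (left_regular Hr2 g \<xi>) \<eta>"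
    using assms unfolding represents_def by blast
  then show ?thesis by (simp only: left_regular_eq[OF assms(2)] L2_inner_def)
qed

lemma represents_measurable:
  assumes rep: "represents Hr2 haar2 \<xi> \<eta> u"
  shows "u \<in> borel_measurable haar2"
proof -
  have [measurable]: "\<xi> \<in> borel_measurable haar2" "\<eta> \<in> borel_measurable haar2"
    using rep by (auto simp: represents_def L2_measurable)
  have "(\<lambda>g. LINT s|haar2. \<xi> (transl2 (inver2 g) s) * cnj (\<eta> s)) \<in> borel_measurable haar2"
    by measurable
  then show ?thesis
    using represents_eq[OF rep] by (subst measurable_cong) (auto simp: space_haar2)
qed

lemma represents_bounded:
  assumes rep: "represents Hr2 haar2 \<xi> \<eta> u" and g: "g \<in> carrier Hr2"
  shows "cmod (u g) \<le> L2_norm haar2 \<xi> * L2_norm haar2 \<eta>"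
proof -
  have u: "u g = L2_inner haar2 (left_regular Hr2 g \<xi>) \<eta>" and \<xi>: "\<xi> \<in> L2 haar2" and \<eta>: "\<eta> \<in> L2 haar2"
    using rep g unfolding represents_def by blast+
  show ?thesis
    using L2_Cauchy_Schwarz[OF left_regular_L2(1)[OF g \<xi>] \<eta>] by (simp add: u left_regular_L2(2)[OF g \<xi>])
qed

section \<open>Coordinates that separate the plane from the circles\<close>

definition chart1 :: "(real \<times> real) \<times> complex \<Rightarrow> real \<times> complex \<times> real" where
  "chart1 p = (fst (fst p), snd p, snd (fst p))"

definition chart :: "((real \<times> real) \<times> (real \<times> real)) \<times> (complex \<times> complex) \<Rightarrow> (real \<times> complex \<times> real) \<times> (real \<times> complex \<times> real)" where
  "chart p = (chart1 (fst (fst p), fst (snd p)), chart1 (snd (fst p), snd (snd p)))"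

lemma mpres_chart1: "mpres (plane \<Otimes>\<^sub>M circle_measure) haar_Hr chart1"
proof (rule mpresI)
  show [measurable]: "chart1 \<in> measurable (plane \<Otimes>\<^sub>M circle_measure) haar_Hr"
    unfolding chart1_def by measurable
  fix f :: "_ \<Rightarrow> ennreal" assume [measurable]: "f \<in> borel_measurable haar_Hr"
  have "(\<integral>\<^sup>+p. f (chart1 p) \<partial>(plane \<Otimes>\<^sub>M circle_measure)) = (\<integral>\<^sup>+q. \<integral>\<^sup>+z. f (chart1 (q, z)) \<partial>circle_measure \<partial>plane)"
    by (rule circle.nn_integral_fst[symmetric]) measurable
  also have "\<dots> = (\<integral>\<^sup>+y. \<integral>\<^sup>+x. \<integral>\<^sup>+z. f (chart1 ((y, x), z)) \<partial>circle_measure \<partial>lborel \<partial>lborel)"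
    by (subst lborel.nn_integral_fst[symmetric]) auto
  also have "\<dots> = (\<integral>\<^sup>+g. f g \<partial>haar_Hr)"
    by (subst nn_integral_haar_Hr) (auto simp: chart1_def)
  finally show "(\<integral>\<^sup>+p. f (chart1 p) \<partial>(plane \<Otimes>\<^sub>M circle_measure)) = (\<integral>\<^sup>+g. f g \<partial>haar_Hr)" .
qed

lemma mpres_chart: "mpres ((plane \<Otimes>\<^sub>M plane) \<Otimes>\<^sub>M torus) haar2 chart"
  using mpres_comp[OF mpres_interchange[OF sigma_finite_plane sigma_finite_plane sigma_finite_circle sigma_finite_circle]
      mpres_prod[OF mpres_chart1 mpres_chart1 sigma_finite_haar_Hr sigma_finite_haar_Hr]]
  by (simp add: chart_def[abs_def])

lemma measurable_chart [measurable (raw)]: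
  assumes "f \<in> measurable M ((plane \<Otimes>\<^sub>M plane) \<Otimes>\<^sub>M torus)"
  shows "(\<lambda>x. chart (f x)) \<in> measurable M haar2"
  using measurable_compose[OF assms mpres_measurable[OF mpres_chart]] .

lemma measurable_chart1 [measurable (raw)]:
  assumes "f \<in> measurable M (plane \<Otimes>\<^sub>M circle_measure)"
  shows "(\<lambda>x. chart1 (f x)) \<in> measurable M haar_Hr"
  using measurable_compose[OF assms mpres_measurable[OF mpres_chart1]] .

lemma L2_chart:
  assumes \<xi>: "\<xi> \<in> L2 haar2"
  shows "(\<lambda>r. \<xi> (chart r)) \<in> L2 ((plane \<Otimes>\<^sub>M plane) \<Otimes>\<^sub>M torus)"
    and "L2_norm ((plane \<Otimes>\<^sub>M plane) \<Otimes>\<^sub>M torus) (\<lambda>r. \<xi> (chart r)) = L2_norm haar2 \<xi>"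
proof -
  note [measurable] = L2_measurable[OF \<xi>]
  have eq: "(\<integral>\<^sup>+r. ennreal ((cmod (\<xi> (chart r)))\<^sup>2) \<partial>((plane \<Otimes>\<^sub>M plane) \<Otimes>\<^sub>M torus)) = (\<integral>\<^sup>+s. ennreal ((cmod (\<xi> s))\<^sup>2) \<partial>haar2)"
    by (rule mpres_nn_integral[OF mpres_chart, of "\<lambda>s. ennreal ((cmod (\<xi> s))\<^sup>2)"]) simp
  show L: "(\<lambda>r. \<xi> (chart r)) \<in> L2 ((plane \<Otimes>\<^sub>M plane) \<Otimes>\<^sub>M torus)"
    using \<xi> eq by (simp add: L2_iff_nn)
  show "L2_norm ((plane \<Otimes>\<^sub>M plane) \<Otimes>\<^sub>M torus) (\<lambda>r. \<xi> (chart r)) = L2_norm haar2 \<xi>"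
    using eq unfolding L2_norm_nn[OF \<xi>] L2_norm_nn[OF L] by simp
qed

section \<open>Fourier components along the circles\<close>

text \<open>Removing the component along one vector lowers the squared norm by the square of its
  coefficient and leaves the other coefficients unchanged; this is why the induction varies
  \<phi>.\<close>

lemma Bessel:
  fixes e :: "'i \<Rightarrow> 'a \<Rightarrow> complex"
  assumes "finite S" and e: "\<And>n. e n \<in> L2 M"
    and on: "\<And>n m. L2_inner M (e n) (e m) = (if n = m then 1 else 0)"
    and \<phi>: "\<phi> \<in> L2 M"
  shows "(\<Sum>n\<in>S. (cmod (L2_inner M \<phi> (e n)))\<^sup>2) \<le> (L2_norm M \<phi>)\<^sup>2"
  using \<open>finite S\<close> \<phi>
proof (induction S arbitrary: \<phi> rule: finite_induct)
  case empty
  then show ?case by simp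
next
  case (insert n S)
  define c where "c = L2_inner M \<phi> (e n)"
  define \<phi>' where "\<phi>' x = \<phi> x + (- c) * e n x" for x
  have \<phi>': "\<phi>' \<in> L2 M" unfolding \<phi>'_def by (intro L2_add L2_scale insert.prems e)
  have "L2_norm M (e n) = 1"
    using L2_inner_self[of M "e n"] by (simp add: on power2_eq_1_iff flip: of_real_power) (use L2_norm_nonneg[of M "e n"] in linarith)
  then have norm: "(L2_norm M \<phi>')\<^sup>2 = (L2_norm M \<phi>)\<^sup>2 - (cmod c)\<^sup>2"
  proof -
    have "(L2_norm M \<phi>')\<^sup>2 = (L2_norm M \<phi>)\<^sup>2 + 2 * Re (cnj (- c) * c) + (cmod c)\<^sup>2"
      unfolding \<phi>'_def L2_norm_add_square[OF insert.prems L2_scale[OF e]] L2_inner_scale_right L2_norm_scale c_def[symmetric] \<open>L2_norm M (e n) = 1\<close>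
      by simp
    moreover have "Re (cnj (- c) * c) = - (cmod c)\<^sup>2"
      by (simp only: cmod_power2) (simp add: power2_eq_square)
    ultimately show ?thesis by simp
  qed
  have "L2_inner M \<phi>' (e m) = L2_inner M \<phi> (e m)" if "m \<in> S" for m
    unfolding \<phi>'_def L2_inner_add_left[OF insert.prems L2_scale[OF e] e] L2_inner_scale_left on
    using that insert.hyps by auto
  then have "(\<Sum>m\<in>S. (cmod (L2_inner M \<phi> (e m)))\<^sup>2) \<le> (L2_norm M \<phi>')\<^sup>2"
    using insert.IH[OF \<phi>'] by simp
  then show ?case
    using insert.hyps by (simp add: norm c_def)
qed

definition character :: "int \<Rightarrow> complex \<times> complex \<Rightarrow> complex" where
  "character n z = (fst z * snd z) powi n"

lemma measurable_character [measurable]: "character n \<in> borel_measurable torus"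
  unfolding character_def by measurable

lemma powi_norm_1: "cmod z = 1 \<Longrightarrow> cmod (z powi n) = 1"
  by (simp add: norm_power_int)

lemma cnj_powi:
  assumes "cmod z = 1"
  shows "cnj (z powi n) = z powi (- n)"
proof -
  have z: "z = cis (Arg2pi z)"
    using assms by (simp add: complex_norm_eq_1_exp cis_conv_exp)
  show ?thesis by (subst z, subst (2) z) (simp only: cis_power_int cis_cnj of_int_minus mult_minus_left)
qed

lemma space_torus: "z \<in> space torus \<longleftrightarrow> cmod (fst z) = 1 \<and> cmod (snd z) = 1"
  by (cases z) (auto simp: space_pair_measure)

lemma character_L2: "character n \<in> L2 torus"
proof (rule L2I)
  have "integrable torus (\<lambda>z. 1 :: real)" by simp
  then show "integrable torus (\<lambda>z. (cmod (character n z))\<^sup>2)"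
    by (rule Bochner_Integration.integrable_cong[THEN iffD1, rotated 2])
      (auto simp: character_def space_torus norm_mult powi_norm_1)
qed measurable

lemma character_orthonormal: "L2_inner torus (character n) (character m) = (if n = m then 1 else 0)"
proof -
  have "L2_inner torus (character n) (character m) = (LINT z|torus. fst z powi (n - m) * snd z powi (n - m))"
    unfolding L2_inner_def
  proof (rule Bochner_Integration.integral_cong)
    fix z assume "z \<in> space torus"
    then have 1: "cmod (fst z * snd z) = 1" and nz: "fst z \<noteq> 0" "snd z \<noteq> 0" by (auto simp: space_torus norm_mult)
    show "character n z * cnj (character m z) = fst z powi (n - m) * snd z powi (n - m)"
      unfolding character_def cnj_powi[OF 1]
      using nz by (simp add: power_int_mult_distrib power_int_diff power_int_minus divide_simps)
  qed simp
  also have "\<dots> = (LINT z|circle_measure. z powi (n - m)) * (LINT z|circle_measure. z powi (n - m))"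
    by (rule integrable_pair_mult(2))
      (auto intro!: sigma_finite_circle circle.integrable_const_bound[where B = 1] simp: powi_norm_1)
  finally show ?thesis by (simp add: circle_orthogonal)
qed

definition circle_comp :: "int \<Rightarrow> ((real \<times> complex \<times> real) \<times> (real \<times> complex \<times> real) \<Rightarrow> complex) \<Rightarrow> (real \<times> real) \<times> (real \<times> real) \<Rightarrow> complex" where
  "circle_comp n \<xi> Y = L2_inner torus (\<lambda>z. \<xi> (chart (Y, z))) (character n)"

lemma measurable_circle_comp [measurable]:
  assumes [measurable]: "\<xi> \<in> borel_measurable haar2"
  shows "circle_comp n \<xi> \<in> borel_measurable (plane \<Otimes>\<^sub>M plane)"
  unfolding circle_comp_def L2_inner_def by measurable

lemma circle_comp_Bessel:
  assumes \<xi>: "\<xi> \<in> L2 haar2" and "finite S"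
  shows "(\<Sum>n\<in>S. \<integral>\<^sup>+Y. ennreal ((cmod (circle_comp n \<xi> Y))\<^sup>2) \<partial>(plane \<Otimes>\<^sub>M plane)) \<le> ennreal ((L2_norm haar2 \<xi>)\<^sup>2)"
proof -
  note [measurable] = L2_measurable[OF \<xi>]
  have "(\<Sum>n\<in>S. \<integral>\<^sup>+Y. ennreal ((cmod (circle_comp n \<xi> Y))\<^sup>2) \<partial>(plane \<Otimes>\<^sub>M plane)) = (\<integral>\<^sup>+Y. (\<Sum>n\<in>S. ennreal ((cmod (circle_comp n \<xi> Y))\<^sup>2)) \<partial>(plane \<Otimes>\<^sub>M plane))"
    by (rule nn_integral_sum[symmetric]) simp
  also have "\<dots> \<le> (\<integral>\<^sup>+Y. ennreal ((L2_norm torus (\<lambda>z. \<xi> (chart (Y, z))))\<^sup>2) \<partial>(plane \<Otimes>\<^sub>M plane))"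
  proof (rule nn_integral_mono_AE, use L2_slices(1)[OF sigma_finite_torus L2_chart(1)[OF \<xi>]] in eventually_elim)
    fix Y assume "(\<lambda>z. \<xi> (chart (Y, z))) \<in> L2 torus"
    from Bessel[OF \<open>finite S\<close> character_L2 character_orthonormal this]
    show "(\<Sum>n\<in>S. ennreal ((cmod (circle_comp n \<xi> Y))\<^sup>2)) \<le> ennreal ((L2_norm torus (\<lambda>z. \<xi> (chart (Y, z))))\<^sup>2)"
      by (simp add: circle_comp_def sum_ennreal)
  qed
  also have "\<dots> = ennreal ((L2_norm haar2 \<xi>)\<^sup>2)"
    using L2_slices(3)[OF sigma_finite_torus L2_chart(1)[OF \<xi>]] L2_chart(2)[OF \<xi>] by simp
  finally show ?thesis .
qed

lemma circle_comp_L2: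
  assumes \<xi>: "\<xi> \<in> L2 haar2"
  shows "circle_comp n \<xi> \<in> L2 (plane \<Otimes>\<^sub>M plane)"
proof -
  note [measurable] = L2_measurable[OF \<xi>]
  show ?thesis
    using circle_comp_Bessel[OF \<xi>, of "{n}"] by (subst L2_iff_nn) (auto intro: le_less_trans)
qed

lemma circle_comp_norm_Bessel:
  assumes \<xi>: "\<xi> \<in> L2 haar2" and "finite S"
  shows "(\<Sum>n\<in>S. (L2_norm (plane \<Otimes>\<^sub>M plane) (circle_comp n \<xi>))\<^sup>2) \<le> (L2_norm haar2 \<xi>)\<^sup>2"
  using circle_comp_Bessel[OF assms] by (simp add: L2_norm_nn[OF circle_comp_L2[OF \<xi>]] sum_ennreal)


section \<open>The coefficient function on twisted arguments\<close>

lemma mpres_circle_rotate: "cmod w = 1 \<Longrightarrow> mpres circle_measure circle_measure (\<lambda>z. w * z)"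
  unfolding mpres_def
  by (auto intro!: measurable_circleI simp: norm_mult distr_circle_rotate)

text \<open>This is the way \<open>q\<close> enters the circle coordinates in
  \<open>twist_arg_action\<close>. The map is a rotation depending on the first coordinate, followed
  by a swap and a fixed rotation.\<close>

lemma mpres_torus_twist:
  assumes \<alpha>: "cmod \<alpha> = 1" and \<beta>: "cmod \<beta> = 1"
  shows "mpres torus torus (\<lambda>q. (cnj (fst q) * snd q * \<alpha>, fst q * \<beta>))"
proof -
  have [measurable]: "(\<lambda>_. \<alpha>) \<in> measurable M circle_measure" "(\<lambda>_. \<beta>) \<in> measurable M circle_measure" for M :: "'b measure"
    using \<alpha> \<beta> by (auto intro!: measurable_circleI)
  have "mpres torus torus (\<lambda>q. (fst q, (\<alpha> * cnj (fst q)) * snd q))"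
    by (rule mpres_shear[where \<phi> = "\<lambda>z w. (\<alpha> * cnj z) * w"])
      (auto intro!: sigma_finite_circle mpres_circle_rotate simp: norm_mult \<alpha>)
  from mpres_comp[OF this mpres_swap[OF sigma_finite_circle sigma_finite_circle]]
  have "mpres torus torus (\<lambda>q. ((\<alpha> * cnj (fst q)) * snd q, fst q))" by simp
  from mpres_comp[OF this mpres_prod[OF mpres_id mpres_circle_rotate[OF \<beta>] sigma_finite_circle sigma_finite_circle]]
  show ?thesis by (simp add: mult_ac)
qed

text \<open>The pair \<open>(g exp(-tZ), inv g)\<close>, where \<open>g\<close> has plane
  coordinates \<open>X\<close> and circle coordinate \<open>fst q\<close>, and \<open>snd q\<close>
  is \<open>cis t\<close>.\<close>

definition twist_arg :: "real \<times> real \<Rightarrow> complex \<times> complex \<Rightarrow> (real \<times> complex \<times> real) \<times> (real \<times> complex \<times> real)" where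
  "twist_arg X q = (transl (chart1 (X, fst q)) (0, cnj (snd q), 0), inver (chart1 (X, fst q)))"

lemma twist_arg_carrier: "q \<in> space torus \<Longrightarrow> twist_arg X q \<in> carrier Hr2"
  unfolding space_torus
  by (auto simp: twist_arg_def chart1_def transl_def inver_def carrier_Hr norm_mult)

text \<open>The translation subtracts \<open>X\<close> from the first plane point and adds it to the
  second, so their sum is invariant. The phases come from the twist in the group law.\<close>

lemma twist_arg_action:
  assumes "cmod (fst q) = 1" "cmod (snd q) = 1"
  shows "transl2 (inver2 (twist_arg X q)) (chart (Y, z)) =
     chart ((fst Y - X, snd Y + X),
       (cnj (fst q) * snd q * (fst z * cis (snd X * (fst X - fst (fst Y)))), fst q * (snd z * cis (snd X * fst (snd Y)))))"
proof -
  have "cnj (cnj w) * cnj z = cnj z * w" for w z :: complex by (simp add: mult.commute)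
  have cc: "cis a * cis b * c = cis (a + b) * c" for a b c by (simp add: cis_mult)
  show ?thesis
    by (cases X; cases Y; cases "fst Y"; cases "snd Y"; cases q; cases z)
      (simp add: twist_arg_def chart_def chart1_def transl_def inver_def transl2_def inver2_def cis_mult algebra_simps cis_cnj)
qed

text \<open>\<open>fst q\<close> enters one circle coordinate conjugated and the other directly, so
  it cancels in their product. A power of \<open>snd q\<close> is thereby expressed through the
  values of one character before and after the translation.\<close>

lemma character_twist:
  assumes "cmod (fst q) = 1" "cmod (snd q) = 1" "cmod (fst z) = 1" "cmod (snd z) = 1"
  shows "snd q powi (- n) =
     character n z * cis (of_int n * (a + b)) *
     cnj (character n (cnj (fst q) * snd q * (fst z * cis a), fst q * (snd z * cis b)))"
proof -
  let ?w' = "cnj (fst q) * snd q * (fst z * cis a)" and ?\<zeta> = "fst q * (snd z * cis b)"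
  have 1: "cmod (?w' * ?\<zeta>) = 1" using assms by (simp add: norm_mult)
  have q: "fst q * cnj (fst q) = 1" using assms(1) complex_norm_square[of "fst q"] by simp
  have "?w' * ?\<zeta> = (fst q * cnj (fst q)) * (snd q * (fst z * snd z) * cis (a + b))"
    by (simp add: mult_ac flip: cis_mult)
  also have "\<dots> = snd q * (fst z * snd z) * cis (a + b)" by (simp add: q)
  finally have e: "?w' * ?\<zeta> = snd q * (fst z * snd z) * cis (a + b)" .
  have nz: "fst z \<noteq> 0" "snd z \<noteq> 0" using assms by auto
  have "cnj (character n (?w', ?\<zeta>)) = (?w' * ?\<zeta>) powi (- n)"
    using cnj_powi[OF 1] by (simp add: character_def)
  also have "\<dots> = snd q powi (- n) * (fst z * snd z) powi (- n) * cis (- of_int n * (a + b))"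
    unfolding e by (simp only: power_int_mult_distrib cis_power_int of_int_minus)
  finally have c: "cnj (character n (?w', ?\<zeta>)) = snd q powi (- n) * (fst z * snd z) powi (- n) * cis (- of_int n * (a + b))" .
  have "cis (of_int n * (a + b)) * cis (- of_int n * (a + b)) = 1" by (simp add: cis_mult)
  moreover have "character n z * (fst z * snd z) powi (- n) = 1"
    using nz by (simp add: character_def power_int_minus)
  ultimately show ?thesis unfolding c
    by (metis (no_types, lifting) mult.assoc mult.commute mult.left_neutral)
qed

text \<open>The factor \<open>cis (of_int n * (a + b))\<close> of \<open>character_twist\<close> for
  the two angles in \<open>twist_arg_action\<close>.\<close>

definition phase :: "int \<Rightarrow> real \<times> real \<Rightarrow> (real \<times> real) \<times> (real \<times> real) \<Rightarrow> complex" where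
  "phase n X Y = cis (of_int n * (snd X * (fst X - fst (fst Y)) + snd X * fst (snd Y)))"

lemma plane_eq: "plane = lborel"
  by (rule lborel_prod)

lemma measurable_plane_diff [measurable (raw)]:
  assumes "f \<in> measurable M plane" "g \<in> measurable M plane"
  shows "(\<lambda>x. f x - g x) \<in> measurable M plane"
  using assms unfolding plane_eq by simp

lemma measurable_plane_add [measurable (raw)]:
  assumes "f \<in> measurable M plane" "g \<in> measurable M plane"
  shows "(\<lambda>x. f x + g x) \<in> measurable M plane"
  using assms unfolding plane_eq by simp

lemma measurable_phase [measurable (raw)]:
  assumes f: "f \<in> measurable M plane" and g: "g \<in> measurable M (plane \<Otimes>\<^sub>M plane)"
  shows "(\<lambda>x. phase n (f x) (g x)) \<in> borel_measurable M"
proof -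
  have [measurable]: "(\<lambda>x. fst (f x)) \<in> borel_measurable M" "(\<lambda>x. snd (f x)) \<in> borel_measurable M"
    "(\<lambda>x. fst (fst (g x))) \<in> borel_measurable M" "(\<lambda>x. fst (snd (g x))) \<in> borel_measurable M"
    using measurable_compose[OF f measurable_fst] measurable_compose[OF f measurable_snd]
      measurable_compose[OF measurable_compose[OF g measurable_fst] measurable_fst]
      measurable_compose[OF measurable_compose[OF g measurable_snd] measurable_fst]
    by simp_all
  show ?thesis unfolding phase_def by measurable
qed

lemma mpres_plane_shift: "mpres (plane \<Otimes>\<^sub>M plane) (plane \<Otimes>\<^sub>M plane) (\<lambda>Y. (fst Y - X, snd Y + X))"
proof (rule mpres_prod[OF _ _ sigma_finite_plane sigma_finite_plane])
  show "mpres plane plane (\<lambda>x. x - X)"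
    using mpres_lborel_plus[of "- X"] by (simp add: plane_eq)
  show "mpres plane plane (\<lambda>x. x + X)"
    using mpres_lborel_plus[of X] by (simp add: plane_eq add.commute)
qed

text \<open>For fixed \<open>X\<close>, Cauchy-Schwarz in \<open>Y\<close> and translation
  invariance give a bound independent of \<open>X\<close> apart from the factor \<open>V X\<close>,
  which is integrable.\<close>

lemma integrable_circle_comp_kernel:
  assumes F: "F \<in> L2 (plane \<Otimes>\<^sub>M plane)" and H: "H \<in> L2 (plane \<Otimes>\<^sub>M plane)" and V: "integrable plane V"
  shows "integrable (plane \<Otimes>\<^sub>M (plane \<Otimes>\<^sub>M plane))
    (\<lambda>r. V (fst r) * (phase n (fst r) (snd r) * F (fst (snd r) - fst r, snd (snd r) + fst r) * cnj (H (snd r))))"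
proof -
  interpret R: sigma_finite_measure "plane \<Otimes>\<^sub>M plane" by (rule sigma_finite_plane2)
  note [measurable] = L2_measurable[OF F] L2_measurable[OF H] borel_measurable_integrable[OF V]
  let ?f = "\<lambda>r. V (fst r) * (phase n (fst r) (snd r) * F (fst (snd r) - fst r, snd (snd r) + fst r) * cnj (H (snd r)))"
  let ?N = "L2_norm (plane \<Otimes>\<^sub>M plane)"
  have "(\<integral>\<^sup>+r. ennreal (norm (?f r)) \<partial>(plane \<Otimes>\<^sub>M (plane \<Otimes>\<^sub>M plane)))
      = (\<integral>\<^sup>+X. \<integral>\<^sup>+Y. ennreal (norm (?f (X, Y))) \<partial>(plane \<Otimes>\<^sub>M plane) \<partial>plane)"
    by (rule R.nn_integral_fst[symmetric]) measurable
  also have "\<dots> \<le> (\<integral>\<^sup>+X. ennreal (cmod (V X)) * ennreal (?N F * ?N H) \<partial>plane)"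
  proof (rule nn_integral_mono)
    fix X :: "real \<times> real"
    assume [measurable]: "X \<in> space plane"
    have a: "(\<integral>\<^sup>+Y. ennreal ((cmod (F (fst Y - X, snd Y + X)))\<^sup>2) \<partial>(plane \<Otimes>\<^sub>M plane)) \<le> ennreal ((?N F)\<^sup>2)"
      using mpres_nn_integral[OF mpres_plane_shift, of "\<lambda>Y. ennreal ((cmod (F Y))\<^sup>2)" X] by (simp add: L2_norm_nn[OF F])
    have b: "(\<integral>\<^sup>+Y. ennreal ((cmod (H Y))\<^sup>2) \<partial>(plane \<Otimes>\<^sub>M plane)) \<le> ennreal ((?N H)\<^sup>2)"
      by (simp add: L2_norm_nn[OF H])
    have m: "(\<lambda>Y. F (fst Y - X, snd Y + X)) \<in> borel_measurable (plane \<Otimes>\<^sub>M plane)"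
      using measurable_compose[OF mpres_measurable[OF mpres_plane_shift] L2_measurable[OF F]] .
    note [measurable] = m
    have "(\<integral>\<^sup>+Y. ennreal (norm (?f (X, Y))) \<partial>(plane \<Otimes>\<^sub>M plane))
        = (\<integral>\<^sup>+Y. ennreal (cmod (V X)) * ennreal (cmod (F (fst Y - X, snd Y + X)) * cmod (H Y)) \<partial>(plane \<Otimes>\<^sub>M plane))"
      by (intro nn_integral_cong) (simp add: norm_mult phase_def flip: ennreal_mult)
    also have "\<dots> = ennreal (cmod (V X)) * (\<integral>\<^sup>+Y. ennreal (cmod (F (fst Y - X, snd Y + X)) * cmod (H Y)) \<partial>(plane \<Otimes>\<^sub>M plane))"
      by (rule nn_integral_cmult) measurable
    also have "\<dots> \<le> ennreal (cmod (V X)) * ennreal (?N F * ?N H)"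
      by (intro mult_left_mono nn_integral_Cauchy_Schwarz a b m) auto
    finally show "(\<integral>\<^sup>+Y. ennreal (norm (?f (X, Y))) \<partial>(plane \<Otimes>\<^sub>M plane)) \<le> ennreal (cmod (V X)) * ennreal (?N F * ?N H)" .
  qed
  also have "\<dots> = (\<integral>\<^sup>+X. ennreal (cmod (V X)) \<partial>plane) * ennreal (?N F * ?N H)"
    by (rule nn_integral_multc) measurable
  also have "\<dots> < \<infinity>"
    using V by (simp add: integrable_iff_bounded ennreal_mult_less_top)
  finally show ?thesis
    by (intro integrableI_bounded) measurable
qed

text \<open>By \<open>character_twist\<close> and invariance, the integral over \<open>q\<close> at
  fixed \<open>z\<close> becomes a component of \<xi>; what remains of the integral over
  \<open>z\<close> is the conjugate of a component of \<eta>.\<close>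

lemma coefficient_twist:
  assumes rep: "represents Hr2 haar2 \<xi> \<eta> u"
  shows "(LINT q|torus. snd q powi (- n) * u (twist_arg X q))
     = (LINT Y|(plane \<Otimes>\<^sub>M plane). phase n X Y * circle_comp n \<xi> (fst Y - X, snd Y + X) * cnj (circle_comp n \<eta> Y))"
proof -
  let ?R = "(plane \<Otimes>\<^sub>M plane) \<Otimes>\<^sub>M torus"
  have \<xi>: "\<xi> \<in> L2 haar2" and \<eta>: "\<eta> \<in> L2 haar2" using rep by (auto simp: represents_def)
  note [measurable] = L2_measurable[OF \<xi>] L2_measurable[OF \<eta>]
  define K where "K q r = snd q powi (- n) * (\<xi> (transl2 (inver2 (twist_arg X q)) (chart r)) * cnj (\<eta> (chart r)))" for q r
  have sfR: "sigma_finite_measure ?R"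
    by (intro sigma_finite_pair_measure sigma_finite_plane2 sigma_finite_torus)
  interpret R: sigma_finite_measure ?R by (rule sfR)
  interpret QR: pair_sigma_finite torus ?R
    using sfR sigma_finite_torus by (simp add: pair_sigma_finite_def)
  have [measurable]: "(\<lambda>_. X) \<in> measurable M plane" for M :: "'b measure"
    by (auto simp: space_pair_measure)
  have [measurable]: "(\<lambda>x. twist_arg X (f x)) \<in> measurable M haar2" if [measurable]: "f \<in> measurable M torus" for f and M :: "'b measure"
    unfolding twist_arg_def by measurable
  have mK [measurable]: "(\<lambda>p. K (fst p) (snd p)) \<in> borel_measurable (torus \<Otimes>\<^sub>M ?R)"
    unfolding K_def by measurable
  have u: "u (twist_arg X q) = (LINT r|?R. \<xi> (transl2 (inver2 (twist_arg X q)) (chart r)) * cnj (\<eta> (chart r)))"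
    if q: "q \<in> space torus" for q
  proof -
    have [measurable]: "(\<lambda>_. inver2 (twist_arg X q)) \<in> measurable haar2 haar2"
      using inver2_carrier[OF twist_arg_carrier[OF q]] by (intro measurable_const) (simp add: space_haar2)
    show ?thesis
      unfolding represents_eq[OF rep twist_arg_carrier[OF q]]
      by (rule mpres_integral[OF mpres_chart, symmetric, of "\<lambda>s. \<xi> (transl2 (inver2 (twist_arg X q)) s) * cnj (\<eta> s)"]) measurable
  qed
  \<comment> \<open>Uniform in \<open>q\<close>, because translation preserves the norm; as the
    torus has finite mass, this justifies Fubini.\<close>
  have bound: "(\<integral>\<^sup>+r. ennreal (cmod (K q r)) \<partial>?R) \<le> ennreal (L2_norm haar2 \<xi> * L2_norm haar2 \<eta>)"
    if q: "q \<in> space torus" for q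
  proof -
    let ?g = "twist_arg X q"
    have g: "?g \<in> carrier Hr2" by (rule twist_arg_carrier[OF q])
    have L: "left_regular Hr2 ?g \<xi> \<in> L2 haar2" by (rule left_regular_L2[OF g \<xi>])
    have "(\<integral>\<^sup>+r. ennreal (cmod (K q r)) \<partial>?R) = (\<integral>\<^sup>+r. ennreal (cmod (left_regular Hr2 ?g \<xi> (chart r)) * cmod (\<eta> (chart r))) \<partial>?R)"
      using q by (simp add: K_def norm_mult powi_norm_1 space_torus left_regular_eq[OF g])
    also have "\<dots> \<le> ennreal (L2_norm haar2 \<xi> * L2_norm haar2 \<eta>)"
      using L2_chart[OF L] L2_chart[OF \<eta>] left_regular_L2(2)[OF g \<xi>]
      by (intro nn_integral_Cauchy_Schwarz L2_measurable) (auto simp: L2_norm_nn)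
    finally show ?thesis .
  qed
  have int: "integrable (torus \<Otimes>\<^sub>M ?R) (\<lambda>(q, r). K q r)"
  proof (rule integrableI_bounded)
    have "(\<integral>\<^sup>+p. ennreal (norm (case p of (q, r) \<Rightarrow> K q r)) \<partial>(torus \<Otimes>\<^sub>M ?R)) = (\<integral>\<^sup>+q. \<integral>\<^sup>+r. ennreal (cmod (K q r)) \<partial>?R \<partial>torus)"
      by (subst R.nn_integral_fst[symmetric]) (use mK in \<open>auto simp: case_prod_beta'\<close>)
    also have "\<dots> \<le> (\<integral>\<^sup>+q. ennreal (L2_norm haar2 \<xi> * L2_norm haar2 \<eta>) \<partial>torus)"
      by (rule nn_integral_mono) (rule bound)
    also have "\<dots> < \<infinity>" by (simp add: torus.P.emeasure_space_1 ennreal_mult_less_top)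
    finally show "(\<integral>\<^sup>+p. ennreal (norm (case p of (q, r) \<Rightarrow> K q r)) \<partial>(torus \<Otimes>\<^sub>M ?R)) < \<infinity>" .
  qed (use mK in \<open>simp add: case_prod_beta'\<close>)
  have inner: "(LINT q|torus. K q (Y, z)) = character n z * phase n X Y * circle_comp n \<xi> (fst Y - X, snd Y + X) * cnj (\<eta> (chart (Y, z)))"
    if z: "z \<in> space torus" for Y z
  proof -
    let ?a = "snd X * (fst X - fst (fst Y))" and ?b = "snd X * fst (snd Y)"
    let ?T = "\<lambda>q. (cnj (fst q) * snd q * (fst z * cis ?a), fst q * (snd z * cis ?b))"
    let ?Y = "(fst Y - X, snd Y + X)"
    have slice: "(\<lambda>q. \<xi> (chart (Y0, q))) \<in> borel_measurable torus" for Y0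
      using measurable_compose[OF measurable_Pair1' L2_measurable[OF L2_chart(1)[OF \<xi>]], of Y0]
      by (simp add: space_pair_measure)
    have "(LINT q|torus. K q (Y, z)) = (LINT q|torus. (character n z * phase n X Y * cnj (\<eta> (chart (Y, z)))) * (\<xi> (chart (?Y, ?T q)) * cnj (character n (?T q))))"
    proof (rule Bochner_Integration.integral_cong)
      fix q assume "q \<in> space torus"
      then have q: "cmod (fst q) = 1" "cmod (snd q) = 1" by (auto simp: space_torus)
      show "K q (Y, z) = (character n z * phase n X Y * cnj (\<eta> (chart (Y, z)))) * (\<xi> (chart (?Y, ?T q)) * cnj (character n (?T q)))"
        unfolding K_def twist_arg_action[OF q] phase_def
        by (subst character_twist[OF q, of z n ?a ?b]) (use z in \<open>auto simp: space_torus\<close>)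
    qed simp
    also have "\<dots> = (character n z * phase n X Y * cnj (\<eta> (chart (Y, z)))) * (LINT q|torus. \<xi> (chart (?Y, ?T q)) * cnj (character n (?T q)))"
      by (rule integral_mult_right_zero)
    also have "(LINT q|torus. \<xi> (chart (?Y, ?T q)) * cnj (character n (?T q))) = (LINT q|torus. \<xi> (chart (?Y, q)) * cnj (character n q))"
    proof (rule mpres_integral[where f = "\<lambda>q. \<xi> (chart (?Y, q)) * cnj (character n q)"])
      show "mpres torus torus ?T"
        by (rule mpres_torus_twist) (use z in \<open>simp_all add: space_torus norm_mult\<close>)
      show "(\<lambda>q. \<xi> (chart (?Y, q)) * cnj (character n q)) \<in> borel_measurable torus"
        by (intro borel_measurable_times borel_measurable_cnj slice measurable_character)
    qed
    also have "\<dots> = circle_comp n \<xi> ?Y" by (simp add: circle_comp_def L2_inner_def)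
    finally show ?thesis by (simp only: mult_ac)
  qed
  have "(LINT q|torus. snd q powi (- n) * u (twist_arg X q)) = (LINT q|torus. LINT r|?R. K q r)"
    by (rule Bochner_Integration.integral_cong) (simp_all add: u K_def)
  also have "\<dots> = (LINT r|?R. LINT q|torus. K q r)"
    by (rule QR.Fubini_integral[OF int, symmetric])
  also have "\<dots> = (LINT Y|(plane \<Otimes>\<^sub>M plane). LINT z|torus. LINT q|torus. K q (Y, z))"
  proof -
    interpret PT: pair_sigma_finite "plane \<Otimes>\<^sub>M plane" torus
      using sigma_finite_plane2 sigma_finite_torus by (simp add: pair_sigma_finite_def)
    show ?thesis by (rule PT.integral_fst'[symmetric]) (rule QR.integrable_snd[OF int])
  qed
  also have "\<dots> = (LINT Y|(plane \<Otimes>\<^sub>M plane). phase n X Y * circle_comp n \<xi> (fst Y - X, snd Y + X) * cnj (circle_comp n \<eta> Y))"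
  proof (rule Bochner_Integration.integral_cong)
    fix Y
    have "(LINT z|torus. LINT q|torus. K q (Y, z)) = (LINT z|torus. (phase n X Y * circle_comp n \<xi> (fst Y - X, snd Y + X)) * (character n z * cnj (\<eta> (chart (Y, z)))))"
      by (rule Bochner_Integration.integral_cong) (simp_all only: inner mult_ac)
    also have "\<dots> = (phase n X Y * circle_comp n \<xi> (fst Y - X, snd Y + X)) * (LINT z|torus. character n z * cnj (\<eta> (chart (Y, z))))"
      by (rule integral_mult_right_zero)
    also have "(LINT z|torus. character n z * cnj (\<eta> (chart (Y, z)))) = cnj (circle_comp n \<eta> Y)"
      unfolding circle_comp_def L2_inner_cnj by (simp add: L2_inner_def)
    finally show "(LINT z|torus. LINT q|torus. K q (Y, z)) = phase n X Y * circle_comp n \<xi> (fst Y - X, snd Y + X) * cnj (circle_comp n \<eta> Y)" .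
  qed simp
  finally show ?thesis .
qed

text \<open>
  The integral against \<open>v\<close> of the \<open>n\<close>-th Fourier coefficient of \<open>t \<mapsto> u (g exp(-tZ), g\<inverse>)\<close>. The sign
  makes rotations of the circle the only changes of variables needed, and is undone by the minus sign
  in front of the partial sums below.
\<close>
definition beta :: "(real \<times> complex \<times> real \<Rightarrow> complex) \<Rightarrow> int \<Rightarrow> ((real \<times> complex \<times> real) \<times> (real \<times> complex \<times> real) \<Rightarrow> complex) \<Rightarrow> complex" where
  "beta v n u = (LINT g|haar_Hr. v g * (LINT w|circle_measure. w powi (- n) * u (transl g (0, cnj w, 0), inver g)))"

text \<open>The weight does not depend on the circle coordinate of \<open>g\<close>, so the integral
  over this coordinate joins the one over \<open>w\<close> to an integral over the torus.
  Integrability comes from the boundedness of coefficient functions.\<close>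

lemma beta_eq_plane:
  assumes v: "integrable plane V" and rep: "represents Hr2 haar2 \<xi> \<eta> u"
  shows "beta (\<lambda>(y, z, x). V (y, x)) n u = (LINT X|plane. V X * (LINT q|torus. snd q powi (- n) * u (twist_arg X q)))"
proof -
  note [measurable] = borel_measurable_integrable[OF v] represents_measurable[OF rep]
  define k where "k p w = w powi (- n) * u (transl (chart1 p) (0, cnj w, 0), inver (chart1 p))" for p w
  define B where "B = L2_norm haar2 \<xi> * L2_norm haar2 \<eta>"
  have B0: "0 \<le> B" by (simp add: B_def)
  have k_twist: "k (X, fst q) (snd q) = snd q powi (- n) * u (twist_arg X q)" for X q
    by (simp add: k_def twist_arg_def)
  have mk [measurable]: "(\<lambda>r. k (fst r) (snd r)) \<in> borel_measurable ((plane \<Otimes>\<^sub>M circle_measure) \<Otimes>\<^sub>M circle_measure)"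
    unfolding k_def by measurable
  have kB: "cmod (k p w) \<le> B" if "cmod (snd p) = 1" "cmod w = 1" for p w
  proof -
    have "twist_arg (fst p) (snd p, w) \<in> carrier Hr2"
      by (rule twist_arg_carrier) (use that in \<open>simp add: space_torus\<close>)
    from represents_bounded[OF rep this] show ?thesis
      using k_twist[of "fst p" "(snd p, w)"] that by (simp add: norm_mult powi_norm_1 B_def)
  qed
  have ik: "integrable circle_measure (k p)" if "cmod (snd p) = 1" for p
  proof (rule circle.integrable_const_bound[where B = B])
    show "AE w in circle_measure. cmod (k p w) \<le> B" using kB[OF that] by (intro AE_I2) simp
    have "p \<in> space (plane \<Otimes>\<^sub>M circle_measure)" using that by (cases p) (simp add: space_pair_measure)
    from measurable_compose[OF measurable_Pair1'[OF this] mk] show "k p \<in> borel_measurable circle_measure" by simp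
  qed
  have "beta (\<lambda>(y, z, x). V (y, x)) n u = (LINT p|(plane \<Otimes>\<^sub>M circle_measure). V (fst p) * (LINT w|circle_measure. k p w))"
  proof -
    have "(\<lambda>g. (case g of (y, z, x) \<Rightarrow> V (y, x)) * (LINT w|circle_measure. w powi (- n) * u (transl g (0, cnj w, 0), inver g))) \<in> borel_measurable haar_Hr"
    proof (rule borel_measurable_times)
      have "(\<lambda>g. (fst g, snd (snd g))) \<in> measurable haar_Hr plane"
        by (intro measurable_Pair) simp_all
      from measurable_compose[OF this borel_measurable_integrable[OF v]]
      show "(\<lambda>g. case g of (y, z, x) \<Rightarrow> V (y, x)) \<in> borel_measurable haar_Hr"
        by (simp add: case_prod_beta')
      show "(\<lambda>g. LINT w|circle_measure. w powi (- n) * u (transl g (0, cnj w, 0), inver g)) \<in> borel_measurable haar_Hr"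
        by measurable
    qed
    from mpres_integral[OF mpres_chart1 this] show ?thesis
      by (simp add: beta_def k_def chart1_def)
  qed
  also have "\<dots> = (LINT X|plane. LINT z|circle_measure. V X * (LINT w|circle_measure. k (X, z) w))"
  proof -
    interpret PC: pair_sigma_finite plane circle_measure
      using sigma_finite_plane sigma_finite_circle by (simp add: pair_sigma_finite_def)
    have "integrable (plane \<Otimes>\<^sub>M circle_measure) (\<lambda>p. V (fst p) * (LINT w|circle_measure. k p w))"
    proof (rule Bochner_Integration.integrable_bound)
      show "integrable (plane \<Otimes>\<^sub>M circle_measure) (\<lambda>p. V (fst p) * of_real B)"
        by (rule integrable_pair_mult(1)[where g = "\<lambda>_. of_real B"]) (auto intro: sigma_finite_plane sigma_finite_circle v)
      show "(\<lambda>p. V (fst p) * (LINT w|circle_measure. k p w)) \<in> borel_measurable (plane \<Otimes>\<^sub>M circle_measure)"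
        using circle.borel_measurable_lebesgue_integral[of "\<lambda>p w. k p w" "plane \<Otimes>\<^sub>M circle_measure"] mk
        by (simp add: case_prod_beta')
      show "AE p in plane \<Otimes>\<^sub>M circle_measure. cmod (V (fst p) * (LINT w|circle_measure. k p w)) \<le> cmod (V (fst p) * of_real B)"
      proof (intro AE_I2)
        fix p assume "p \<in> space (plane \<Otimes>\<^sub>M circle_measure)"
        then have p: "cmod (snd p) = 1" by (cases p) (simp add: space_pair_measure)
        have "cmod (LINT w|circle_measure. k p w) \<le> (LINT w|circle_measure. cmod (k p w))" by (rule integral_norm_bound)
        also have "\<dots> \<le> (LINT w|circle_measure. B)"
          by (intro integral_mono integrable_norm ik p) (use kB[OF p] in auto)
        finally have "cmod (LINT w|circle_measure. k p w) \<le> B" using circle.prob_space by simp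
        then show "cmod (V (fst p) * (LINT w|circle_measure. k p w)) \<le> cmod (V (fst p) * of_real B)"
          using B0 by (simp add: norm_mult mult_left_mono)
      qed
    qed
    from PC.integral_fst'[OF this] show ?thesis by simp
  qed
  also have "\<dots> = (LINT X|plane. V X * (LINT q|torus. snd q powi (- n) * u (twist_arg X q)))"
  proof (rule Bochner_Integration.integral_cong)
    fix X
    have m: "(\<lambda>q. k (X, fst q) (snd q)) \<in> borel_measurable torus"
    proof -
      have "(\<lambda>q. ((X, fst q), snd q)) \<in> measurable torus ((plane \<Otimes>\<^sub>M circle_measure) \<Otimes>\<^sub>M circle_measure)"
        by (intro measurable_Pair measurable_const measurable_fst measurable_snd) (simp add: space_pair_measure)
      from measurable_compose[OF this mk] show ?thesis by simp
    qed
    have "integrable torus (\<lambda>q. k (X, fst q) (snd q))"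
      by (rule torus.P.integrable_const_bound[where B = B, OF AE_I2 m]) (simp add: kB space_torus)
    from torus.integral_fst'[OF this]
    show "(LINT z|circle_measure. V X * (LINT w|circle_measure. k (X, z) w)) = V X * (LINT q|torus. snd q powi (- n) * u (twist_arg X q))"
      by (simp add: k_twist)
  qed simp
  finally show ?thesis .
qed

section \<open>The bound for the functionals \<open>beta\<close>\<close>

text \<open>With \<open>p = (P, ((x, b), (a, y)))\<close>, the inner pairs being the variables of
  \<open>plane_kernel\<close>, the new variables are \<open>X = (y - a, x)\<close> and the plane
  points \<open>(y, b)\<close> and \<open>P - (y, b)\<close>, whose sum is \<open>P\<close>.
  Translation by \<open>X\<close> takes these points to \<open>(a, b - x)\<close> and
  \<open>P - (a, b - x)\<close>.\<close>

lemma mpres_plane_coordinates: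
  "mpres (plane \<Otimes>\<^sub>M (plane \<Otimes>\<^sub>M plane)) (plane \<Otimes>\<^sub>M (plane \<Otimes>\<^sub>M plane))
    (\<lambda>p. ((snd (snd (snd p)) - fst (snd (snd p)), fst (fst (snd p))),
      ((snd (snd (snd p)), snd (fst (snd p))), fst p - (snd (snd (snd p)), snd (fst (snd p))))))"
proof -
  note sf = lborel.sigma_finite_measure_axioms sigma_finite_plane sigma_finite_plane2
  have sh: "mpres plane plane (\<lambda>p. (fst p, snd p - fst p))"
    by (rule mpres_shear[where \<phi> = "\<lambda>a y. y - a"])
      (use mpres_lborel_plus[of "- a" for a :: real] in \<open>auto intro: lborel.sigma_finite_measure_axioms\<close>)
  have sh': "mpres plane plane (\<lambda>p. (fst p, fst p - snd p))"
    by (rule mpres_shear[where \<phi> = "\<lambda>y a. y - a"])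
      (use mpres_lborel_minus in \<open>auto intro: lborel.sigma_finite_measure_axioms\<close>)
  have sw: "mpres plane plane (\<lambda>p. (snd p, fst p))"
    by (rule mpres_swap[OF sf(1) sf(1)])
  have s1: "mpres plane plane (\<lambda>p. (snd p - fst p, snd p))"
    using mpres_comp[OF mpres_comp[OF sw sh'] sw] by simp
  have s2: "mpres (plane \<Otimes>\<^sub>M plane) (plane \<Otimes>\<^sub>M plane) (\<lambda>r. (fst r, (snd (snd r) - fst (snd r), snd (snd r))))"
    using mpres_prod[OF mpres_id s1 sf(2) sf(2)] by simp
  have s3: "mpres (plane \<Otimes>\<^sub>M plane) (plane \<Otimes>\<^sub>M plane) (\<lambda>r. ((fst (fst r), snd (snd r) - fst (snd r)), (snd (fst r), snd (snd r))))"
    using mpres_comp[OF s2 mpres_interchange[OF sf(1) sf(1) sf(1) sf(1)]] by simp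
  have s4: "mpres (plane \<Otimes>\<^sub>M plane) (plane \<Otimes>\<^sub>M plane) (\<lambda>r. ((snd (snd r) - fst (snd r), fst (fst r)), (snd (snd r), snd (fst r))))"
    using mpres_comp[OF s3 mpres_prod[OF sw sw sf(2) sf(2)]] by simp
  have s5: "mpres (plane \<Otimes>\<^sub>M (plane \<Otimes>\<^sub>M plane)) ((plane \<Otimes>\<^sub>M plane) \<Otimes>\<^sub>M plane)
     (\<lambda>p. (((snd (snd (snd p)) - fst (snd (snd p)), fst (fst (snd p))), (snd (snd (snd p)), snd (fst (snd p)))), fst p))"
    using mpres_comp[OF mpres_prod[OF mpres_id[of plane] s4 sf(2) sf(3)] mpres_swap[OF sf(2) sf(3)]] by simp
  have s6: "mpres ((plane \<Otimes>\<^sub>M plane) \<Otimes>\<^sub>M plane) ((plane \<Otimes>\<^sub>M plane) \<Otimes>\<^sub>M plane) (\<lambda>p. (fst p, snd p - snd (fst p)))"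
  proof (rule mpres_shear[where \<phi> = "\<lambda>q P. P - snd q", OF sf(2) sf(2)])
    fix q :: "(real \<times> real) \<times> (real \<times> real)"
    show "mpres plane plane (\<lambda>P. P - snd q)"
      using mpres_lborel_plus[of "- snd q"] by (simp add: plane_eq)
  qed measurable
  show ?thesis
    using mpres_comp[OF mpres_comp[OF s5 s6] mpres_assoc[OF sf(2) sf(2)]] by simp
qed

text \<open>Passes to slices along which the sum of the two plane points is fixed;
  \<open>plane_bound\<close> is applied to almost every such slice.\<close>

lemma L2_plane_slices:
  assumes F: "F \<in> L2 (plane \<Otimes>\<^sub>M plane)"
  shows "(\<lambda>p. F (snd p, fst p - snd p)) \<in> L2 (plane \<Otimes>\<^sub>M plane)"
    and "L2_norm (plane \<Otimes>\<^sub>M plane) (\<lambda>p. F (snd p, fst p - snd p)) = L2_norm (plane \<Otimes>\<^sub>M plane) F"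
proof -
  note [measurable] = L2_measurable[OF F]
  have mp: "mpres (plane \<Otimes>\<^sub>M plane) (plane \<Otimes>\<^sub>M plane) (\<lambda>p. (snd p, fst p - snd p))"
  proof -
    have "mpres (plane \<Otimes>\<^sub>M plane) (plane \<Otimes>\<^sub>M plane) (\<lambda>p. (fst p, snd p - fst p))"
    proof (rule mpres_shear[where \<phi> = "\<lambda>A P. P - A", OF sigma_finite_plane sigma_finite_plane])
      fix A :: "real \<times> real"
      show "mpres plane plane (\<lambda>P. P - A)"
        using mpres_lborel_plus[of "- A"] by (simp add: plane_eq)
    qed measurable
    from mpres_comp[OF mpres_swap[OF sigma_finite_plane sigma_finite_plane] this] show ?thesis by simp
  qed
  have m: "(\<lambda>p. F (snd p, fst p - snd p)) \<in> borel_measurable (plane \<Otimes>\<^sub>M plane)"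
    using measurable_compose[OF mpres_measurable[OF mp] L2_measurable[OF F]] .
  have eq: "(\<integral>\<^sup>+p. ennreal ((cmod (F (snd p, fst p - snd p)))\<^sup>2) \<partial>(plane \<Otimes>\<^sub>M plane)) = (\<integral>\<^sup>+p. ennreal ((cmod (F p))\<^sup>2) \<partial>(plane \<Otimes>\<^sub>M plane))"
    by (rule mpres_nn_integral[OF mp, of "\<lambda>p. ennreal ((cmod (F p))\<^sup>2)"]) simp
  show L: "(\<lambda>p. F (snd p, fst p - snd p)) \<in> L2 (plane \<Otimes>\<^sub>M plane)"
    using F eq m by (simp add: L2_iff_nn)
  show "L2_norm (plane \<Otimes>\<^sub>M plane) (\<lambda>p. F (snd p, fst p - snd p)) = L2_norm (plane \<Otimes>\<^sub>M plane) F"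
    using eq unfolding L2_norm_nn[OF F] L2_norm_nn[OF L] by simp
qed

text \<open>In the coordinates of \<open>mpres_plane_coordinates\<close> the inner integral at a
  fixed sum \<open>P\<close> is that of a \<open>plane_kernel\<close>. The norms of the slices are
  then combined by Cauchy-Schwarz in \<open>P\<close>.\<close>

lemma circle_comp_kernel_bound:
  fixes n :: int
  assumes v1: "integrable lborel v1" "AE x in lborel. cmod (v1 x) \<le> C" "0 \<le> C"
    and v2: "integrable lborel v2" "integrable lborel (fourier v2)"
    and F: "F \<in> L2 (plane \<Otimes>\<^sub>M plane)" and H: "H \<in> L2 (plane \<Otimes>\<^sub>M plane)" and n: "n \<noteq> 0"
  defines "V \<equiv> \<lambda>X. v2 (fst X) * v1 (snd X)"
  shows "\<bar>real_of_int n\<bar> * cmod (LINT X|plane. V X * (LINT Y|(plane \<Otimes>\<^sub>M plane). phase n X Y * F (fst Y - X, snd Y + X) * cnj (H Y)))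
     \<le> C * (LINT s|lborel. cmod (fourier v2 s)) * L2_norm (plane \<Otimes>\<^sub>M plane) F * L2_norm (plane \<Otimes>\<^sub>M plane) H"
proof -
  let ?R = "plane \<Otimes>\<^sub>M plane"
  let ?c = "C * (LINT s|lborel. cmod (fourier v2 s))"
  have c0: "0 \<le> ?c" using v1(3) by simp
  have V: "integrable plane V"
    unfolding V_def by (rule integrable_pair_mult(1)) (auto intro: lborel.sigma_finite_measure_axioms v1 v2)
  have nn: "0 \<le> ?c * (L2_norm ?R F * L2_norm ?R H)"
    by (rule mult_nonneg_nonneg[OF c0]) simp
  define T where "T p = ((snd (snd (snd p)) - fst (snd (snd p)), fst (fst (snd p))),
      ((snd (snd (snd p)), snd (fst (snd p))), fst p - (snd (snd (snd p)), snd (fst (snd p)))))"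
    for p :: "(real \<times> real) \<times> ((real \<times> real) \<times> (real \<times> real))"
  have T: "mpres (plane \<Otimes>\<^sub>M ?R) (plane \<Otimes>\<^sub>M ?R) T"
    unfolding T_def[abs_def] by (rule mpres_plane_coordinates)
  define g where "g r = V (fst r) * (phase n (fst r) (snd r) * F (fst (snd r) - fst r, snd (snd r) + fst r) * cnj (H (snd r)))"
    for r
  have g: "integrable (plane \<Otimes>\<^sub>M ?R) g"
    unfolding g_def by (rule integrable_circle_comp_kernel[OF F H V])
  define f where "f P A = F (A, P - A)" for P A :: "real \<times> real"
  define h where "h P A = H (A, P - A)" for P A :: "real \<times> real"
  note slF = L2_slices[OF sigma_finite_plane L2_plane_slices(1)[OF F], unfolded fst_conv snd_conv L2_plane_slices(2)[OF F], folded f_def]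
  note slH = L2_slices[OF sigma_finite_plane L2_plane_slices(1)[OF H], unfolded fst_conv snd_conv L2_plane_slices(2)[OF H], folded h_def]
  have gT: "g (T (P, r)) = plane_kernel v1 v2 (of_int n) (fst P) (f P) (h P) r" for P r
  proof -
    obtain x b a y where r: "r = ((x, b), (a, y))" by (metis surj_pair)
    have 1: "P - (y, b) + (y - a, x) = P - (a, b - x)" by (cases P) simp
    have 2: "(y, b) - (y - a, x) = (a, b - x)" by simp
    have ph: "phase n (y - a, x) ((y, b), P - (y, b)) = cis (of_int n * x * (fst P - a - y))"
      by (cases P) (simp add: phase_def algebra_simps)
    show ?thesis
      unfolding g_def T_def plane_kernel_def r f_def h_def V_def
      by (simp only: fst_conv snd_conv case_prod_conv 1 2 ph mult_ac)
  qed
  interpret PR: pair_sigma_finite plane ?R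
    using sigma_finite_plane sigma_finite_plane2 by (simp add: pair_sigma_finite_def)
  have gT_int: "integrable (plane \<Otimes>\<^sub>M ?R) (\<lambda>p. g (T p))"
    using T g integrable_distr_eq[of T "plane \<Otimes>\<^sub>M ?R" "plane \<Otimes>\<^sub>M ?R" g] by (simp add: mpres_def)
  have "(LINT X|plane. V X * (LINT Y|?R. phase n X Y * F (fst Y - X, snd Y + X) * cnj (H Y))) = (LINT X|plane. LINT Y|?R. g (X, Y))"
    by (simp add: g_def)
  also have "\<dots> = (LINT p|(plane \<Otimes>\<^sub>M ?R). g p)" by (rule PR.integral_fst'[OF g])
  also have "\<dots> = (LINT p|(plane \<Otimes>\<^sub>M ?R). g (T p))"
    by (rule mpres_integral[OF T, symmetric]) (use g in simp)
  also have "\<dots> = (LINT P|plane. LINT r|?R. g (T (P, r)))" by (rule PR.integral_fst'[OF gT_int, symmetric])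
  finally have eq: "(LINT X|plane. V X * (LINT Y|?R. phase n X Y * F (fst Y - X, snd Y + X) * cnj (H Y))) = (LINT P|plane. LINT r|?R. g (T (P, r)))" .
  have "AE P in plane. integrable ?R (\<lambda>r. g (T (P, r)))"
    by (rule PR.AE_integrable_fst'[OF gT_int])
  with slF(1) slH(1) have ae: "AE P in plane. \<bar>real_of_int n\<bar> * cmod (LINT r|?R. g (T (P, r))) \<le> ?c * (L2_norm plane (f P) * L2_norm plane (h P))"
  proof eventually_elim
    case (elim P)
    then have "integrable ?R (plane_kernel v1 v2 (of_int n) (fst P) (f P) (h P))" by (simp add: gT)
    from plane_bound[OF v1 v2 elim(1,2) _ this] n show ?case by (simp add: gT mult.assoc)
  qed
  have "ennreal (\<bar>real_of_int n\<bar> * cmod (LINT P|plane. LINT r|?R. g (T (P, r)))) = ennreal \<bar>real_of_int n\<bar> * ennreal (cmod (LINT P|plane. LINT r|?R. g (T (P, r))))"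
    by (simp add: ennreal_mult)
  also have "\<dots> \<le> ennreal \<bar>real_of_int n\<bar> * (\<integral>\<^sup>+P. ennreal (cmod (LINT r|?R. g (T (P, r)))) \<partial>plane)"
    by (intro mult_left_mono integral_norm_bound_ennreal PR.integrable_fst'[OF gT_int]) simp
  also have "\<dots> = (\<integral>\<^sup>+P. ennreal (\<bar>real_of_int n\<bar> * cmod (LINT r|?R. g (T (P, r)))) \<partial>plane)"
    using PR.integrable_fst'[OF gT_int] by (subst nn_integral_cmult[symmetric]) (auto simp: ennreal_mult)
  also have "\<dots> \<le> (\<integral>\<^sup>+P. ennreal ?c * ennreal (L2_norm plane (f P) * L2_norm plane (h P)) \<partial>plane)"
    by (rule nn_integral_mono_AE, use ae in eventually_elim)
      (use c0 in \<open>auto simp flip: ennreal_mult intro!: ennreal_leI\<close>)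
  also have "\<dots> = ennreal ?c * (\<integral>\<^sup>+P. ennreal (L2_norm plane (f P) * L2_norm plane (h P)) \<partial>plane)"
    using slF(2) slH(2) by (intro nn_integral_cmult) simp
  also have "\<dots> \<le> ennreal ?c * ennreal (L2_norm ?R F * L2_norm ?R H)"
  proof (rule mult_left_mono)
    have "(\<integral>\<^sup>+P. ennreal (cmod (of_real (L2_norm plane (f P))) * cmod (of_real (L2_norm plane (h P)))) \<partial>plane) \<le> ennreal (L2_norm ?R F * L2_norm ?R H)"
      by (rule nn_integral_Cauchy_Schwarz) (use slF slH in auto)
    then show "(\<integral>\<^sup>+P. ennreal (L2_norm plane (f P) * L2_norm plane (h P)) \<partial>plane) \<le> ennreal (L2_norm ?R F * L2_norm ?R H)"
      by simp
  qed simp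
  also have "\<dots> = ennreal (?c * (L2_norm ?R F * L2_norm ?R H))"
    using c0 by (simp add: ennreal_mult)
  finally show ?thesis
    unfolding eq using nn by (simp only: ennreal_le_iff mult.assoc)
qed

theorem beta_bound:
  fixes n :: int
  assumes v1: "integrable lborel v1" "AE x in lborel. cmod (v1 x) \<le> C" "0 \<le> C"
    and v2: "integrable lborel v2" "integrable lborel (fourier v2)"
    and rep: "represents Hr2 haar2 \<xi> \<eta> u"
  shows "\<bar>real_of_int n\<bar> * cmod (beta (\<lambda>(y, z, x). v1 x * v2 y) n u)
     \<le> C * (LINT s|lborel. cmod (fourier v2 s)) * (L2_norm (plane \<Otimes>\<^sub>M plane) (circle_comp n \<xi>) * L2_norm (plane \<Otimes>\<^sub>M plane) (circle_comp n \<eta>))"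
proof (cases "n = 0")
  \<comment> \<open>Here the left-hand side is 0, whereas the substitution behind
    \<open>plane_bound\<close> requires a nonzero frequency.\<close>
  case True
  then show ?thesis using v1(3) by simp
next
  case False
  have \<xi>: "\<xi> \<in> L2 haar2" and \<eta>: "\<eta> \<in> L2 haar2" using rep by (auto simp: represents_def)
  have V: "integrable plane (\<lambda>X. v2 (fst X) * v1 (snd X))"
    by (rule integrable_pair_mult(1)) (auto intro: lborel.sigma_finite_measure_axioms v1 v2)
  have "beta (\<lambda>(y, z, x). v1 x * v2 y) n u = (LINT X|plane. (v2 (fst X) * v1 (snd X)) * (LINT q|torus. snd q powi (- n) * u (twist_arg X q)))"
    using beta_eq_plane[OF V rep, of n] by (simp add: mult.commute)
  then show ?thesis
    using circle_comp_kernel_bound[OF v1 v2 circle_comp_L2[OF \<xi>] circle_comp_L2[OF \<eta>] False, of n n]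
    by (simp only: coefficient_twist[OF rep] mult.assoc)
qed

text \<open>Cauchy-Schwarz over \<open>n\<close>, then Bessel's inequality for \<xi> and for \<eta>.
  The bound does not depend on \<open>S\<close>, which makes the truncations uniformly
  bounded.\<close>

theorem sum_beta_bound:
  assumes v1: "integrable lborel v1" "AE x in lborel. cmod (v1 x) \<le> C" "0 \<le> C"
    and v2: "integrable lborel v2" "integrable lborel (fourier v2)"
    and rep: "represents Hr2 haar2 \<xi> \<eta> u" and "finite S"
  shows "cmod (\<Sum>n\<in>S. \<i> * of_int n * beta (\<lambda>(y, z, x). v1 x * v2 y) n u)
     \<le> C * (LINT s|lborel. cmod (fourier v2 s)) * L2_norm haar2 \<xi> * L2_norm haar2 \<eta>"
proof -
  let ?c = "C * (LINT s|lborel. cmod (fourier v2 s))"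
  let ?a = "\<lambda>n. L2_norm (plane \<Otimes>\<^sub>M plane) (circle_comp n \<xi>)" and ?b = "\<lambda>n. L2_norm (plane \<Otimes>\<^sub>M plane) (circle_comp n \<eta>)"
  have \<xi>: "\<xi> \<in> L2 haar2" and \<eta>: "\<eta> \<in> L2 haar2" using rep by (auto simp: represents_def)
  have c0: "0 \<le> ?c" using v1(3) by simp
  have "cmod (\<Sum>n\<in>S. \<i> * of_int n * beta (\<lambda>(y, z, x). v1 x * v2 y) n u) \<le> (\<Sum>n\<in>S. ?c * (?a n * ?b n))"
    by (rule order_trans[OF norm_sum], rule sum_mono) (use beta_bound[OF v1 v2 rep] in \<open>simp add: norm_mult\<close>)
  also have "\<dots> = ?c * (\<Sum>n\<in>S. \<bar>?a n\<bar> * \<bar>?b n\<bar>)" by (simp add: sum_distrib_left)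
  also have "\<dots> \<le> ?c * (L2_set ?a S * L2_set ?b S)"
    by (intro mult_left_mono L2_set_mult_ineq c0)
  also have "\<dots> \<le> ?c * (L2_norm haar2 \<xi> * L2_norm haar2 \<eta>)"
  proof (intro mult_left_mono mult_mono c0)
    show "L2_set ?a S \<le> L2_norm haar2 \<xi>"
      unfolding L2_set_def by (rule real_le_lsqrt) (use circle_comp_norm_Bessel[OF \<xi> \<open>finite S\<close>] in \<open>auto intro: sum_nonneg\<close>)
    show "L2_set ?b S \<le> L2_norm haar2 \<eta>"
      unfolding L2_set_def by (rule real_le_lsqrt) (use circle_comp_norm_Bessel[OF \<eta> \<open>finite S\<close>] in \<open>auto intro: sum_nonneg\<close>)
  qed auto
  finally show ?thesis by (simp add: mult.assoc)
qed

section \<open>Test functions lifted to the covering space\<close>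

lemma Ck_Suc_imp: "Ck (Suc k) f \<Longrightarrow> Ck k f"
proof (induction k arbitrary: f)
  case 0
  then show ?case
    by (auto intro!: continuous_at_imp_continuous_on differentiable_imp_continuous_within)
next
  case (Suc k)
  then show ?case by auto
qed

lemma has_derivative_frechet:
  "f differentiable at x \<Longrightarrow> (f has_derivative frechet_derivative f (at x)) (at x)"
  by (simp add: frechet_derivative_works)

lemma Ck_add: "Ck k f \<Longrightarrow> Ck k g \<Longrightarrow> Ck k (\<lambda>x. f x + g x)"
proof (induction k arbitrary: f g)
  case 0
  then show ?case by (auto intro: continuous_intros)
next
  case (Suc k)
  then have d: "f differentiable at x" "g differentiable at x" for x by auto
  have "frechet_derivative (\<lambda>x. f x + g x) (at x) b = frechet_derivative f (at x) b + frechet_derivative g (at x) b" for x b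
    by (rule fun_cong[OF frechet_derivative_at[OF has_derivative_add[OF has_derivative_frechet has_derivative_frechet, OF d]], symmetric])
  then show ?case using Suc d by auto
qed

lemma Ck_scaleR: "Ck k f \<Longrightarrow> Ck k (\<lambda>x. r *\<^sub>R f x)"
proof (induction k arbitrary: f)
  case 0
  then show ?case by (auto intro: continuous_intros)
next
  case (Suc k)
  then have d: "f differentiable at x" for x by auto
  have "frechet_derivative (\<lambda>x. r *\<^sub>R f x) (at x) b = r *\<^sub>R frechet_derivative f (at x) b" for x b
    by (rule fun_cong[OF frechet_derivative_at[OF has_derivative_scaleR_right[OF has_derivative_frechet[OF d]]], symmetric])
  then show ?case using Suc d by auto
qed

text \<open>The left invariant field in the \<open>y\<close>-direction has the coordinate
  \<open>x\<close> as a coefficient, so multiplication by a coordinate has to preserve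
  smoothness.\<close>

lemma Ck_coordinate: "Ck k f \<Longrightarrow> Ck k (\<lambda>x. (x \<bullet> c) *\<^sub>R f x)"
proof (induction k arbitrary: f)
  case 0
  then show ?case by (auto intro!: continuous_intros)
next
  case (Suc k)
  then have d: "f differentiable at x" for x by auto
  have h: "((\<lambda>x. (x \<bullet> c) *\<^sub>R f x) has_derivative (\<lambda>b. (x \<bullet> c) *\<^sub>R frechet_derivative f (at x) b + (b \<bullet> c) *\<^sub>R f x)) (at x)" for x
    by (rule has_derivative_scaleR[OF bounded_linear_imp_has_derivative[OF bounded_linear_inner_left] has_derivative_frechet[OF d]])
  have e: "frechet_derivative (\<lambda>x. (x \<bullet> c) *\<^sub>R f x) (at x) b = (x \<bullet> c) *\<^sub>R frechet_derivative f (at x) b + (b \<bullet> c) *\<^sub>R f x" for x b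
    by (rule fun_cong[OF frechet_derivative_at[OF h], symmetric])
  have "(\<lambda>x. (x \<bullet> c) *\<^sub>R f x) differentiable at x" for x by (rule differentiableI[OF h])
  moreover have "Ck k (\<lambda>x. (x \<bullet> c) *\<^sub>R frechet_derivative f (at x) b + (b \<bullet> c) *\<^sub>R f x)" if "b \<in> Basis" for b
  proof (rule Ck_add)
    show "Ck k (\<lambda>x. (x \<bullet> c) *\<^sub>R frechet_derivative f (at x) b)"
      using Suc.prems that by (intro Suc.IH) simp
    show "Ck k (\<lambda>x. (b \<bullet> c) *\<^sub>R f x)"
      by (rule Ck_scaleR[OF Ck_Suc_imp[OF Suc.prems]])
  qed
  ultimately show ?case by (simp add: e)
qed

lemma smooth_add: "smooth f \<Longrightarrow> smooth g \<Longrightarrow> smooth (\<lambda>x. f x + g x)"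
  by (simp add: smooth_def Ck_add)

lemma smooth_scaleR: "smooth f \<Longrightarrow> smooth (\<lambda>x. r *\<^sub>R f x)"
  by (simp add: smooth_def Ck_scaleR)

lemma smooth_coordinate: "smooth f \<Longrightarrow> smooth (\<lambda>x. (x \<bullet> c) *\<^sub>R f x)"
  by (simp add: smooth_def Ck_coordinate)

lemma smooth_differentiable: "smooth f \<Longrightarrow> f differentiable at x"
  unfolding smooth_def by (metis Ck.simps(2))

lemma smooth_partial: "smooth f \<Longrightarrow> b \<in> Basis \<Longrightarrow> smooth (\<lambda>x. frechet_derivative f (at x) b)"
  unfolding smooth_def by (metis Ck.simps(2))

lemma smooth_continuous: "smooth f \<Longrightarrow> continuous_on UNIV f"
  unfolding smooth_def by (metis Ck.simps(1))

section \<open>Lifts of test functions\<close>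

type_synonym cover2 = "(real \<times> real \<times> real) \<times> (real \<times> real \<times> real)"

text \<open>The deck transformations of the covering map, in both factors.\<close>

definition deck :: "cover2 set" where
  "deck = {((0, s, 0), (0, t, 0)) | s t. cis s = 1 \<and> cis t = 1}"

text \<open>The angles stay free: a lift is periodic in them, so compact support on the group bounds
  just the other coordinates.\<close>

definition slab :: "real \<Rightarrow> cover2 set" where
  "slab R = {p. \<bar>fst (fst p)\<bar> \<le> R \<and> \<bar>snd (snd (fst p))\<bar> \<le> R \<and> \<bar>fst (snd p)\<bar> \<le> R \<and> \<bar>snd (snd (snd p))\<bar> \<le> R}"

definition test_lift :: "(cover2 \<Rightarrow> complex) \<Rightarrow> bool" where
  "test_lift U \<longleftrightarrow> smooth U \<and> (\<forall>p. \<forall>l\<in>deck. U (p + l) = U p) \<and> (\<exists>R. \<forall>p. p \<notin> slab R \<longrightarrow> U p = 0)"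

lemma test_liftI:
  "smooth U \<Longrightarrow> (\<And>p l. l \<in> deck \<Longrightarrow> U (p + l) = U p) \<Longrightarrow> (\<And>p. p \<notin> slab R \<Longrightarrow> U p = 0) \<Longrightarrow> test_lift U"
  unfolding test_lift_def by blast

lemma test_liftE:
  assumes "test_lift U"
  obtains R where "smooth U" "\<And>p l. l \<in> deck \<Longrightarrow> U (p + l) = U p" "\<And>p. p \<notin> slab R \<Longrightarrow> U p = 0"
  using assms unfolding test_lift_def by blast

lemma test_functions_lift:
  assumes "u \<in> test_functions_Hr2"
  shows "test_lift (\<lambda>(a, b). u (cover_Hr a, cover_Hr b))"
proof -
  let ?U = "\<lambda>(a, b). u (cover_Hr a, cover_Hr b)"
  from assms obtain K where sm: "smooth ?U" and K: "compact K"
    and u0: "\<And>p. p \<in> carrier (Hr \<times>\<times> Hr) - K \<Longrightarrow> u p = 0"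
    unfolding test_functions_Hr2_def by auto
  have "?U (p + l) = ?U p" if "l \<in> deck" for p l
  proof -
    have c: "cis (x + s) = cis x" if "cis s = 1" for x s using that by (simp flip: cis_mult)
    from that show ?thesis
      by (cases p) (auto simp: deck_def cover_Hr_def case_prod_beta c)
  qed
  moreover obtain R where R: "\<And>p. p \<in> K \<Longrightarrow> norm p \<le> R"
    using compact_imp_bounded[OF K] by (auto simp: bounded_iff)
  have "?U p = 0" if "p \<notin> slab R" for p
  proof -
    let ?q = "(cover_Hr (fst p), cover_Hr (snd p))"
    have "?q \<notin> K"
    proof
      assume "?q \<in> K"
      then have n: "norm ?q \<le> R" by (rule R)
      have le: "\<bar>y\<bar> \<le> norm (y, z, x)" "\<bar>x\<bar> \<le> norm (y, z, x)" for y x :: real and z :: complex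
        using norm_fst_le[of y "(z, x)"] norm_snd_le[of "(z, x)" y] norm_snd_le[of x z] by auto
      have "norm (cover_Hr (fst p)) \<le> R" "norm (cover_Hr (snd p)) \<le> R"
        using norm_fst_le[of "cover_Hr (fst p)" "cover_Hr (snd p)"] norm_snd_le[of "cover_Hr (snd p)" "cover_Hr (fst p)"] n
        by linarith+
      then have "p \<in> slab R"
        unfolding slab_def cover_Hr_def case_prod_beta
        using le(1)[of "fst (fst p)"] le(2)[of "snd (snd (fst p))"]
          le(1)[of "fst (snd p)"] le(2)[of "snd (snd (snd p))"] by (simp, meson order_trans)
      with that show False by simp
    qed
    moreover have "?q \<in> carrier (Hr \<times>\<times> Hr)"
      by (simp add: Hr_def cover_Hr_def case_prod_beta)
    ultimately show ?thesis using u0[of ?q] by (simp add: case_prod_beta)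
  qed
  ultimately show ?thesis using sm by (intro test_liftI)
qed

lemma test_lift_partial:
  assumes U: "test_lift U" and b: "b \<in> Basis"
  shows "test_lift (\<lambda>p. frechet_derivative U (at p) b)"
proof -
  obtain R where sm: "smooth U" and per: "\<And>p l. l \<in> deck \<Longrightarrow> U (p + l) = U p"
    and R: "\<And>p. p \<notin> slab R \<Longrightarrow> U p = 0" by (rule test_liftE[OF U]) blast
  have "frechet_derivative U (at (p + l)) b = frechet_derivative U (at p) b" if l: "l \<in> deck" for p l
  proof -
    have "((\<lambda>q. U (q + l)) has_derivative (\<lambda>h. frechet_derivative U (at (p + l)) h)) (at p)"
      by (rule has_derivative_compose[where f = "\<lambda>q. q + l", OF _ has_derivative_frechet[OF smooth_differentiable[OF sm]]])
        (auto intro!: derivative_eq_intros)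
    then have "(U has_derivative (\<lambda>h. frechet_derivative U (at (p + l)) h)) (at p)" by (simp add: per l)
    from frechet_derivative_at[OF this] show ?thesis by simp
  qed
  moreover have "frechet_derivative U (at p) b = 0" if p: "p \<notin> slab R" for p
  proof -
    have "closed (slab R)" unfolding slab_def
      by (intro closed_Collect_conj closed_Collect_le continuous_intros)
    then have op: "open (- slab R)" by auto
    have "(U has_derivative (\<lambda>_. 0)) (at p)"
      by (rule has_derivative_transform_within_open[OF has_derivative_const[of 0] op]) (use p R in auto)
    from fun_cong[OF frechet_derivative_at[OF this], of b] show ?thesis by simp
  qed
  ultimately show ?thesis using smooth_partial[OF sm b] by (intro test_liftI)
qed

lemma slab_mono: "R \<le> R' \<Longrightarrow> slab R \<subseteq> slab R'"
  by (auto simp: slab_def)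

lemma test_lift_add:
  assumes U: "test_lift U" and V: "test_lift V"
  shows "test_lift (\<lambda>p. U p + V p)"
proof -
  obtain R where R: "smooth U" "\<And>p l. l \<in> deck \<Longrightarrow> U (p + l) = U p" "\<And>p. p \<notin> slab R \<Longrightarrow> U p = 0"
    by (rule test_liftE[OF U]) blast
  obtain R' where R': "smooth V" "\<And>p l. l \<in> deck \<Longrightarrow> V (p + l) = V p" "\<And>p. p \<notin> slab R' \<Longrightarrow> V p = 0"
    by (rule test_liftE[OF V]) blast
  have "U p + V p = 0" if "p \<notin> slab (max R R')" for p
  proof -
    have "p \<notin> slab R" "p \<notin> slab R'"
      using that slab_mono[OF max.cobounded1[of R R']] slab_mono[OF max.cobounded2[of R' R]] by auto
    then show ?thesis by (simp add: R(3) R'(3))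
  qed
  then show ?thesis
    by (intro test_liftI[where R = "max R R'"] smooth_add R(1) R'(1)) (simp_all only: R(2) R'(2))
qed

lemma test_lift_scaleR:
  assumes U: "test_lift U"
  shows "test_lift (\<lambda>p. r *\<^sub>R U p)"
proof -
  obtain R where R: "smooth U" "\<And>p l. l \<in> deck \<Longrightarrow> U (p + l) = U p" "\<And>p. p \<notin> slab R \<Longrightarrow> U p = 0"
    by (rule test_liftE[OF U]) blast
  show ?thesis
    by (intro test_liftI[where R = R] smooth_scaleR R(1)) (simp add: R(2), simp add: R(3))
qed

lemma test_lift_diff: "test_lift U \<Longrightarrow> test_lift V \<Longrightarrow> test_lift (\<lambda>p. U p - V p)"
  using test_lift_add[OF _ test_lift_scaleR[of V "-1"], of U] by simp

text \<open>The condition on \<open>c\<close> makes the coordinate invariant under deck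
  transformations, so that periodicity in the angles is preserved.\<close>

lemma test_lift_coordinate:
  assumes U: "test_lift U" and c: "\<And>l. l \<in> deck \<Longrightarrow> l \<bullet> c = 0"
  shows "test_lift (\<lambda>p. (p \<bullet> c) *\<^sub>R U p)"
proof -
  obtain R where R: "smooth U" "\<And>p l. l \<in> deck \<Longrightarrow> U (p + l) = U p" "\<And>p. p \<notin> slab R \<Longrightarrow> U p = 0"
    by (rule test_liftE[OF U]) blast
  show ?thesis
    by (intro test_liftI[where R = R] smooth_coordinate R(1)) (simp add: R(2) c inner_add_left, simp add: R(3))
qed

text \<open>A deck transformation moves any point of the slab into a compact box whose angles lie
  between 0 and \<open>2 * pi\<close>.\<close>

lemma test_lift_bounded:
  assumes U: "test_lift U"
  obtains B where "0 \<le> B" "\<And>p. cmod (U p) \<le> B"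
proof -
  obtain R where sm: "smooth U" and per: "\<And>p l. l \<in> deck \<Longrightarrow> U (p + l) = U p"
    and R: "\<And>p. p \<notin> slab R \<Longrightarrow> U p = 0" by (rule test_liftE[OF U]) blast
  define K where "K = (({-R..R} \<times> {0..2 * pi} \<times> {-R..R}) \<times> ({-R..R} \<times> {0..2 * pi} \<times> {-R..R}))"
  have "compact (U ` K)"
    unfolding K_def
    by (intro compact_continuous_image compact_Times compact_Icc continuous_on_subset[OF smooth_continuous[OF sm]]) auto
  then obtain B where B: "\<And>p. p \<in> K \<Longrightarrow> cmod (U p) \<le> B"
    using compact_imp_bounded by (force simp: bounded_iff)
  have "cmod (U p) \<le> max 0 B" for p
  proof (cases "p \<in> slab R")
    case True
    obtain y s x y' s' x' where p: "p = ((y, s, x), (y', s', x'))" by (metis surj_pair)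
    define l where "l = ((0 :: real, Arg2pi (cis s) - s, 0 :: real), (0 :: real, Arg2pi (cis s') - s', 0 :: real))"
    have a: "cis (Arg2pi (cis s)) = cis s" for s
      using complex_norm_eq_1_exp[of "cis s"] by (simp add: cis_conv_exp)
    have "l \<in> deck" by (simp add: l_def deck_def a flip: cis_divide)
    moreover have "p + l \<in> K"
      using True Arg2pi[of "cis s"] Arg2pi[of "cis s'"] by (auto simp: p l_def K_def slab_def)
    ultimately show ?thesis using per[of l p] B[of "p + l"] by simp
  qed (simp add: R)
  then show ?thesis by (intro that[of "max 0 B"]) auto
qed

lemma test_lift_continuous: "test_lift U \<Longrightarrow> continuous_on UNIV U"
  by (simp add: test_lift_def smooth_continuous)

lemma test_lift_line_derivative:
  assumes U: "test_lift U"
  shows "((\<lambda>t. U (p + t *\<^sub>R d)) has_vector_derivative frechet_derivative U (at (p + t *\<^sub>R d)) d) (at t)"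
proof -
  have U': "(U has_derivative frechet_derivative U (at q)) (at q)" for q
    using U by (intro has_derivative_frechet smooth_differentiable) (simp add: test_lift_def)
  have "((\<lambda>t. U (p + t *\<^sub>R d)) has_derivative (\<lambda>h. frechet_derivative U (at (p + t *\<^sub>R d)) (h *\<^sub>R d))) (at t)"
    by (rule has_derivative_compose[where f = "\<lambda>t. p + t *\<^sub>R d", OF _ U']) (auto intro!: derivative_eq_intros)
  then show ?thesis
    unfolding has_vector_derivative_def
    by (simp add: linear_cmul[OF has_derivative_linear[OF U']])
qed

lemma test_lift_linear:
  assumes U: "test_lift U"
  shows "frechet_derivative U (at p) (b + r *\<^sub>R c) = frechet_derivative U (at p) b + r *\<^sub>R frechet_derivative U (at p) c"
proof -
  have "linear (frechet_derivative U (at p))"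
    using U by (intro has_derivative_linear[OF has_derivative_frechet] smooth_differentiable) (simp add: test_lift_def)
  then show ?thesis by (simp add: linear_add linear_cmul)
qed

section \<open>Convergence of differentiated Fourier series\<close>

text \<open>Up to \<open>pi / 3\<close> the derivative \<open>cos y - 1 / 2\<close> is nonnegative;
  beyond that point \<open>sin\<close> stays above \<open>sin (pi / 3)\<close>, which exceeds
  \<open>pi / 4\<close>.\<close>

lemma sin_ge_half: "0 \<le> x \<Longrightarrow> x \<le> pi / 2 \<Longrightarrow> x / 2 \<le> sin x"
proof -
  assume x: "0 \<le> x" "x \<le> pi / 2"
  show "x / 2 \<le> sin x"
  proof (cases "x \<le> pi / 3")
    case True
    have "(\<lambda>x. sin x - x / 2) 0 \<le> (\<lambda>x. sin x - x / 2) x"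
    proof (rule DERIV_nonneg_imp_nondecreasing[OF x(1)])
      fix y assume "0 \<le> y" "y \<le> x"
      then have "cos (pi / 3) \<le> cos y" using True pi_gt_zero by (intro cos_monotone_0_pi_le) auto
      then have "0 \<le> cos y - 1 / 2" by (simp add: cos_60)
      moreover have "((\<lambda>x. sin x - x / 2) has_real_derivative (cos y - 1 / 2)) (at y)"
        by (auto intro!: derivative_eq_intros)
      ultimately show "\<exists>d. ((\<lambda>x. sin x - x / 2) has_real_derivative d) (at y) \<and> 0 \<le> d" by blast
    qed
    then show ?thesis by simp
  next
    case False
    then have "sin (pi / 3) \<le> sin x" using x pi_gt_zero by (intro sin_monotone_2pi_le) auto
    moreover have "17 / 10 \<le> sqrt 3" by (rule real_le_rsqrt) (simp add: power2_eq_square)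
    moreover have "x / 2 \<le> 4 / 5" using x pi_approx by simp
    ultimately show ?thesis by (simp add: sin_60)
  qed
qed

text \<open>The chord has length \<open>2 * \<bar>sin (t / 2)\<bar>\<close>. A Lipschitz bound in
  the angle can thereby be divided by the distance of \<open>cis t\<close> from 1.\<close>

lemma abs_le_dist_cis:
  assumes "\<bar>t\<bar> \<le> pi"
  shows "\<bar>t\<bar> \<le> 2 * cmod (cis t - 1)"
proof -
  have "(cmod (cis t - 1))\<^sup>2 = (cos t - 1)\<^sup>2 + (sin t)\<^sup>2"
    by (simp add: cmod_power2)
  also have "\<dots> = 2 - 2 * cos t"
    using sin_cos_squared_add[of t] by (simp add: power2_eq_square algebra_simps)
  also have "cos t = 1 - 2 * (sin (t / 2))\<^sup>2" using cos_double_sin[of "t / 2"] by simp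
  finally have "(cmod (cis t - 1))\<^sup>2 = (2 * \<bar>sin (t / 2)\<bar>)\<^sup>2" by (simp add: power_mult_distrib)
  then have eq: "cmod (cis t - 1) = 2 * \<bar>sin (t / 2)\<bar>" by (rule power2_eq_imp_eq) auto
  have "\<bar>t\<bar> / 2 / 2 \<le> sin (\<bar>t\<bar> / 2)" using assms by (intro sin_ge_half) auto
  also have "\<dots> \<le> \<bar>sin (t / 2)\<bar>" by (cases "0 \<le> t") (auto simp: abs_if)
  finally show ?thesis by (simp add: eq)
qed

definition fcoef :: "(complex \<Rightarrow> complex) \<Rightarrow> int \<Rightarrow> complex" where
  "fcoef F n = (LINT w|circle_measure. w powi (- n) * F w)"

lemma circle_integrable_bounded:
  assumes [measurable]: "F \<in> borel_measurable circle_measure" and "\<And>z. cmod z = 1 \<Longrightarrow> cmod (F z) \<le> B"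
  shows "integrable circle_measure F"
  by (rule circle.integrable_const_bound[where B = B]) (use assms in \<open>auto intro: AE_I2\<close>)

lemma fcoef_le:
  assumes m [measurable]: "F \<in> borel_measurable circle_measure" and B: "\<And>z. cmod z = 1 \<Longrightarrow> cmod (F z) \<le> B"
  shows "cmod (fcoef F n) \<le> B"
proof -
  have i: "integrable circle_measure (\<lambda>w. w powi (- n) * F w)"
    by (rule circle_integrable_bounded[where B = B]) (use B in \<open>auto simp: norm_mult powi_norm_1\<close>)
  have "cmod (fcoef F n) \<le> (LINT w|circle_measure. cmod (w powi (- n) * F w))"
    unfolding fcoef_def by (rule integral_norm_bound)
  also have "\<dots> \<le> (LINT w|circle_measure. B)"
    by (intro integral_mono integrable_norm i) (use B in \<open>auto simp: norm_mult powi_norm_1\<close>)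
  finally show ?thesis using circle.prob_space by simp
qed

text \<open>Integration by parts over one period; the boundary terms cancel by periodicity.\<close>

lemma fcoef_derivative:
  assumes m: "F \<in> borel_measurable circle_measure" "F' \<in> borel_measurable circle_measure"
    and d: "\<And>t. ((\<lambda>t. F (cis t)) has_vector_derivative F' (cis t)) (at t)"
    and c: "continuous_on UNIV (\<lambda>t. F' (cis t))"
  shows "fcoef F' n = \<i> * of_int n * fcoef F n"
proof -
  note [measurable] = m
  have cF: "continuous_on UNIV (\<lambda>t. F (cis t))"
    using d by (auto simp: continuous_on_eq_continuous_at intro: has_vector_derivative_continuous)
  have coef: "fcoef G n = (LINT t|lborel. indicator {0..2 * pi} t *\<^sub>R (cis (- of_int n * t) * G (cis t))) / (2 * pi)"
    if [measurable]: "G \<in> borel_measurable circle_measure" for G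
    unfolding fcoef_def by (subst integral_circle) (auto simp: set_lebesgue_integral_def cis_power_int)
  have int: "integrable lborel (\<lambda>t. indicator {0..2 * pi} t *\<^sub>R (cis (- of_int n * t) * G t))"
    if "continuous_on UNIV G" for G :: "real \<Rightarrow> complex"
  proof -
    have "continuous_on {0..2 * pi} (\<lambda>t. cis (- of_int n * t) * G t)"
      by (intro continuous_intros continuous_on_subset[OF that]) auto
    from borel_integrable_atLeastAtMost'[OF this] show ?thesis by (simp only: set_integrable_def)
  qed
  have cis_d: "((\<lambda>t. cis (- of_int n * t)) has_vector_derivative (- of_int n) *\<^sub>R (\<i> * cis (- of_int n * t))) (at t)" for t
  proof -
    have f: "((\<lambda>t. - of_int n * t) has_vector_derivative - of_int n) (at t)"
      by (auto intro!: derivative_eq_intros simp flip: has_real_derivative_iff_has_vector_derivative)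
    have "(iexp has_vector_derivative \<i> * iexp (- of_int n * t)) (at (- of_int n * t))"
      by (rule has_vector_derivative_iexp)
    from vector_diff_chain_at[OF f this] show ?thesis by (simp add: cis_conv_exp o_def)
  qed
  have "(LINT t|lborel. indicator {0..2 * pi} t *\<^sub>R (cis (- of_int n * t) * F' (cis t) + ((- of_int n) *\<^sub>R (\<i> * cis (- of_int n * t))) * F (cis t)))
      = cis (- of_int n * (2 * pi)) * F (cis (2 * pi)) - cis (- of_int n * 0) * F (cis 0)"
  proof (rule integral_FTC_atLeastAtMost)
    fix t :: real
    show "((\<lambda>t. cis (- of_int n * t) * F (cis t)) has_vector_derivative
        (cis (- of_int n * t) * F' (cis t) + ((- of_int n) *\<^sub>R (\<i> * cis (- of_int n * t))) * F (cis t))) (at t within {0..2 * pi})"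
      by (rule has_vector_derivative_at_within) (rule has_vector_derivative_mult[OF cis_d d])
  qed (use c cF in \<open>auto intro!: continuous_intros intro: continuous_on_subset\<close>)
  also have "\<dots> = 0"
  proof -
    have "cis (of_int k * (2 * pi)) = 1" for k
      using cis_multiple_2pi[of "of_int k"] by (simp add: mult_ac)
    from this[of "- n"] this[of 1] show ?thesis by simp
  qed
  also have "(\<lambda>t. indicator {0..2 * pi} t *\<^sub>R (cis (- of_int n * t) * F' (cis t) + ((- of_int n) *\<^sub>R (\<i> * cis (- of_int n * t))) * F (cis t)))
      = (\<lambda>t. indicator {0..2 * pi} t *\<^sub>R (cis (- of_int n * t) * F' (cis t)) - \<i> * of_int n * (indicator {0..2 * pi} t *\<^sub>R (cis (- of_int n * t) * F (cis t))))"
    by (auto simp: fun_eq_iff scaleR_conv_of_real algebra_simps split: split_indicator)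
  finally have "(LINT t|lborel. indicator {0..2 * pi} t *\<^sub>R (cis (- of_int n * t) * F' (cis t)) - \<i> * of_int n * (indicator {0..2 * pi} t *\<^sub>R (cis (- of_int n * t) * F (cis t)))) = 0" .
  then have "(LINT t|lborel. indicator {0..2 * pi} t *\<^sub>R (cis (- of_int n * t) * F' (cis t)))
     - \<i> * of_int n * (LINT t|lborel. indicator {0..2 * pi} t *\<^sub>R (cis (- of_int n * t) * F (cis t))) = 0"
    unfolding Bochner_Integration.integral_diff[OF int[OF c] integrable_mult_right[OF int[OF cF]]] integral_mult_right_zero .
  then show ?thesis unfolding coef[OF m(1)] coef[OF m(2)] by simp
qed

text \<open>The Riemann-Lebesgue lemma, from the summability contained in Bessel's inequality. The
  injection \<nu> allows the index to run to either infinity.\<close>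

lemma fcoef_tendsto_0:
  assumes F: "F \<in> L2 circle_measure" and inj: "inj (\<nu> :: nat \<Rightarrow> int)"
  shows "(\<lambda>N. fcoef F (\<nu> N)) \<longlonglongrightarrow> 0"
proof -
  define e where "e n z = z powi n" for n :: int and z :: complex
  have [measurable]: "e n \<in> borel_measurable circle_measure" for n unfolding e_def by measurable
  have eL: "e n \<in> L2 circle_measure" for n
    by (rule L2I) (auto intro!: circle.integrable_const_bound[where B = 1] AE_I2 simp: e_def powi_norm_1)
  have on: "L2_inner circle_measure (e n) (e m) = (if n = m then 1 else 0)" for n m
  proof -
    have "L2_inner circle_measure (e n) (e m) = (LINT z|circle_measure. z powi (n - m))"
      unfolding L2_inner_def e_def
    proof (rule Bochner_Integration.integral_cong)
      fix z assume "z \<in> space circle_measure"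
      then have z: "cmod z = 1" "z \<noteq> 0" by auto
      show "z powi n * cnj (z powi m) = z powi (n - m)"
        unfolding cnj_powi[OF z(1)] using z(2) by (simp add: power_int_diff power_int_minus divide_inverse)
    qed simp
    then show ?thesis by (simp add: circle_orthogonal)
  qed
  have co: "fcoef F n = L2_inner circle_measure F (e n)" for n
    unfolding fcoef_def L2_inner_def e_def
  proof (rule Bochner_Integration.integral_cong)
    fix w assume "w \<in> space circle_measure"
    then have w: "cmod w = 1" by simp
    show "w powi (- n) * F w = F w * cnj (w powi n)" by (simp only: cnj_powi[OF w] mult.commute)
  qed simp
  have "summable (\<lambda>N. (cmod (fcoef F (\<nu> N)))\<^sup>2)"
  proof (rule summableI_nonneg_bounded)
    fix K
    have "(\<Sum>N<K. (cmod (fcoef F (\<nu> N)))\<^sup>2) = (\<Sum>n\<in>\<nu> ` {..<K}. (cmod (fcoef F n))\<^sup>2)"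
      using inj by (subst sum.reindex) (auto intro: inj_on_subset)
    also have "\<dots> \<le> (L2_norm circle_measure F)\<^sup>2"
      unfolding co by (rule Bessel[OF _ eL on F]) simp
    finally show "(\<Sum>N<K. (cmod (fcoef F (\<nu> N)))\<^sup>2) \<le> (L2_norm circle_measure F)\<^sup>2" .
  qed simp
  then have "(\<lambda>N. (cmod (fcoef F (\<nu> N)))\<^sup>2) \<longlonglongrightarrow> 0" by (rule summable_LIMSEQ_zero)
  then have "(\<lambda>N. sqrt ((cmod (fcoef F (\<nu> N)))\<^sup>2)) \<longlonglongrightarrow> sqrt 0" by (rule tendsto_real_sqrt)
  then show ?thesis by (simp add: tendsto_norm_zero_iff)
qed

lemma sum_symmetric_telescope:
  fixes a :: "int \<Rightarrow> 'a :: ab_group_add"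
  shows "(\<Sum>n\<in>{- int N..int N}. a (n - 1) - a n) = a (- int N - 1) - a (int N)"
proof (induction N)
  case 0
  then show ?case by simp
next
  case (Suc N)
  have "{- int (Suc N)..int (Suc N)} = insert (- int (Suc N)) (insert (int (Suc N)) {- int N..int N})" by auto
  then have "(\<Sum>n\<in>{- int (Suc N)..int (Suc N)}. a (n - 1) - a n)
     = (a (- int (Suc N) - 1) - a (- int (Suc N))) + ((a (int (Suc N) - 1) - a (int (Suc N))) + (\<Sum>n\<in>{- int N..int N}. a (n - 1) - a n))"
    by (simp only:) (subst sum.insert; simp)+
  also have "\<dots> = a (- int (Suc N) - 1) - a (int (Suc N))"
  proof -
    have e: "- int (Suc N) = - int N - 1" "int (Suc N) - 1 = int N" by simp_all
    have gen: "(p - q) + ((r - s) + (q - r)) = p - s" for p q r s :: 'a by simp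
    show ?thesis unfolding Suc.IH e by (rule gen)
  qed
  finally show ?case .
qed

text \<open>
  Chernoff's argument: dividing \<open>F' z - F' 1\<close> by \<open>z - 1\<close> turns the symmetric partial sums at \<open>1\<close>
  into a telescoping sum.
\<close>
lemma Fourier_series_derivative:
  assumes m: "F \<in> borel_measurable circle_measure" "F' \<in> borel_measurable circle_measure"
    and d: "\<And>t. ((\<lambda>t. F (cis t)) has_vector_derivative F' (cis t)) (at t)"
    and d': "\<And>t. ((\<lambda>t. F' (cis t)) has_vector_derivative F'' t) (at t)"
    and M: "\<And>t. cmod (F'' t) \<le> M"
  shows "(\<lambda>N. \<Sum>n\<in>{- int N..int N}. \<i> * of_int n * fcoef F n) \<longlonglongrightarrow> F' 1"
    and "cmod (\<Sum>n\<in>{- int N..int N}. \<i> * of_int n * fcoef F n) \<le> cmod (F' 1) + 4 * M"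
proof -
  note [measurable] = m
  have c: "continuous_on UNIV (\<lambda>t. F' (cis t))"
    using d' by (auto simp: continuous_on_eq_continuous_at intro: has_vector_derivative_continuous)
  \<comment> \<open>Division by zero gives \<open>H 1 = 0\<close>, so
    \<open>F' z = F' 1 + (z - 1) * H z\<close> and the bound on \<open>H\<close> hold at
    \<open>z = 1\<close> too.\<close>
  define H where "H z = (F' z - F' 1) / (z - 1)" for z
  have [measurable]: "H \<in> borel_measurable circle_measure" unfolding H_def by measurable
  have M0: "0 \<le> M" using M[of 0] norm_ge_zero[of "F'' 0"] by linarith
  have HB: "cmod (H z) \<le> 2 * M" if z: "cmod z = 1" for z
  proof (cases "z = 1")
    case True
    then show ?thesis using M0 by (simp add: H_def)
  next
    case False
    define t where "t = Arg z"
    have zt: "z = cis t" and t: "\<bar>t\<bar> \<le> pi"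
      using z cis_Arg[of z] Arg_bounded[of z] by (force simp: t_def sgn_div_norm)+
    have "norm (F' (cis t) - F' (cis 0)) \<le> M * norm (t - 0)"
    proof (rule differentiable_bound[of UNIV "\<lambda>t. F' (cis t)" "\<lambda>t h. h *\<^sub>R F'' t"])
      fix s :: real
      show "((\<lambda>t. F' (cis t)) has_derivative (\<lambda>h. h *\<^sub>R F'' s)) (at s within UNIV)"
        using d'[of s] by (simp add: has_vector_derivative_def)
      show "onorm (\<lambda>h. h *\<^sub>R F'' s) \<le> M"
      proof (rule onorm_le)
        fix h :: real
        show "norm (h *\<^sub>R F'' s) \<le> M * norm h"
          using mult_right_mono[OF M[of s] norm_ge_zero[of h]] by (simp add: mult.commute)
      qed
    qed auto
    also have "\<dots> \<le> M * (2 * cmod (z - 1))"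
      using abs_le_dist_cis[OF t] M0 by (intro mult_left_mono) (simp_all add: zt)
    finally show ?thesis using False by (simp add: H_def norm_divide divide_le_eq zt)
  qed
  have HL: "H \<in> L2 circle_measure"
  proof (rule L2I)
    have "(cmod (H z))\<^sup>2 \<le> (2 * M)\<^sup>2" if "cmod z = 1" for z by (intro power_mono HB that) simp
    then show "integrable circle_measure (\<lambda>z. (cmod (H z))\<^sup>2)"
      by (intro circle.integrable_const_bound[where B = "(2 * M)\<^sup>2"] AE_I2) auto
  qed measurable
  have iH: "integrable circle_measure (\<lambda>w. w powi k * H w)" for k
    by (rule circle_integrable_bounded[where B = "2 * M"]) (use HB in \<open>auto simp: norm_mult powi_norm_1\<close>)
  have step: "fcoef F' n = F' 1 * (if n = 0 then 1 else 0) + (fcoef H (n - 1) - fcoef H n)" for n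
  proof -
    have "fcoef F' n = (LINT w|circle_measure. F' 1 * w powi (- n) + (w powi (- (n - 1)) * H w - w powi (- n) * H w))"
      unfolding fcoef_def
    proof (rule Bochner_Integration.integral_cong)
      fix w assume "w \<in> space circle_measure"
      then have w: "w \<noteq> 0" by auto
      have "F' w = F' 1 + (w - 1) * H w" by (cases "w = 1") (auto simp: H_def)
      moreover have "w powi (- (n - 1)) = w powi (- n) * w"
        using w power_int_add[of w "- n" 1] by simp
      moreover have "P * (c + (w - 1) * h) = c * P + (P * w * h - P * h)" for P c h by (simp add: algebra_simps)
      ultimately show "w powi (- n) * F' w = F' 1 * w powi (- n) + (w powi (- (n - 1)) * H w - w powi (- n) * H w)"
        by (simp only:)
    qed simp
    also have "\<dots> = (LINT w|circle_measure. F' 1 * w powi (- n)) + ((LINT w|circle_measure. w powi (- (n - 1)) * H w) - (LINT w|circle_measure. w powi (- n) * H w))"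
    proof (subst Bochner_Integration.integral_add)
      show "integrable circle_measure (\<lambda>w. F' 1 * w powi - n)"
        by (rule circle_integrable_bounded[where B = "cmod (F' 1)"]) (auto simp: norm_mult powi_norm_1)
      show "integrable circle_measure (\<lambda>w. w powi - (n - 1) * H w - w powi - n * H w)"
        by (intro Bochner_Integration.integrable_diff iH)
    qed (simp only: Bochner_Integration.integral_diff[OF iH iH])
    also have "(LINT w|circle_measure. F' 1 * w powi (- n)) = F' 1 * (if n = 0 then 1 else 0)"
      using circle_orthogonal[of "- n"] by simp
    finally show ?thesis by (simp add: fcoef_def)
  qed
  have partial: "(\<Sum>n\<in>{- int N..int N}. \<i> * of_int n * fcoef F n) = F' 1 + (fcoef H (- int N - 1) - fcoef H (int N))" for N
  proof -
    have "(\<Sum>n\<in>{- int N..int N}. \<i> * of_int n * fcoef F n) = (\<Sum>n\<in>{- int N..int N}. F' 1 * (if n = 0 then 1 else 0) + (fcoef H (n - 1) - fcoef H n))"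
      by (simp add: fcoef_derivative[OF m d c, symmetric] step)
    also have "\<dots> = F' 1 + (fcoef H (- int N - 1) - fcoef H (int N))"
      unfolding sum.distrib sum_symmetric_telescope by (simp add: sum_distrib_left[symmetric] sum.delta)
    finally show ?thesis .
  qed
  have "(\<lambda>N. F' 1 + (fcoef H (- int N - 1) - fcoef H (int N))) \<longlonglongrightarrow> F' 1 + (0 - 0)"
    by (intro tendsto_intros fcoef_tendsto_0[OF HL]) (auto simp: inj_def)
  then show "(\<lambda>N. \<Sum>n\<in>{- int N..int N}. \<i> * of_int n * fcoef F n) \<longlonglongrightarrow> F' 1"
    by (simp add: partial)
  \<comment> \<open>Telescoping leaves two coefficients of \<open>H\<close>, each at most
    \<open>2 * M\<close>; hence the \<open>4 * M\<close> in the statement.\<close>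
  have "cmod (fcoef H (- int N - 1)) \<le> 2 * M" "cmod (fcoef H (int N)) \<le> 2 * M"
    by (auto intro!: fcoef_le HB)
  then show "cmod (\<Sum>n\<in>{- int N..int N}. \<i> * of_int n * fcoef F n) \<le> cmod (F' 1) + 4 * M"
    unfolding partial
    using norm_triangle_ineq[of "F' 1" "fcoef H (- int N - 1) - fcoef H (int N)"]
      norm_triangle_ineq4[of "fcoef H (- int N - 1)" "fcoef H (int N)"] by linarith
qed


section \<open>From lifts back to functions on the group\<close>

text \<open>\<open>Arg2pi\<close> is continuous off the nonnegative reals and vanishes on them, so
  it agrees with its truncation to their complement.\<close>

lemma borel_measurable_Arg2pi [measurable]: "Arg2pi \<in> borel_measurable borel"
proof -
  have "continuous_on (- \<real>\<^sub>\<ge>\<^sub>0) Arg2pi"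
    by (auto intro!: continuous_at_imp_continuous_on continuous_at_Arg2pi)
  moreover have "(- \<real>\<^sub>\<ge>\<^sub>0 :: complex set) \<in> sets borel"
    by (intro borel_open open_Compl closed_nonneg_Reals_complex)
  ultimately have "(\<lambda>z. indicator (- \<real>\<^sub>\<ge>\<^sub>0) z *\<^sub>R Arg2pi z) \<in> borel_measurable borel"
    by (intro borel_measurable_continuous_on_indicator)
  moreover have "(\<lambda>z. indicator (- \<real>\<^sub>\<ge>\<^sub>0) z *\<^sub>R Arg2pi z) = Arg2pi"
    by (auto simp: fun_eq_iff Arg2pi_eq_0 complex_nonneg_Reals_iff complex_is_Real_iff split: split_indicator)
  ultimately show ?thesis by simp
qed

text \<open>On the carrier, a Borel section of the covering map. It jumps where the angle passes 0;
  periodicity of lifts hides the jump.\<close>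

definition section_Hr :: "real \<times> complex \<times> real \<Rightarrow> real \<times> real \<times> real" where
  "section_Hr g = (fst g, Arg2pi (fst (snd g)), snd (snd g))"

text \<open>Measurability and bounds of test functions are read off from this form, and the bounds
  hold even off the carrier.\<close>

definition descend :: "(cover2 \<Rightarrow> complex) \<Rightarrow> (real \<times> complex \<times> real) \<times> (real \<times> complex \<times> real) \<Rightarrow> complex" where
  "descend U p = U (section_Hr (fst p), section_Hr (snd p))"

lemma cis_Arg2pi: "cmod z = 1 \<Longrightarrow> cis (Arg2pi z) = z"
  using complex_norm_eq_1_exp[of z] by (simp add: cis_conv_exp)

lemma cover_section: "g \<in> carrier Hr \<Longrightarrow> cover_Hr (section_Hr g) = g"
  by (cases g) (auto simp: cover_Hr_def section_Hr_def carrier_Hr cis_Arg2pi)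

lemma descend_cover:
  assumes U: "test_lift U"
  shows "descend U (cover_Hr a, cover_Hr b) = U (a, b)"
proof -
  define l where "l = ((0 :: real, Arg2pi (cis (fst (snd a))) - fst (snd a), 0 :: real), (0 :: real, Arg2pi (cis (fst (snd b))) - fst (snd b), 0 :: real))"
  have "l \<in> deck" by (simp add: l_def deck_def cis_Arg2pi flip: cis_divide)
  moreover have "(section_Hr (cover_Hr a), section_Hr (cover_Hr b)) = (a, b) + l"
    by (cases a; cases b) (simp add: l_def section_Hr_def cover_Hr_def)
  moreover have "U ((a, b) + l) = U (a, b)"
    using U \<open>l \<in> deck\<close> unfolding test_lift_def by blast
  ultimately show ?thesis by (simp only: descend_def fst_conv snd_conv)
qed

lemma measurable_descend [measurable]:
  assumes U: "test_lift U"
  shows "descend U \<in> borel_measurable haar2"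
proof -
  have s [measurable]: "section_Hr \<in> borel_measurable haar_Hr"
    unfolding section_Hr_def[abs_def] by (intro borel_measurable_Pair) simp_all
  have "U \<in> borel_measurable borel"
    by (rule borel_measurable_continuous_onI[OF test_lift_continuous[OF U]])
  moreover have "(\<lambda>p. (section_Hr (fst p), section_Hr (snd p))) \<in> borel_measurable haar2"
    by (intro borel_measurable_Pair measurable_compose[OF measurable_fst s] measurable_compose[OF measurable_snd s])
  ultimately show ?thesis unfolding descend_def[abs_def] by (rule measurable_compose[rotated])
qed

definition unit_theta :: cover2 where
  "unit_theta = ((0, 1, 0), (0, 0, 0))"

lemma unit_theta_Basis: "unit_theta \<in> Basis"
  by (simp add: unit_theta_def Basis_prod_def zero_prod_def)

definition dtheta :: "(cover2 \<Rightarrow> complex) \<Rightarrow> cover2 \<Rightarrow> complex" where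
  "dtheta U p = frechet_derivative U (at p) unit_theta"

lemma test_lift_dtheta: "test_lift U \<Longrightarrow> test_lift (dtheta U)"
  unfolding dtheta_def[abs_def] by (intro test_lift_partial unit_theta_Basis)

text \<open>Rotating the first circle is a shift of the first angle, whichever branch the section
  selects afterwards.\<close>

lemma descend_rotate:
  assumes U: "test_lift U" and g: "g \<in> carrier Hr" and h: "h \<in> carrier Hr"
  shows "descend U (transl g (0, cis t, 0), h) = U ((section_Hr g, section_Hr h) + t *\<^sub>R unit_theta)"
proof -
  have "(section_Hr g, section_Hr h) + t *\<^sub>R unit_theta = (section_Hr g + (0, t, 0), section_Hr h)"
    by (simp add: unit_theta_def zero_prod_def)
  moreover have "transl g (0, cis t, 0) = cover_Hr (section_Hr g + (0, t, 0))"
    using cover_section[OF g]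
    by (cases g) (simp add: cover_Hr_def section_Hr_def transl_def flip: cis_mult)
  ultimately show ?thesis
    using descend_cover[OF U, of "section_Hr g + (0, t, 0)" "section_Hr h"] by (simp add: cover_section[OF h])
qed

lemma descend_rotate_derivative:
  assumes U: "test_lift U" and g: "g \<in> carrier Hr" and h: "h \<in> carrier Hr"
  shows "((\<lambda>t. descend U (transl g (0, cis t, 0), h)) has_vector_derivative descend (dtheta U) (transl g (0, cis t, 0), h)) (at t)"
  unfolding descend_rotate[OF U g h] descend_rotate[OF test_lift_dtheta[OF U] g h]
  unfolding dtheta_def by (rule test_lift_line_derivative[OF U])

text \<open>The conjugate reverses the direction of rotation, to match \<open>exp(-tZ)\<close> in
  \<open>beta\<close>.\<close>

lemma descend_rotate_derivative':
  assumes U: "test_lift U" and g: "g \<in> carrier Hr" and h: "h \<in> carrier Hr"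
  shows "((\<lambda>t. descend U (transl g (0, cnj (cis t), 0), h)) has_vector_derivative - descend (dtheta U) (transl g (0, cnj (cis t), 0), h)) (at t)"
proof -
  have "((\<lambda>t. - t) has_vector_derivative - 1) (at t)" for t :: real
    by (auto intro!: derivative_eq_intros)
  from vector_diff_chain_at[OF this descend_rotate_derivative[OF U g h]] show ?thesis
    by (simp add: o_def cis_cnj)
qed

lemma test_function_descend:
  assumes u: "u \<in> test_functions_Hr2"
  obtains U where "test_lift U" "\<And>p. p \<in> carrier Hr2 \<Longrightarrow> u p = descend U p"
proof
  show U: "test_lift (\<lambda>(a, b). u (cover_Hr a, cover_Hr b))"
    by (rule test_functions_lift[OF u])
  fix p assume "p \<in> carrier Hr2"
  then show "u p = descend (\<lambda>(a, b). u (cover_Hr a, cover_Hr b)) p"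
    by (cases p) (simp add: descend_def cover_section)
qed

lemma transl_carrier: "g \<in> carrier Hr \<Longrightarrow> h \<in> carrier Hr \<Longrightarrow> transl g h \<in> carrier Hr"
  by (cases g; cases h) (simp add: transl_def carrier_Hr norm_mult)

lemma beta_cong:
  assumes "\<And>p. p \<in> carrier Hr2 \<Longrightarrow> u p = u' p"
  shows "beta v n u = beta v n u'"
  unfolding beta_def
proof (intro Bochner_Integration.integral_cong refl arg_cong2[where f = times])
  fix g w assume "g \<in> space haar_Hr" "w \<in> space circle_measure"
  then have "(transl g (0, cnj w, 0), inver g) \<in> carrier Hr2"
    by (auto intro!: transl_carrier inver_carrier simp: space_haar_Hr) (simp add: carrier_Hr)
  then show "u (transl g (0, cnj w, 0), inver g) = u' (transl g (0, cnj w, 0), inver g)" by (rule assms)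
qed

text \<open>For each \<open>g\<close> the sums involve the differentiated Fourier series, at angle
  0, of \<open>t \<mapsto> u (g exp(-tZ), inv g)\<close>. Bounds for the first two angular
  derivatives of the lift control its partial sums uniformly in \<open>g\<close>, so a multiple of
  the modulus of \<open>v\<close> dominates.\<close>

theorem sum_beta_tendsto:
  assumes v: "integrable haar_Hr v" and u: "u \<in> test_functions_Hr2"
  shows "(\<lambda>N. - (\<Sum>n\<in>{- int N..int N}. \<i> * of_int n * beta v n u))
    \<longlonglongrightarrow> (LINT g|haar_Hr. deriv_fst Hr exp_Z u (g, inv\<^bsub>Hr\<^esub> g) * v g)"
proof -
  obtain U where U: "test_lift U" and uU: "\<And>p. p \<in> carrier Hr2 \<Longrightarrow> u p = descend U p"
    by (rule test_function_descend[OF u]) blast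
  note U' = test_lift_dtheta[OF U] and U'' = test_lift_dtheta[OF test_lift_dtheta[OF U]]
  note [measurable] = measurable_descend[OF U] measurable_descend[OF U'] borel_measurable_integrable[OF v]
  obtain B where B: "0 \<le> B" "\<And>p. cmod (U p) \<le> B" by (rule test_lift_bounded[OF U]) blast
  obtain B' where B': "0 \<le> B'" "\<And>p. cmod (dtheta U p) \<le> B'" by (rule test_lift_bounded[OF U']) blast
  obtain B'' where B'': "0 \<le> B''" "\<And>p. cmod (dtheta (dtheta U) p) \<le> B''" by (rule test_lift_bounded[OF U'']) blast
  define \<Phi> where "\<Phi> g w = descend U (transl g (0, cnj w, 0), inver g)" for g w
  define \<Phi>' where "\<Phi>' g w = - descend (dtheta U) (transl g (0, cnj w, 0), inver g)" for g w
  have [measurable]: "(\<lambda>p. \<Phi> (fst p) (snd p)) \<in> borel_measurable (haar_Hr \<Otimes>\<^sub>M circle_measure)"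
    unfolding \<Phi>_def by measurable
  have \<Phi>_m: "\<Phi> g \<in> borel_measurable circle_measure" "\<Phi>' g \<in> borel_measurable circle_measure" if g: "g \<in> carrier Hr" for g
  proof -
    have [measurable]: "(\<lambda>_. g) \<in> measurable circle_measure haar_Hr"
      using g by (intro measurable_const) (simp add: space_haar_Hr)
    show "\<Phi> g \<in> borel_measurable circle_measure" "\<Phi>' g \<in> borel_measurable circle_measure"
      unfolding \<Phi>_def \<Phi>'_def by measurable
  qed
  have F1: "(\<lambda>N. \<Sum>n\<in>{- int N..int N}. \<i> * of_int n * fcoef (\<Phi> g) n) \<longlonglongrightarrow> \<Phi>' g 1"
    and F2: "cmod (\<Sum>n\<in>{- int N..int N}. \<i> * of_int n * fcoef (\<Phi> g) n) \<le> B' + 4 * B''" if g: "g \<in> carrier Hr" for g N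
  proof -
    note h = inver_carrier[OF g]
    have 1: "((\<lambda>t. \<Phi> g (cis t)) has_vector_derivative \<Phi>' g (cis t)) (at t)" for t
      unfolding \<Phi>_def \<Phi>'_def by (rule descend_rotate_derivative'[OF U g h])
    have 2: "((\<lambda>t. \<Phi>' g (cis t)) has_vector_derivative descend (dtheta (dtheta U)) (transl g (0, cnj (cis t), 0), inver g)) (at t)" for t
      unfolding \<Phi>'_def using has_vector_derivative_minus[OF descend_rotate_derivative'[OF U' g h, of t]] by simp
    have 3: "cmod (descend (dtheta (dtheta U)) (transl g (0, cnj (cis t), 0), inver g)) \<le> B''" for t
      unfolding descend_def by (rule B'')
    note F = Fourier_series_derivative[OF \<Phi>_m[OF g] 1 2 3]
    show "(\<lambda>N. \<Sum>n\<in>{- int N..int N}. \<i> * of_int n * fcoef (\<Phi> g) n) \<longlonglongrightarrow> \<Phi>' g 1" by (rule F(1))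
    have "cmod (\<Phi>' g 1) \<le> B'" by (simp add: \<Phi>'_def descend_def B')
    then show "cmod (\<Sum>n\<in>{- int N..int N}. \<i> * of_int n * fcoef (\<Phi> g) n) \<le> B' + 4 * B''" using F(2)[of N] by linarith
  qed
  have fm [measurable]: "(\<lambda>g. fcoef (\<Phi> g) n) \<in> borel_measurable haar_Hr" for n
    unfolding fcoef_def by measurable
  have fi: "integrable haar_Hr (\<lambda>g. v g * fcoef (\<Phi> g) n)" for n
  proof (rule Bochner_Integration.integrable_bound)
    show "integrable haar_Hr (\<lambda>g. v g * of_real B)" using v by simp
    have "cmod (fcoef (\<Phi> g) n) \<le> B" if "g \<in> carrier Hr" for g
      by (rule fcoef_le[OF \<Phi>_m(1)[OF that]]) (simp add: \<Phi>_def descend_def B)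
    then show "AE g in haar_Hr. cmod (v g * fcoef (\<Phi> g) n) \<le> cmod (v g * of_real B)"
      using B by (intro AE_I2) (auto simp: norm_mult space_haar_Hr intro!: mult_left_mono)
  qed measurable
  have b: "beta v n u = (LINT g|haar_Hr. v g * fcoef (\<Phi> g) n)" for n
    by (subst beta_cong[where u' = "descend U"]) (simp_all add: uU beta_def fcoef_def \<Phi>_def)
  have sum: "(\<Sum>n\<in>{- int N..int N}. \<i> * of_int n * beta v n u) = (LINT g|haar_Hr. v g * (\<Sum>n\<in>{- int N..int N}. \<i> * of_int n * fcoef (\<Phi> g) n))" for N
  proof -
    have "(LINT g|haar_Hr. v g * (\<Sum>n\<in>{- int N..int N}. \<i> * of_int n * fcoef (\<Phi> g) n)) = (LINT g|haar_Hr. (\<Sum>n\<in>{- int N..int N}. \<i> * of_int n * (v g * fcoef (\<Phi> g) n)))"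
      by (simp add: sum_distrib_left mult_ac)
    also have "\<dots> = (\<Sum>n\<in>{- int N..int N}. (LINT g|haar_Hr. \<i> * of_int n * (v g * fcoef (\<Phi> g) n)))"
      by (rule Bochner_Integration.integral_sum) (intro integrable_mult_right fi)
    finally show ?thesis by (simp add: b)
  qed
  have lim: "(\<lambda>N. (LINT g|haar_Hr. v g * (\<Sum>n\<in>{- int N..int N}. \<i> * of_int n * fcoef (\<Phi> g) n))) \<longlonglongrightarrow> (LINT g|haar_Hr. v g * \<Phi>' g 1)"
  proof (rule integral_dominated_convergence[where w = "\<lambda>g. cmod (v g) * (B' + 4 * B'')"])
    show "integrable haar_Hr (\<lambda>g. cmod (v g) * (B' + 4 * B''))" using v by simp
    have "(\<lambda>_. 1) \<in> measurable haar_Hr circle_measure" by (rule measurable_circleI) auto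
    note [measurable] = this
    have "(\<lambda>g. descend (dtheta U) (transl g (0, cnj 1, 0), inver g)) \<in> borel_measurable haar_Hr"
      by measurable
    then show "(\<lambda>g. v g * \<Phi>' g 1) \<in> borel_measurable haar_Hr"
      unfolding \<Phi>'_def by (intro borel_measurable_times borel_measurable_uminus) simp_all
    show "AE g in haar_Hr. (\<lambda>N. v g * (\<Sum>n\<in>{- int N..int N}. \<i> * of_int n * fcoef (\<Phi> g) n)) \<longlonglongrightarrow> v g * \<Phi>' g 1"
      by (intro AE_I2 tendsto_mult tendsto_const F1) (simp add: space_haar_Hr)
    show "AE g in haar_Hr. cmod (v g * (\<Sum>n\<in>{- int N..int N}. \<i> * of_int n * fcoef (\<Phi> g) n)) \<le> cmod (v g) * (B' + 4 * B'')" for N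
      unfolding norm_mult by (intro AE_I2 mult_left_mono F2) (simp_all add: space_haar_Hr)
  qed measurable
  \<comment> \<open>The function \<Phi> follows \<open>exp(-tZ)\<close>, so its angular derivative
    at 0 is the negative of the derivative along \<open>Z\<close>.\<close>
  have "deriv_fst Hr exp_Z u (g, inv\<^bsub>Hr\<^esub> g) = - \<Phi>' g 1" if g: "g \<in> carrier Hr" for g
  proof -
    have "u (g \<otimes>\<^bsub>Hr\<^esub> exp_Z t, inver g) = descend U (transl g (0, cis t, 0), inver g)" for t
    proof -
      have "(transl g (0, cis t, 0), inver g) \<in> carrier Hr2"
        using g by (auto intro!: transl_carrier inver_carrier) (simp add: carrier_Hr)
      then show ?thesis by (simp add: mult_Hr exp_Z_def uU)
    qed
    then have "deriv_fst Hr exp_Z u (g, inv\<^bsub>Hr\<^esub> g) = vector_derivative (\<lambda>t. descend U (transl g (0, cis t, 0), inver g)) (at 0)"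
      by (simp add: deriv_fst_def inver_Hr[OF g])
    also have "\<dots> = descend (dtheta U) (transl g (0, cis 0, 0), inver g)"
      by (rule vector_derivative_at) (rule descend_rotate_derivative[OF U g inver_carrier[OF g]])
    finally show ?thesis by (simp add: \<Phi>'_def)
  qed
  then have "(LINT g|haar_Hr. deriv_fst Hr exp_Z u (g, inv\<^bsub>Hr\<^esub> g) * v g) = (LINT g|haar_Hr. - (v g * \<Phi>' g 1))"
    by (intro Bochner_Integration.integral_cong) (simp_all add: space_haar_Hr mult.commute)
  also have "\<dots> = - (LINT g|haar_Hr. v g * \<Phi>' g 1)" by (rule integral_minus)
  finally show ?thesis
    using tendsto_minus[OF lim] by (simp add: sum)
qed

section \<open>Test functions are coefficient functions\<close>

text \<open>The kernel of the inverse of \<open>1 - d/dt\<close> on the line, in the sense of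
  \<open>integral_exp_half\<close>.\<close>

definition exp_half :: "real \<Rightarrow> real" where
  "exp_half t = indicator {0..} t * exp (- t)"

lemma exp_half_measurable [measurable]: "exp_half \<in> borel_measurable borel"
  unfolding exp_half_def by measurable

lemma exp_half_bounds: "0 \<le> exp_half t" "exp_half t \<le> 1"
  by (auto simp: exp_half_def split: split_indicator)

lemma exp_half_integrable: "integrable lborel exp_half"
proof (rule integrableI_bounded)
  have "(\<integral>\<^sup>+t. ennreal (norm (exp_half t)) \<partial>lborel) = (\<integral>\<^sup>+t. ennreal (exp (- t)) * indicator {0..} t \<partial>lborel)"
    by (rule nn_integral_cong) (auto simp: exp_half_def split: split_indicator)
  also have "\<dots> = ennreal (0 - (- exp (- 0)))"
  proof (rule nn_integral_FTC_atLeast)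
    show "((\<lambda>t. - exp (- t)) \<longlongrightarrow> (0 :: real)) at_top"
      using tendsto_minus[OF filterlim_compose[OF exp_at_bot filterlim_uminus_at_bot_at_top]] by simp
  qed (auto intro!: derivative_eq_intros)
  finally show "(\<integral>\<^sup>+t. ennreal (norm (exp_half t)) \<partial>lborel) < \<infinity>" by simp
qed measurable

text \<open>The integrand is the derivative of \<open>- exp (- t) * f t\<close>, which tends to 0 at
  infinity because \<open>f\<close> is bounded.\<close>

lemma integral_exp_half:
  fixes f :: "real \<Rightarrow> complex"
  assumes f: "\<And>t. (f has_vector_derivative f' t) (at t)" and c: "continuous_on UNIV f'"
    and B: "\<And>t. cmod (f t) \<le> B" and B': "\<And>t. cmod (f' t) \<le> B'"
  shows "(LINT t|lborel. of_real (exp_half t) * (f t - f' t)) = f 0"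
proof -
  have cf: "continuous_on UNIV f"
    using f by (auto simp: continuous_on_eq_continuous_at intro: has_vector_derivative_continuous)
  have [measurable]: "f \<in> borel_measurable borel" "f' \<in> borel_measurable borel"
    using cf c by (auto intro: borel_measurable_continuous_onI)
  let ?g = "\<lambda>t. of_real (exp (- t)) * (f t - f' t)"
  have cg: "continuous_on S ?g" for S
    by (intro continuous_intros continuous_on_subset[OF cf] continuous_on_subset[OF c]) auto
  have eq: "of_real (exp_half t) * (f t - f' t) = indicator {0..} t *\<^sub>R ?g t" for t
    by (auto simp: exp_half_def split: split_indicator)
  have "integrable lborel (\<lambda>t. of_real (exp_half t) * (f t - f' t))"
  proof (rule Bochner_Integration.integrable_bound)
    show "integrable lborel (\<lambda>t. exp_half t * (B + B'))" using exp_half_integrable by simp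
    have "cmod (f t - f' t) \<le> B + B'" for t
      using norm_triangle_ineq4[of "f t" "f' t"] B[of t] B'[of t] by linarith
    then show "AE t in lborel. cmod (of_real (exp_half t) * (f t - f' t)) \<le> norm (exp_half t * (B + B'))"
      by (intro AE_I2) (auto simp: norm_mult abs_mult exp_half_bounds intro!: mult_left_mono order_trans[OF _ abs_ge_self])
  qed measurable
  then have int: "set_integrable lborel {0..} ?g" by (simp only: set_integrable_def eq)
  have fin: "set_lebesgue_integral lborel {0..b} ?g = f 0 - of_real (exp (- b)) * f b" if b: "0 \<le> b" for b
  proof -
    have "(LINT t|lborel. indicator {0..b} t *\<^sub>R ?g t) = - (of_real (exp (- b)) * f b) - (- (of_real (exp (- 0)) * f 0))"
    proof (rule integral_FTC_atLeastAtMost[OF b])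
      fix t :: real
      have e: "((\<lambda>t. complex_of_real (exp (- t))) has_vector_derivative of_real (- exp (- t))) (at t)"
        by (rule has_vector_derivative_of_real) (auto intro!: derivative_eq_intros)
      have "((\<lambda>t. - (of_real (exp (- t)) * f t)) has_vector_derivative - (of_real (exp (- t)) * f' t + of_real (- exp (- t)) * f t)) (at t)"
        by (intro has_vector_derivative_minus has_vector_derivative_mult e f)
      then show "((\<lambda>t. - (of_real (exp (- t)) * f t)) has_vector_derivative ?g t) (at t within {0..b})"
        by (rule has_vector_derivative_at_within[OF has_vector_derivative_eq_rhs]) (simp add: algebra_simps)
    qed (rule cg)
    then show ?thesis by (simp add: set_lebesgue_integral_def)
  qed
  have "((\<lambda>b. set_lebesgue_integral lborel {0..b} ?g) \<longlongrightarrow> set_lebesgue_integral lborel {0..} ?g) at_top"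
    by (rule tendsto_set_lebesgue_integral_at_top[OF _ int]) simp
  moreover have "((\<lambda>b. set_lebesgue_integral lborel {0..b} ?g) \<longlongrightarrow> f 0) at_top"
  proof -
    have e0: "((\<lambda>b. exp (- b) * B) \<longlongrightarrow> (0 :: real)) at_top"
      using tendsto_mult_right[OF filterlim_compose[OF exp_at_bot filterlim_uminus_at_bot_at_top], of B] by simp
    have "((\<lambda>b. of_real (exp (- b)) * f b) \<longlongrightarrow> 0) at_top"
      by (rule Lim_null_comparison[OF _ e0]) (auto intro!: always_eventually mult_left_mono simp: norm_mult B)
    then have "((\<lambda>b. f 0 - of_real (exp (- b)) * f b) \<longlongrightarrow> f 0 - 0) at_top" by (intro tendsto_intros)
    then have l: "((\<lambda>b. f 0 - of_real (exp (- b)) * f b) \<longlongrightarrow> f 0) at_top" by simp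
    show ?thesis
      by (rule Lim_transform_eventually[OF l])
        (auto intro!: eventually_mono[OF eventually_ge_at_top[of 0]] simp: fin)
  qed
  ultimately have "set_lebesgue_integral lborel {0..} ?g = f 0"
    by (rule tendsto_unique[rotated]) simp
  then show ?thesis by (simp only: eq set_lebesgue_integral_def)
qed

text \<open>
  The kernel of the inverse of \<open>1 - \<partial>\<close> on the circle: the exponential weight of the half line, summed over a
  fibre of the covering; \<open>2 * pi\<close> accounts for the normalisation of the Haar measure.
\<close>
definition exp_circle :: "complex \<Rightarrow> real" where
  "exp_circle z = 2 * pi / (1 - exp (- 2 * pi)) * exp (- Arg2pi z)"

lemma exp_circle_measurable [measurable]: "exp_circle \<in> borel_measurable borel"
  unfolding exp_circle_def by measurable

lemma exp_circle_bounds: "0 \<le> exp_circle z" "exp_circle z \<le> 2 * pi / (1 - exp (- 2 * pi))"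
proof -
  have "0 \<le> 2 * pi / (1 - exp (- 2 * pi))" by simp
  moreover have "exp (- Arg2pi z) \<le> 1" using Arg2pi[of z] by simp
  ultimately show "0 \<le> exp_circle z" "exp_circle z \<le> 2 * pi / (1 - exp (- 2 * pi))"
    unfolding exp_circle_def by (intro mult_nonneg_nonneg mult_left_le; simp)+
qed

lemma Arg2pi_cis: "0 \<le> t \<Longrightarrow> t < 2 * pi \<Longrightarrow> Arg2pi (cis t) = t"
  by (rule Arg2pi_unique[of 1]) (simp_all add: cis_conv_exp)

text \<open>The same primitive over one period; by periodicity its boundary values combine to
  \<open>1 - exp (- 2 * pi)\<close> times \<open>f 0\<close>, and the normalisation of
  \<open>exp_circle\<close> removes this factor.\<close>

lemma integral_exp_circle:
  fixes f :: "real \<Rightarrow> complex"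
  assumes f: "\<And>t. (f has_vector_derivative f' t) (at t)" and c: "continuous_on UNIV f'"
    and per: "f (2 * pi) = f 0"
    and G: "G \<in> borel_measurable circle_measure" "\<And>t. G (cis t) = f t - f' t"
  shows "(LINT z|circle_measure. of_real (exp_circle z) * G z) = f 0"
proof -
  note [measurable] = G(1)
  have cf: "continuous_on UNIV f"
    using f by (auto simp: continuous_on_eq_continuous_at intro: has_vector_derivative_continuous)
  have [measurable]: "f \<in> borel_measurable borel" "f' \<in> borel_measurable borel"
    using cf c by (auto intro: borel_measurable_continuous_onI)
  let ?k = "2 * pi / (1 - exp (- 2 * pi)) :: real"
  let ?g = "\<lambda>t. of_real (exp (- t)) * (f t - f' t)"
  have cg: "continuous_on S ?g" for S
    by (intro continuous_intros continuous_on_subset[OF cf] continuous_on_subset[OF c]) auto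
  have "(LINT t|lborel. indicator {0..2 * pi} t *\<^sub>R ?g t) = - (of_real (exp (- (2 * pi))) * f (2 * pi)) - (- (of_real (exp (- 0)) * f 0))"
  proof (rule integral_FTC_atLeastAtMost)
    fix t :: real
    have e: "((\<lambda>t. complex_of_real (exp (- t))) has_vector_derivative of_real (- exp (- t))) (at t)"
      by (rule has_vector_derivative_of_real) (auto intro!: derivative_eq_intros)
    have "((\<lambda>t. - (of_real (exp (- t)) * f t)) has_vector_derivative - (of_real (exp (- t)) * f' t + of_real (- exp (- t)) * f t)) (at t)"
      by (intro has_vector_derivative_minus has_vector_derivative_mult e f)
    then show "((\<lambda>t. - (of_real (exp (- t)) * f t)) has_vector_derivative ?g t) (at t within {0..2 * pi})"
      by (rule has_vector_derivative_at_within[OF has_vector_derivative_eq_rhs]) (simp add: algebra_simps)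
  qed (simp, rule cg)
  then have val: "(LINT t|lborel. indicator {0..2 * pi} t *\<^sub>R ?g t) = of_real (1 - exp (- 2 * pi)) * f 0"
    by (simp add: per left_diff_distrib)
  have "(LINT z|circle_measure. of_real (exp_circle z) * G z) = (LINT t|lborel. indicator {0..2 * pi} t *\<^sub>R (of_real (exp_circle (cis t)) * G (cis t))) / (2 * pi)"
    by (subst integral_circle) (auto simp: set_lebesgue_integral_def)
  also have "(LINT t|lborel. indicator {0..2 * pi} t *\<^sub>R (of_real (exp_circle (cis t)) * G (cis t))) = (LINT t|lborel. of_real ?k * (indicator {0..2 * pi} t *\<^sub>R ?g t))"
  proof (rule integral_cong_AE)
    have "AE t in lborel. t \<noteq> 2 * pi" by (rule AE_lborel_singleton)
    then show "AE t in lborel. indicator {0..2 * pi} t *\<^sub>R (of_real (exp_circle (cis t)) * G (cis t)) = of_real ?k * (indicator {0..2 * pi} t *\<^sub>R ?g t)"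
    proof eventually_elim
      case (elim t)
      then show ?case
        by (cases "t \<in> {0..2 * pi}") (simp_all add: exp_circle_def Arg2pi_cis G(2) mult.assoc)
    qed
    have [measurable]: "(\<lambda>t. G (cis t)) \<in> borel_measurable borel" by (rule borel_measurable_circle_cis[OF G(1)])
    show "(\<lambda>t. indicator {0..2 * pi} t *\<^sub>R (of_real (exp_circle (cis t)) * G (cis t))) \<in> borel_measurable lborel"
      by measurable
  qed measurable
  also have "\<dots> = of_real ?k * (of_real (1 - exp (- 2 * pi)) * f 0)"
    unfolding integral_mult_right_zero val ..
  also have "\<dots> = 2 * pi * f 0"
  proof -
    have "1 - exp (- 2 * pi) \<noteq> (0 :: real)" by simp
    then have "complex_of_real ?k * of_real (1 - exp (- 2 * pi)) = 2 * pi"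
      by (simp flip: of_real_mult)
    then show ?thesis by (simp only: mult.assoc[symmetric])
  qed
  finally show ?thesis by simp
qed


section \<open>The convolution kernel and the resolvents of the left invariant fields\<close>

definition left_kernel :: "real \<times> complex \<times> real \<Rightarrow> complex" where
  "left_kernel g = of_real (exp_half (fst g) * exp_half (snd (snd g)) * exp_circle (fst (snd g)))"

lemma left_kernel_measurable [measurable]: "left_kernel \<in> borel_measurable haar_Hr"
  unfolding left_kernel_def by measurable

lemma left_kernel_chart:
  "left_kernel (chart1 p) = (of_real (exp_half (fst (fst p))) * of_real (exp_half (snd (fst p)))) * of_real (exp_circle (snd p))"
  by (simp add: left_kernel_def chart1_def)

lemma exp_circle_integrable: "integrable circle_measure (\<lambda>z. complex_of_real (exp_circle z))"
  by (rule circle_integrable_bounded[where B = "2 * pi / (1 - exp (- 2 * pi))"])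
    (use exp_circle_bounds in \<open>auto simp del: mult_minus_left\<close>)

lemma left_kernel_integrable_chart: "integrable (plane \<Otimes>\<^sub>M circle_measure) (\<lambda>p. left_kernel (chart1 p))"
  unfolding left_kernel_chart
  by (intro integrable_pair_mult(1)[where g = "\<lambda>z. complex_of_real (exp_circle z)" and f = "\<lambda>q. complex_of_real (exp_half (fst q)) * complex_of_real (exp_half (snd q))"]
      integrable_pair_mult(1)[where f = "\<lambda>y. complex_of_real (exp_half y)" and g = "\<lambda>y. complex_of_real (exp_half y)"]
      sigma_finite_plane sigma_finite_circle exp_circle_integrable integrable_of_real exp_half_integrable lborel.sigma_finite_measure_axioms)

lemma left_kernel_integrable: "integrable haar_Hr left_kernel"
  using left_kernel_integrable_chart mpres_chart1
    integrable_distr_eq[of chart1 "plane \<Otimes>\<^sub>M circle_measure" haar_Hr left_kernel]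
  by (simp add: mpres_def)

text \<open>The kernel is integrable and bounded, so its square is dominated by a multiple of its
  modulus.\<close>

lemma left_kernel_L2: "left_kernel \<in> L2 haar_Hr"
proof (rule L2I)
  let ?k = "2 * pi / (1 - exp (- 2 * pi)) :: real"
  show "integrable haar_Hr (\<lambda>g. (cmod (left_kernel g))\<^sup>2)"
  proof (rule Bochner_Integration.integrable_bound)
    show "integrable haar_Hr (\<lambda>g. ?k * cmod (left_kernel g))"
      using left_kernel_integrable by (intro integrable_mult_right integrable_norm)
    have "cmod (left_kernel g) \<le> ?k" for g
    proof -
      have "exp_half (fst g) * exp_half (snd (snd g)) \<le> 1"
        by (intro mult_le_one exp_half_bounds)
      then have "(exp_half (fst g) * exp_half (snd (snd g))) * exp_circle (fst (snd g)) \<le> 1 * ?k"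
        by (intro mult_mono exp_circle_bounds) auto
      moreover have "0 \<le> (exp_half (fst g) * exp_half (snd (snd g))) * exp_circle (fst (snd g))"
        by (intro mult_nonneg_nonneg exp_half_bounds exp_circle_bounds)
      ultimately show ?thesis unfolding left_kernel_def by (simp only: norm_of_real abs_of_nonneg mult_1)
    qed
    then have "(cmod (left_kernel g))\<^sup>2 \<le> ?k * cmod (left_kernel g)" for g
      unfolding power2_eq_square by (intro mult_right_mono) auto
    then show "AE g in haar_Hr. norm ((cmod (left_kernel g))\<^sup>2) \<le> norm (?k * cmod (left_kernel g))"
      by (intro AE_I2) (simp only: real_norm_def abs_of_nonneg zero_le_power2, rule order_trans[OF _ abs_ge_self], simp)
  qed measurable
qed measurable

lemma integral_left_kernel:
  assumes [measurable]: "F \<in> borel_measurable haar_Hr" and B: "\<And>g. cmod (F g) \<le> B"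
  shows "(LINT s|haar_Hr. left_kernel s * F s)
     = (LINT y|lborel. of_real (exp_half y) * (LINT x|lborel. of_real (exp_half x) * (LINT z|circle_measure. of_real (exp_circle z) * F (y, z, x))))"
proof -
  interpret PC: pair_sigma_finite plane circle_measure
    using sigma_finite_plane sigma_finite_circle by (simp add: pair_sigma_finite_def)
  have m: "(\<lambda>s. left_kernel s * F s) \<in> borel_measurable haar_Hr" by measurable
  \<comment> \<open>Any point will do for reading off the sign of \<open>B\<close>.\<close>
  have B0: "0 \<le> B" using B[of undefined] norm_ge_zero order_trans by blast
  have int: "integrable (plane \<Otimes>\<^sub>M circle_measure) (\<lambda>p. left_kernel (chart1 p) * F (chart1 p))"
  proof (rule Bochner_Integration.integrable_bound)
    show "integrable (plane \<Otimes>\<^sub>M circle_measure) (\<lambda>p. left_kernel (chart1 p) * of_real B)"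
      using left_kernel_integrable_chart by simp
    show "AE p in plane \<Otimes>\<^sub>M circle_measure. cmod (left_kernel (chart1 p) * F (chart1 p)) \<le> cmod (left_kernel (chart1 p) * of_real B)"
      using B B0 by (intro AE_I2) (simp add: norm_mult mult_left_mono)
  qed measurable
  have "(LINT s|haar_Hr. left_kernel s * F s) = (LINT p|(plane \<Otimes>\<^sub>M circle_measure). left_kernel (chart1 p) * F (chart1 p))"
    by (rule mpres_integral[OF mpres_chart1 m, symmetric])
  also have "\<dots> = (LINT q|plane. LINT z|circle_measure. left_kernel (chart1 (q, z)) * F (chart1 (q, z)))"
    by (rule PC.integral_fst'[OF int, symmetric])
  also have "\<dots> = (LINT y|lborel. LINT x|lborel. LINT z|circle_measure. left_kernel (chart1 ((y, x), z)) * F (chart1 ((y, x), z)))"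
    by (rule lborel_pair.integral_fst'[symmetric]) (rule PC.integrable_fst'[OF int])
  also have "\<dots> = (LINT y|lborel. of_real (exp_half y) * (LINT x|lborel. of_real (exp_half x) * (LINT z|circle_measure. of_real (exp_circle z) * F (y, z, x))))"
    unfolding integral_mult_right_zero[symmetric]
    by (simp add: left_kernel_def chart1_def mult_ac)
  finally show ?thesis .
qed

text \<open>With \<open>b\<close>, \<open>b'\<close> and \<open>c\<close> the directions of
  \<open>y\<close>, of the angle and of \<open>x\<close> in one factor, this is the lift of the left
  invariant field along \<open>y\<close>, whose angular part comes from the twist in the group
  law.\<close>

lemma test_lift_field:
  assumes U: "test_lift U" and b: "b \<in> Basis" and b': "b' \<in> Basis" and c: "\<And>l. l \<in> deck \<Longrightarrow> l \<bullet> c = 0"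
  shows "test_lift (\<lambda>p. frechet_derivative U (at p) (b + (p \<bullet> c) *\<^sub>R b'))"
  unfolding test_lift_linear[OF U]
  by (intro test_lift_add test_lift_coordinate test_lift_partial U b b' c)

text \<open>As \<open>b\<close> and \<open>b'\<close> are orthogonal to \<open>c\<close>, the
  coefficient \<open>p \<bullet> c\<close> is constant along the flow. The orbits are straight lines
  and \<open>integral_exp_half\<close> applies along each of them.\<close>

lemma test_lift_field_resolvent:
  assumes U: "test_lift U" and b: "b \<in> Basis" and b': "b' \<in> Basis" and c: "\<And>l. l \<in> deck \<Longrightarrow> l \<bullet> c = 0"
    and o: "b \<bullet> c = 0" "b' \<bullet> c = 0"
  shows "(LINT t|lborel. of_real (exp_half t) * (U (p + t *\<^sub>R (b + (p \<bullet> c) *\<^sub>R b'))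
     - frechet_derivative U (at (p + t *\<^sub>R (b + (p \<bullet> c) *\<^sub>R b'))) (b + ((p + t *\<^sub>R (b + (p \<bullet> c) *\<^sub>R b')) \<bullet> c) *\<^sub>R b'))) = U p"
proof -
  let ?d = "b + (p \<bullet> c) *\<^sub>R b'"
  let ?D = "\<lambda>p. frechet_derivative U (at p) (b + (p \<bullet> c) *\<^sub>R b')"
  have D: "test_lift ?D" by (rule test_lift_field[OF U b b' c])
  have pc: "(p + t *\<^sub>R ?d) \<bullet> c = p \<bullet> c" for t using o by (simp add: inner_add_left)
  obtain B where B: "0 \<le> B" "\<And>p. cmod (U p) \<le> B" by (rule test_lift_bounded[OF U]) blast
  obtain B' where B': "0 \<le> B'" "\<And>p. cmod (?D p) \<le> B'" by (rule test_lift_bounded[OF D]) blast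
  have "(LINT t|lborel. of_real (exp_half t) * (U (p + t *\<^sub>R ?d) - ?D (p + t *\<^sub>R ?d))) = U (p + 0 *\<^sub>R ?d)"
  proof (rule integral_exp_half)
    fix t
    show "((\<lambda>t. U (p + t *\<^sub>R ?d)) has_vector_derivative ?D (p + t *\<^sub>R ?d)) (at t)"
      unfolding pc by (rule test_lift_line_derivative[OF U])
    show "cmod (U (p + t *\<^sub>R ?d)) \<le> B" by (rule B)
    show "cmod (?D (p + t *\<^sub>R ?d)) \<le> B'" by (rule B')
  next
    show "continuous_on UNIV (\<lambda>t. ?D (p + t *\<^sub>R ?d))"
      by (rule continuous_on_compose2[OF test_lift_continuous[OF D]]) (auto intro!: continuous_intros)
  qed
  then show ?thesis by simp
qed

lemma test_lift_circle_resolvent: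
  assumes U: "test_lift U" and b: "b \<in> Basis" and per: "\<And>t. cis t = 1 \<Longrightarrow> t *\<^sub>R b \<in> deck"
  shows "(LINT z|circle_measure. of_real (exp_circle z) * (U (p + Arg2pi z *\<^sub>R b) - frechet_derivative U (at (p + Arg2pi z *\<^sub>R b)) b)) = U p"
proof -
  let ?D = "\<lambda>p. frechet_derivative U (at p) b"
  have D: "test_lift ?D" by (rule test_lift_partial[OF U b])
  note UD = test_lift_diff[OF U D]
  \<comment> \<open>\<open>Arg2pi (cis t)\<close> and \<open>t\<close> differ by a period, which
    deck invariance absorbs.\<close>
  have shift: "W (p + Arg2pi (cis t) *\<^sub>R b) = W (p + t *\<^sub>R b)" if "test_lift W" for W t
  proof -
    have "cis (Arg2pi (cis t) - t) = 1" by (simp add: cis_Arg2pi flip: cis_divide)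
    then have l: "(Arg2pi (cis t) - t) *\<^sub>R b \<in> deck" by (rule per)
    have "W ((p + t *\<^sub>R b) + (Arg2pi (cis t) - t) *\<^sub>R b) = W (p + t *\<^sub>R b)"
      using that l unfolding test_lift_def by blast
    then show ?thesis by (simp add: algebra_simps)
  qed
  have "(LINT z|circle_measure. of_real (exp_circle z) * (U (p + Arg2pi z *\<^sub>R b) - ?D (p + Arg2pi z *\<^sub>R b))) = U (p + 0 *\<^sub>R b)"
  proof (rule integral_exp_circle)
    fix t
    show "((\<lambda>t. U (p + t *\<^sub>R b)) has_vector_derivative ?D (p + t *\<^sub>R b)) (at t)"
      by (rule test_lift_line_derivative[OF U])
    show "U (p + Arg2pi (cis t) *\<^sub>R b) - ?D (p + Arg2pi (cis t) *\<^sub>R b) = U (p + t *\<^sub>R b) - ?D (p + t *\<^sub>R b)"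
      by (simp only: shift[OF U] shift[OF D])
  next
    show "continuous_on UNIV (\<lambda>t. ?D (p + t *\<^sub>R b))"
      by (rule continuous_on_compose2[OF test_lift_continuous[OF D]]) (auto intro!: continuous_intros)
    have "(2 * pi) *\<^sub>R b \<in> deck" by (rule per) simp
    then have "U (p + (2 * pi) *\<^sub>R b) = U p" using U unfolding test_lift_def by blast
    then show "U (p + (2 * pi) *\<^sub>R b) = U (p + 0 *\<^sub>R b)" by simp
    have "(\<lambda>p. U p - ?D p) \<in> borel_measurable borel"
      by (rule borel_measurable_continuous_onI[OF test_lift_continuous[OF UD]])
    moreover have "(\<lambda>z. p + Arg2pi z *\<^sub>R b) \<in> borel_measurable circle_measure" by measurable
    ultimately show "(\<lambda>z. U (p + Arg2pi z *\<^sub>R b) - ?D (p + Arg2pi z *\<^sub>R b)) \<in> borel_measurable circle_measure"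
      by (rule measurable_compose[rotated])
  qed
  then show ?thesis by simp
qed

text \<open>
  Inverting \<open>1 - X\<close> for the three left invariant vector fields \<open>X\<close> of one factor, in the order
  \<open>y\<close>, \<open>x\<close>, \<open>z\<close>; the inverse is averaging along the flow against an exponential weight.
\<close>
lemma test_lift_resolvent:
  assumes U: "test_lift U" and b: "ey \<in> Basis" "ex \<in> Basis" "et \<in> Basis"
    and o: "ey \<bullet> ex = 0" "et \<bullet> ex = 0" and c: "\<And>l. l \<in> deck \<Longrightarrow> l \<bullet> ex = 0"
    and per: "\<And>t. cis t = 1 \<Longrightarrow> t *\<^sub>R et \<in> deck"
  obtains W where "test_lift W"
    "\<And>p. U p = (LINT y|lborel. of_real (exp_half y) * (LINT x|lborel. of_real (exp_half x) *
       (LINT z|circle_measure. of_real (exp_circle z) * W (p + y *\<^sub>R (ey + (p \<bullet> ex) *\<^sub>R et) + x *\<^sub>R ex + Arg2pi z *\<^sub>R et))))"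
proof -
  define V1 where "V1 p = U p - frechet_derivative U (at p) (ey + (p \<bullet> ex) *\<^sub>R et)" for p
  \<comment> \<open>The vector 0 in place of \<open>ex\<close> makes the field constant, so the
    lemma for the \<open>y\<close>-direction serves for the \<open>x\<close>-direction as
    well.\<close>
  define V2 where "V2 p = V1 p - frechet_derivative V1 (at p) (ex + (p \<bullet> 0) *\<^sub>R et)" for p
  define W where "W p = V2 p - frechet_derivative V2 (at p) et" for p
  have V1: "test_lift V1" unfolding V1_def by (intro test_lift_diff test_lift_field U b c)
  have V2: "test_lift V2" unfolding V2_def by (intro test_lift_diff test_lift_field V1 b) simp
  have W: "test_lift W" unfolding W_def by (intro test_lift_diff test_lift_partial V2 b)
  have 1: "U p = (LINT y|lborel. of_real (exp_half y) * V1 (p + y *\<^sub>R (ey + (p \<bullet> ex) *\<^sub>R et)))" for p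
    unfolding V1_def by (rule test_lift_field_resolvent[OF U b(1,3) c o, symmetric])
  have 2: "V1 p = (LINT x|lborel. of_real (exp_half x) * V2 (p + x *\<^sub>R ex))" for p
    using test_lift_field_resolvent[OF V1 b(2,3), of 0 p] by (simp add: V2_def)
  have 3: "V2 p = (LINT z|circle_measure. of_real (exp_circle z) * W (p + Arg2pi z *\<^sub>R et))" for p
    unfolding W_def by (rule test_lift_circle_resolvent[OF V2 b(3) per, symmetric])
  \<comment> \<open>In this nesting the angular drift uses the \<open>x\<close>-coordinate of
    \<open>p\<close> before the shift by \<open>x\<close>, as right multiplication by
    \<open>(y, z, x)\<close> does.\<close>
  show ?thesis
    by (rule that[OF W]) (simp only: 1[symmetric] 2[symmetric] 3[symmetric])
qed

lemma descend_bounded: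
  assumes "test_lift W"
  obtains B where "0 \<le> B" "\<And>p. cmod (descend W p) \<le> B"
  by (rule test_lift_bounded[OF assms]) (simp add: descend_def)

lemma Basis_cover: "((1, 0, 0), 0) \<in> (Basis :: cover2 set)" "((0, 0, 1), 0) \<in> (Basis :: cover2 set)" "((0, 1, 0), 0) \<in> (Basis :: cover2 set)"
  "(0, (1, 0, 0)) \<in> (Basis :: cover2 set)" "(0, (0, 0, 1)) \<in> (Basis :: cover2 set)" "(0, (0, 1, 0)) \<in> (Basis :: cover2 set)"
  by (auto simp: Basis_prod_def zero_prod_def)

text \<open>The displacement in \<open>test_lift_resolvent\<close> is a lift of right translation by
  \<open>(y, z, x)\<close>; the nested integrals there thus become one integral over the
  group.\<close>

lemma cover_translate:
  assumes g: "g \<in> carrier Hr" and z: "cmod z = 1"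
  shows "cover_Hr (section_Hr g + (y, snd (snd g) * y + Arg2pi z, x)) = transl g (y, z, x)"
proof -
  obtain b w a where g_eq: "g = (b, w, a)" and w: "cmod w = 1" using g by (cases g) (auto simp: carrier_Hr)
  have "cis (Arg2pi w + (a * y + Arg2pi z)) = w * z * cis (a * y)"
    by (simp add: cis_Arg2pi w z mult_ac flip: cis_mult)
  then show ?thesis by (simp add: g_eq section_Hr_def cover_Hr_def transl_def)
qed

lemma measurable_const_haar: "g \<in> carrier Hr \<Longrightarrow> (\<lambda>_. g) \<in> measurable M haar_Hr"
  by (intro measurable_const) (simp add: space_haar_Hr)

lemma descend_resolvent_fst:
  assumes U: "test_lift U"
  obtains W where "test_lift W" "\<And>g h. g \<in> carrier Hr \<Longrightarrow> h \<in> carrier Hr \<Longrightarrow>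
    descend U (g, h) = (LINT s|haar_Hr. left_kernel s * descend W (transl g s, h))"
proof -
  obtain W where W: "test_lift W" and eq: "\<And>p. U p = (LINT y|lborel. of_real (exp_half y) * (LINT x|lborel. of_real (exp_half x) *
       (LINT z|circle_measure. of_real (exp_circle z) * W (p + y *\<^sub>R (((1, 0, 0), 0) + (p \<bullet> ((0, 0, 1), 0)) *\<^sub>R ((0, 1, 0), 0)) + x *\<^sub>R ((0, 0, 1), 0) + Arg2pi z *\<^sub>R ((0, 1, 0), 0)))))"
  proof (rule test_lift_resolvent[OF U Basis_cover(1,2,3)])
    show "t *\<^sub>R ((0, 1, 0), 0) \<in> deck" if "cis t = 1" for t
      using that unfolding deck_def by (auto simp: zero_prod_def intro!: exI[of _ t] exI[of _ 0])
  qed (auto simp: deck_def)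
  obtain B where B: "\<And>p. cmod (descend W p) \<le> B" by (rule descend_bounded[OF W]) blast
  show ?thesis
  proof (rule that[OF W])
    fix g h assume g: "g \<in> carrier Hr" and h: "h \<in> carrier Hr"
    note [measurable] = measurable_const_haar[OF g] measurable_const_haar[OF h] measurable_descend[OF W]
    have arg: "W ((section_Hr g, section_Hr h) + y *\<^sub>R (((1, 0, 0), 0) + ((section_Hr g, section_Hr h) \<bullet> ((0, 0, 1), 0)) *\<^sub>R ((0, 1, 0), 0)) + x *\<^sub>R ((0, 0, 1), 0) + Arg2pi z *\<^sub>R ((0, 1, 0), 0))
       = descend W (transl g (y, z, x), h)" if "cmod z = 1" for y x z
    proof -
      have "(section_Hr g, section_Hr h) + y *\<^sub>R (((1, 0, 0), 0) + ((section_Hr g, section_Hr h) \<bullet> ((0, 0, 1), 0)) *\<^sub>R ((0, 1, 0), 0)) + x *\<^sub>R ((0, 0, 1), 0) + Arg2pi z *\<^sub>R ((0, 1, 0), 0)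
        = (section_Hr g + (y, snd (snd g) * y + Arg2pi z, x), section_Hr h)"
        by (simp add: section_Hr_def zero_prod_def)
      then show ?thesis
        using descend_cover[OF W, of "section_Hr g + (y, snd (snd g) * y + Arg2pi z, x)" "section_Hr h"]
        by (simp only: cover_translate[OF g that] cover_section[OF h])
    qed
    have "descend U (g, h) = (LINT y|lborel. of_real (exp_half y) * (LINT x|lborel. of_real (exp_half x) *
       (LINT z|circle_measure. of_real (exp_circle z) * descend W (transl g (y, z, x), h))))"
      unfolding descend_def[of U] fst_conv snd_conv eq[of "(section_Hr g, section_Hr h)"]
      by (intro Bochner_Integration.integral_cong refl arg_cong2[where f = times] arg) simp
    also have "\<dots> = (LINT s|haar_Hr. left_kernel s * descend W (transl g s, h))"
      by (rule integral_left_kernel[OF _ B, symmetric]) measurable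
    finally show "descend U (g, h) = (LINT s|haar_Hr. left_kernel s * descend W (transl g s, h))" .
  qed
qed

lemma descend_resolvent_snd:
  assumes U: "test_lift U"
  obtains W where "test_lift W" "\<And>g h. g \<in> carrier Hr \<Longrightarrow> h \<in> carrier Hr \<Longrightarrow>
    descend U (g, h) = (LINT s|haar_Hr. left_kernel s * descend W (g, transl h s))"
proof -
  obtain W where W: "test_lift W" and eq: "\<And>p. U p = (LINT y|lborel. of_real (exp_half y) * (LINT x|lborel. of_real (exp_half x) *
       (LINT z|circle_measure. of_real (exp_circle z) * W (p + y *\<^sub>R ((0, (1, 0, 0)) + (p \<bullet> (0, (0, 0, 1))) *\<^sub>R (0, (0, 1, 0))) + x *\<^sub>R (0, (0, 0, 1)) + Arg2pi z *\<^sub>R (0, (0, 1, 0))))))"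
  proof (rule test_lift_resolvent[OF U Basis_cover(4,5,6)])
    show "t *\<^sub>R (0, (0, 1, 0)) \<in> deck" if "cis t = 1" for t
      using that unfolding deck_def by (auto simp: zero_prod_def intro!: exI[of _ t] exI[of _ 0])
  qed (auto simp: deck_def)
  obtain B where B: "\<And>p. cmod (descend W p) \<le> B" by (rule descend_bounded[OF W]) blast
  show ?thesis
  proof (rule that[OF W])
    fix g h assume g: "g \<in> carrier Hr" and h: "h \<in> carrier Hr"
    note [measurable] = measurable_const_haar[OF g] measurable_const_haar[OF h] measurable_descend[OF W]
    have arg: "W ((section_Hr g, section_Hr h) + y *\<^sub>R ((0, (1, 0, 0)) + ((section_Hr g, section_Hr h) \<bullet> (0, (0, 0, 1))) *\<^sub>R (0, (0, 1, 0))) + x *\<^sub>R (0, (0, 0, 1)) + Arg2pi z *\<^sub>R (0, (0, 1, 0)))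
       = descend W (g, transl h (y, z, x))" if "cmod z = 1" for y x z
    proof -
      have "(section_Hr g, section_Hr h) + y *\<^sub>R ((0, (1, 0, 0)) + ((section_Hr g, section_Hr h) \<bullet> (0, (0, 0, 1))) *\<^sub>R (0, (0, 1, 0))) + x *\<^sub>R (0, (0, 0, 1)) + Arg2pi z *\<^sub>R (0, (0, 1, 0))
        = (section_Hr g, section_Hr h + (y, snd (snd h) * y + Arg2pi z, x))"
        by (simp add: section_Hr_def zero_prod_def)
      then show ?thesis
        using descend_cover[OF W, of "section_Hr g" "section_Hr h + (y, snd (snd h) * y + Arg2pi z, x)"]
        by (simp only: cover_translate[OF h that] cover_section[OF g])
    qed
    have "descend U (g, h) = (LINT y|lborel. of_real (exp_half y) * (LINT x|lborel. of_real (exp_half x) *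
       (LINT z|circle_measure. of_real (exp_circle z) * descend W (g, transl h (y, z, x)))))"
      unfolding descend_def[of U] fst_conv snd_conv eq[of "(section_Hr g, section_Hr h)"]
      by (intro Bochner_Integration.integral_cong refl arg_cong2[where f = times] arg) simp
    also have "\<dots> = (LINT s|haar_Hr. left_kernel s * descend W (g, transl h s))"
      by (rule integral_left_kernel[OF _ B, symmetric]) measurable
    finally show "descend U (g, h) = (LINT s|haar_Hr. left_kernel s * descend W (g, transl h s))" .
  qed
qed

text \<open>Bounded, and zero outside a set of finite measure: the slab bounds the real coordinates,
  and the circles have mass 1.\<close>

lemma descend_L2:
  assumes W: "test_lift W"
  shows "descend W \<in> L2 haar2"
proof (rule L2I)
  note [measurable] = measurable_descend[OF W]
  show "descend W \<in> borel_measurable haar2" by measurable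
  obtain R where R: "\<And>p. p \<notin> slab R \<Longrightarrow> W p = 0" by (rule test_liftE[OF W]) blast
  obtain B where B: "0 \<le> B" "\<And>p. cmod (descend W p) \<le> B" by (rule descend_bounded[OF W]) blast
  define i where "i y = complex_of_real (indicator {-R..R} y)" for y :: real
  define k where "k g = i (fst g) * i (snd (snd g))" for g :: "real \<times> complex \<times> real"
  have i: "integrable lborel i" unfolding i_def by (intro integrable_of_real integrable_real_indicator) (auto simp: emeasure_lborel_Icc_eq)
  have [measurable]: "i \<in> borel_measurable borel" unfolding i_def by measurable
  have [measurable]: "k \<in> borel_measurable haar_Hr" unfolding k_def by measurable
  have "integrable (plane \<Otimes>\<^sub>M circle_measure) (\<lambda>p. (i (fst (fst p)) * i (snd (fst p))) * 1)"
    by (intro integrable_pair_mult(1)[where g = "\<lambda>_. 1" and f = "\<lambda>q. i (fst q) * i (snd q)"] integrable_pair_mult(1)[of lborel lborel i i]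
        sigma_finite_plane sigma_finite_circle i lborel.sigma_finite_measure_axioms) simp
  then have "integrable haar_Hr k"
    using mpres_chart1 integrable_distr_eq[of chart1 "plane \<Otimes>\<^sub>M circle_measure" haar_Hr k]
    by (simp add: mpres_def k_def chart1_def)
  then have kk: "integrable haar2 (\<lambda>p. k (fst p) * k (snd p))"
    by (intro integrable_pair_mult(1) sigma_finite_haar_Hr)
  show "integrable haar2 (\<lambda>p. (cmod (descend W p))\<^sup>2)"
  proof (rule Bochner_Integration.integrable_bound)
    show "integrable haar2 (\<lambda>p. of_real (B\<^sup>2) * (k (fst p) * k (snd p)))" using kk by (rule integrable_mult_right)
    have "(cmod (descend W p))\<^sup>2 \<le> B\<^sup>2 * cmod (k (fst p) * k (snd p))" for p
    proof (cases "(section_Hr (fst p), section_Hr (snd p)) \<in> slab R")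
      case True
      then have "k (fst p) * k (snd p) = 1"
        by (auto simp: k_def i_def slab_def section_Hr_def abs_le_iff indicator_def)
      then show ?thesis using power_mono[OF B(2)[of p], of 2] by simp
    next
      case False
      then show ?thesis using R by (simp add: descend_def)
    qed
    then show "AE p in haar2. norm ((cmod (descend W p))\<^sup>2) \<le> norm (of_real (B\<^sup>2) * (k (fst p) * k (snd p)))"
      by (intro AE_I2) (simp add: norm_mult norm_power)
  qed measurable
qed

lemma transl2_inver2_cancel:
  assumes "g \<in> carrier Hr2"
  shows "transl2 (inver2 g) (transl2 g s) = s"
proof -
  have *: "transl (inver a) (transl a t) = t" if a: "a \<in> carrier Hr" for a t
  proof -
    obtain b w c where a_eq: "a = (b, w, c)" and w: "cmod w = 1" using a by (cases a) (auto simp: carrier_Hr)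
    obtain y z x where t: "t = (y, z, x)" by (cases t)
    have "cnj w * w = 1" using complex_norm_square[of w] w by (simp add: mult.commute)
    moreover have "cis (c * b) * (cis (c * y) * cis (- c * (b + y))) = 1"
      by (simp add: cis_mult algebra_simps)
    ultimately have "cnj w * cis (c * b) * (w * z * cis (c * y)) * cis (- c * (b + y)) = z"
      by (metis (no_types, lifting) mult.assoc mult.commute mult.right_neutral)
    then show ?thesis by (simp add: a_eq t transl_def inver_def)
  qed
  from assms show ?thesis
    by (cases g; cases s) (simp add: transl2_def inver2_def *)
qed

text \<open>With the resolvents inverted in both factors, \<open>u g\<close> is the integral of
  \<open>\<xi> s\<close> times the value of \<open>W\<close> at \<open>g s\<close>. Left invariance
  moves \<open>g\<close> onto \<xi>, which gives a coefficient of the regular representation with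
  \<eta> the conjugate of \<open>W\<close>.\<close>

theorem test_function_represented:
  assumes u: "u \<in> test_functions_Hr2"
  obtains \<xi> \<eta> where "represents Hr2 haar2 \<xi> \<eta> u"
proof -
  obtain U where U: "test_lift U" and uU: "\<And>p. p \<in> carrier Hr2 \<Longrightarrow> u p = descend U p"
    by (rule test_function_descend[OF u]) blast
  obtain V where V: "test_lift V" and UV: "\<And>g h. g \<in> carrier Hr \<Longrightarrow> h \<in> carrier Hr \<Longrightarrow>
    descend U (g, h) = (LINT s|haar_Hr. left_kernel s * descend V (transl g s, h))"
    by (rule descend_resolvent_fst[OF U]) blast
  obtain W where W: "test_lift W" and VW: "\<And>g h. g \<in> carrier Hr \<Longrightarrow> h \<in> carrier Hr \<Longrightarrow>
    descend V (g, h) = (LINT s|haar_Hr. left_kernel s * descend W (g, transl h s))"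
    by (rule descend_resolvent_snd[OF V]) blast
  note [measurable] = measurable_descend[OF W]
  obtain B where B: "0 \<le> B" "\<And>p. cmod (descend W p) \<le> B" by (rule descend_bounded[OF W]) blast
  define \<xi> where "\<xi> p = left_kernel (fst p) * left_kernel (snd p)" for p
  have \<xi>_int: "integrable haar2 \<xi>"
    unfolding \<xi>_def by (intro integrable_pair_mult(1) sigma_finite_haar_Hr left_kernel_integrable)
  have [measurable]: "\<xi> \<in> borel_measurable haar2" using \<xi>_int by auto
  have \<xi>: "\<xi> \<in> L2 haar2"
  proof (rule L2I)
    have "integrable haar2 (\<lambda>p. of_real ((cmod (left_kernel (fst p)))\<^sup>2) * complex_of_real ((cmod (left_kernel (snd p)))\<^sup>2))"
      by (intro integrable_pair_mult(1)[where f = "\<lambda>g. of_real ((cmod (left_kernel g))\<^sup>2)" and g = "\<lambda>g. of_real ((cmod (left_kernel g))\<^sup>2)"]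
          sigma_finite_haar_Hr integrable_of_real L2_integrable left_kernel_L2)
    from integrable_norm[OF this] show "integrable haar2 (\<lambda>p. (cmod (\<xi> p))\<^sup>2)"
      by (simp add: \<xi>_def norm_mult norm_power power_mult_distrib)
  qed measurable
  define \<eta> where "\<eta> p = cnj (descend W p)" for p
  have \<eta>: "\<eta> \<in> L2 haar2" using descend_L2[OF W] by (auto simp: L2_def \<eta>_def[abs_def])
  have "u g = L2_inner haar2 (left_regular Hr2 g \<xi>) \<eta>" if g: "g \<in> carrier Hr2" for g
  proof -
    obtain a b where ab: "g = (a, b)" "a \<in> carrier Hr" "b \<in> carrier Hr" using g by auto
    have [measurable]: "(\<lambda>_. g) \<in> measurable M haar2" "(\<lambda>_. inver2 g) \<in> measurable M haar2" for M :: "'c measure"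
      using g inver2_carrier[OF g] by (auto intro!: measurable_const simp: space_haar2 simp del: carrier_DirProd)
    have int: "integrable haar2 (\<lambda>s. \<xi> s * descend W (transl2 g s))"
    proof (rule Bochner_Integration.integrable_bound)
      show "integrable haar2 (\<lambda>s. \<xi> s * of_real B)" using \<xi>_int by simp
      show "AE s in haar2. cmod (\<xi> s * descend W (transl2 g s)) \<le> cmod (\<xi> s * of_real B)"
        using B by (intro AE_I2) (simp add: norm_mult mult_left_mono)
    qed measurable
    interpret HH: pair_sigma_finite haar_Hr haar_Hr
      using sigma_finite_haar_Hr by (simp add: pair_sigma_finite_def)
    have "u g = (LINT s|haar_Hr. left_kernel s * descend V (transl a s, b))"
      using uU[OF g] UV[OF ab(2,3)] by (simp add: ab)
    also have "\<dots> = (LINT s|haar_Hr. left_kernel s * (LINT t|haar_Hr. left_kernel t * descend W (transl a s, transl b t)))"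
      using ab by (intro Bochner_Integration.integral_cong) (simp_all add: VW transl_carrier space_haar_Hr)
    also have "\<dots> = (LINT s|haar_Hr. LINT t|haar_Hr. \<xi> (s, t) * descend W (transl2 g (s, t)))"
      unfolding integral_mult_right_zero[symmetric] by (simp add: \<xi>_def transl2_def ab mult.assoc)
    also have "\<dots> = (LINT s|haar2. \<xi> s * descend W (transl2 g s))"
      by (rule HH.integral_fst'[OF int])
    also have "\<dots> = (LINT s|haar2. \<xi> (transl2 (inver2 g) (transl2 g s)) * descend W (transl2 g s))"
      by (simp only: transl2_inver2_cancel[OF g])
    also have "\<dots> = (LINT s|haar2. \<xi> (transl2 (inver2 g) s) * descend W s)"
      by (rule integral_haar2_transl2[OF _ g, of "\<lambda>s. \<xi> (transl2 (inver2 g) s) * descend W s"]) measurable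
    finally show ?thesis by (simp add: L2_inner_def left_regular_eq[OF g] \<eta>_def)
  qed
  then have "represents Hr2 haar2 \<xi> \<eta> u" using \<xi> \<eta> unfolding represents_def by blast
  then show ?thesis by (rule that)
qed

section \<open>Linearity of the functionals and conclusion\<close>

text \<open>Splitting the two integrals requires integrability, which is supplied by the boundedness
  of represented functions and the integrability of \<open>v\<close>.\<close>

lemma beta_add:
  assumes v: "integrable haar_Hr v" and rep: "represents Hr2 haar2 \<xi> \<eta> u" and rep': "represents Hr2 haar2 \<xi>' \<eta>' u'"
  shows "beta v n (\<lambda>g. u g + u' g) = beta v n u + beta v n u'"
proof -
  have main: "integrable circle_measure (\<lambda>w. w powi (- n) * f (transl g (0, cnj w, 0), inver g))"
      "integrable haar_Hr (\<lambda>g. v g * (LINT w|circle_measure. w powi (- n) * f (transl g (0, cnj w, 0), inver g)))"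
    if rep: "represents Hr2 haar2 \<xi> \<eta> f" and g: "g \<in> carrier Hr" for f \<xi> \<eta> g
  proof -
    note [measurable] = represents_measurable[OF rep] borel_measurable_integrable[OF v]
    define B where "B = L2_norm haar2 \<xi> * L2_norm haar2 \<eta>"
    have B0: "0 \<le> B" by (simp add: B_def)
    define k where "k g w = w powi (- n) * f (transl g (0, cnj w, 0), inver g)" for g w
    have kB: "cmod (k g w) \<le> B" if "cmod w = 1" "g \<in> carrier Hr" for g w
    proof -
      have "(transl g (0, cnj w, 0), inver g) \<in> carrier Hr2"
        using that by (auto intro!: transl_carrier inver_carrier) (simp add: carrier_Hr)
      from represents_bounded[OF rep this] that show ?thesis
        by (simp add: k_def norm_mult powi_norm_1 B_def)
    qed
    have km: "k g \<in> borel_measurable circle_measure" if "g \<in> carrier Hr" for g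
    proof -
      note [measurable] = measurable_const_haar[OF that]
      show ?thesis unfolding k_def by measurable
    qed
    have ki: "integrable circle_measure (k g)" if "g \<in> carrier Hr" for g
      by (rule circle_integrable_bounded[OF km[OF that] kB]) (use that in auto)
    show "integrable circle_measure (\<lambda>w. w powi (- n) * f (transl g (0, cnj w, 0), inver g))"
      using ki[OF g] by (simp add: k_def[abs_def])
    show "integrable haar_Hr (\<lambda>g. v g * (LINT w|circle_measure. w powi (- n) * f (transl g (0, cnj w, 0), inver g)))"
    proof (rule Bochner_Integration.integrable_bound)
      show "integrable haar_Hr (\<lambda>g. v g * of_real B)" using v by simp
      have "cmod (LINT w|circle_measure. k g w) \<le> B" if g: "g \<in> carrier Hr" for g
      proof -
        have "cmod (LINT w|circle_measure. k g w) \<le> (LINT w|circle_measure. cmod (k g w))" by (rule integral_norm_bound)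
        also have "\<dots> \<le> (LINT w|circle_measure. B)"
          by (intro integral_mono integrable_norm ki g) (use kB[OF _ g] in auto)
        finally show ?thesis using circle.prob_space by simp
      qed
      then show "AE g in haar_Hr. cmod (v g * (LINT w|circle_measure. w powi (- n) * f (transl g (0, cnj w, 0), inver g))) \<le> cmod (v g * of_real B)"
        using B0 by (intro AE_I2) (auto simp: norm_mult space_haar_Hr k_def intro!: mult_left_mono)
    qed measurable
  qed
  \<comment> \<open>A point of the carrier that discharges the premise of the second fact in
    \<open>main\<close>.\<close>
  have 1: "\<one>\<^bsub>Hr\<^esub> \<in> carrier Hr" by (simp add: Hr_def)
  have "beta v n (\<lambda>g. u g + u' g) = (LINT g|haar_Hr. v g * (LINT w|circle_measure. w powi (- n) * u (transl g (0, cnj w, 0), inver g))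
      + v g * (LINT w|circle_measure. w powi (- n) * u' (transl g (0, cnj w, 0), inver g)))"
    unfolding beta_def
  proof (rule Bochner_Integration.integral_cong)
    fix g assume "g \<in> space haar_Hr"
    then have g: "g \<in> carrier Hr" by (simp add: space_haar_Hr)
    show "v g * (LINT w|circle_measure. w powi (- n) * (u (transl g (0, cnj w, 0), inver g) + u' (transl g (0, cnj w, 0), inver g)))
       = v g * (LINT w|circle_measure. w powi (- n) * u (transl g (0, cnj w, 0), inver g)) + v g * (LINT w|circle_measure. w powi (- n) * u' (transl g (0, cnj w, 0), inver g))"
      unfolding distrib_left Bochner_Integration.integral_add[OF main(1)[OF rep g] main(1)[OF rep' g]] ..
  qed simp
  also have "\<dots> = beta v n u + beta v n u'"
    unfolding beta_def by (rule Bochner_Integration.integral_add[OF main(2)[OF rep 1] main(2)[OF rep' 1]])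
  finally show ?thesis .
qed

text \<open>Valid for arbitrary \<open>u\<close>, because a scalar can be pulled out even of a
  divergent integral, whose value is 0.\<close>

lemma beta_scale: "beta v n (\<lambda>g. c * u g) = c * beta v n u"
proof -
  have "beta v n (\<lambda>g. c * u g) = (LINT g|haar_Hr. c * (v g * (LINT w|circle_measure. w powi (- n) * u (transl g (0, cnj w, 0), inver g))))"
    unfolding beta_def integral_mult_right_zero[symmetric] by (simp only: mult_ac)
  then show ?thesis unfolding beta_def by (simp only: integral_mult_right_zero)
qed

theorem theorem2p6:
  fixes v1 v2 :: "real \<Rightarrow> complex" and v :: "real \<times> complex \<times> real \<Rightarrow> complex"
  assumes "integrable lborel v1" and "integrable lborel v2"
    and "\<exists>C. AE x in lborel. cmod (v1 x) \<le> C"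
    and "integrable lborel (fourier v2)"
    and "v = (\<lambda>(y, z, x). v1 x * v2 y)"
  shows "\<exists>S \<in> group_vN (Hr \<times>\<times> Hr) (haar_Hr \<Otimes>\<^sub>M haar_Hr).
           \<forall>u \<in> test_functions_Hr2.
             vN_apply (Hr \<times>\<times> Hr) (haar_Hr \<Otimes>\<^sub>M haar_Hr) S u =
             (LINT g|haar_Hr. deriv_fst Hr exp_Z u (g, inv\<^bsub>Hr\<^esub> g) * v g)"
proof -
  from assms(3) obtain C' where C': "AE x in lborel. cmod (v1 x) \<le> C'" by blast
  define C where "C = max C' 0"
  have C: "AE x in lborel. cmod (v1 x) \<le> C" "0 \<le> C"
    using C' by (auto simp: C_def elim: eventually_mono)
  define b where "b N u = - (\<Sum>n\<in>{- int N..int N}. \<i> * of_int n * beta v n u)" for N u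
  have v: "integrable haar_Hr v"
  proof -
    have "integrable (plane \<Otimes>\<^sub>M circle_measure) (\<lambda>p. (v2 (fst (fst p)) * v1 (snd (fst p))) * 1)"
      by (intro integrable_pair_mult(1)[where g = "\<lambda>_. 1" and f = "\<lambda>q. v2 (fst q) * v1 (snd q)"] integrable_pair_mult(1)[of lborel lborel v2 v1]
          sigma_finite_plane sigma_finite_circle assms(1,2) lborel.sigma_finite_measure_axioms) simp
    moreover have "v \<in> borel_measurable haar_Hr"
    proof -
      have [measurable]: "v1 \<in> borel_measurable borel" "v2 \<in> borel_measurable borel" using assms(1,2) by auto
      have "(\<lambda>g. v1 (snd (snd g)) * v2 (fst g)) \<in> borel_measurable haar_Hr" by measurable
      then show ?thesis by (simp add: assms(5) case_prod_beta')
    qed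
    ultimately show ?thesis
      using mpres_chart1 integrable_distr_eq[of chart1 "plane \<Otimes>\<^sub>M circle_measure" haar_Hr v]
      by (simp add: mpres_def assms(5) chart1_def mult.commute)
  qed
  obtain S where S: "S \<in> group_vN Hr2 haar2"
    and Sb: "\<And>u l \<xi> \<eta>. represents Hr2 haar2 \<xi> \<eta> u \<Longrightarrow> (\<lambda>N. b N u) \<longlonglongrightarrow> l \<Longrightarrow> vN_apply Hr2 haar2 S u = l"
  proof (rule group_vN_cluster_point[where G = Hr2 and M = haar2 and b = b and C = "C * (LINT s|lborel. cmod (fourier v2 s))"])
    show "left_regular Hr2 g \<xi> \<in> L2 haar2" if "g \<in> carrier Hr2" "\<xi> \<in> L2 haar2" for g \<xi>
      using that by (rule left_regular_L2)
    show "b N u = b N u'" if "\<And>g. g \<in> carrier Hr2 \<Longrightarrow> u g = u' g" for N u u'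
      unfolding b_def using beta_cong[of u u'] that by simp
    show "b N (\<lambda>g. u g + u' g) = b N u + b N u'"
      if "represents Hr2 haar2 \<xi> \<eta> u" "represents Hr2 haar2 \<xi>' \<eta>' u'" for N u u' \<xi> \<eta> \<xi>' \<eta>'
      unfolding b_def beta_add[OF v that] by (simp add: distrib_left sum.distrib)
    show "b N (\<lambda>g. c * u g) = c * b N u" for N u c
      unfolding b_def beta_scale by (simp add: sum_distrib_left mult_ac)
    show "cmod (b N u) \<le> C * (LINT s|lborel. cmod (fourier v2 s)) * L2_norm haar2 \<xi> * L2_norm haar2 \<eta>"
      if "represents Hr2 haar2 \<xi> \<eta> u" for N u \<xi> \<eta>
      using sum_beta_bound[OF assms(1) C assms(2,4) that, of "{- int N..int N}"] by (simp add: b_def assms(5))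
    show "0 \<le> C * (LINT s|lborel. cmod (fourier v2 s))" using C(2) by simp
  qed blast
  show ?thesis
  proof (rule bexI[OF _ S], rule ballI)
    fix u assume u: "u \<in> test_functions_Hr2"
    obtain \<xi> \<eta> where rep: "represents Hr2 haar2 \<xi> \<eta> u" by (rule test_function_represented[OF u])
    show "vN_apply Hr2 haar2 S u = (LINT g|haar_Hr. deriv_fst Hr exp_Z u (g, inv\<^bsub>Hr\<^esub> g) * v g)"
      by (rule Sb[OF rep]) (unfold b_def, rule sum_beta_tendsto[OF v u])
  qed
qed

end
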